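(* Let Assumption A1 hold and fix $\tau>0$. For each edge $e\in\mathcal E$, let $\widetilde u_e$ be the generalized Whittle–Matérn field with $\alpha=1$ and coefficients $\kappa_e,a_e$ on the metric graph consisting of the single edge $[0,\ell_e]$ (i.e. the solution of $(\kappa_e^2-\frac{d}{dt}(a_e\frac{d}{dt}))^{1/2}(\tau\widetilde u_e)=\mathcal W_e$ with Neumann conditions $\widetilde u_e'(0)=\widetilde u_e'(\ell_e)=0$ for the operator and $\mathcal W_e$ white noise on $L_2(e)$), with $\{\widetilde u_e:e\in\mathcal E\}$ mutually independent. Let $\widehat B^1\widetilde u=(\widetilde u_e(0),\widetilde u_e(\ell_e))_{e\in\mathcal E}\in\mathbb R^{2|\mathcal E|}$, and let $K$ be any matrix with $2|\mathcal E|$ columns such that for every $x=(x_{e,0},x_{e,\ell_e})_{e\in\mathcal E}\in\mathbb R^{2|\mathcal E|}$ one has $Kx=0$ if and only if $x_{e,b}=x_{e',b'}$ whenever the endpoint $b\in\{0,\ell_e\}$ of $e$ and the endpoint $b'$ of $e'$ are the same vertex of $\Gamma$. Define, for $t\in[0,\ell_e]$, $e\in\mathcal E$, $$u(t,e)=\widetilde u_e(t)-\mathbb E\big[\widetilde u_e(t)\,\big|\,\sigma(K\widehat B^1\widetilde u)\big]$$ (i.e. $\widetilde u$ conditioned on $K\widehat B^1\widetilde u=0$). Then $u$ is well defined as a field on $\Gamma$ (its values at a vertex do not depend on the edge) and it has the same law as the generalized Whittle–Matérn field on $\Gamma$ with $\alpha=1$, coefficients $\kappa,a$ and parameter $\tau$,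 i.e. the solution of $(\kappa^2-\nabla(a\nabla))^{1/2}(\tau u)=\mathcal W$ on $\Gamma$ with Kirchhoff vertex conditions.
   Context: $\Gamma$ is a compact connected metric graph (finite vertex set $\mathcal V$, finite edge set $\mathcal E$, each edge $e$ identified with $[0,\ell_e]$); $f_e$ restriction to $e$. $\partial_ef(v)$: derivative of $f_e$ at vertex $v$ pointing into $e$; $\mathcal E_v$: edges at $v$. Assumption A1: $\kappa\in L^\infty(\Gamma)$, $\operatorname{ess\,inf}\kappa\ge\kappa_0>0$; $a:\Gamma\to\mathbb R$ Lipschitz, $a\ge a_0>0$. On a compact metric graph $G$ with coefficients satisfying A1, $L$ is the operator $(Lf)_e=-(a_ef_e')'+\kappa_e^2f_e$ with domain $\{f\in\bigoplus_eH^2(e)\cap C(G):\sum_{e\in\mathcal E_v}\partial_ef(v)=0\ \forall v\}$ (Kirchhoff conditions; for a single edge these are Neumann conditions); it is self-adjoint positive definite with compact inverse and eigenpairs $(\lambda_k,e_k)$. The generalized Whittle–Matérn field with exponent $\alpha>1/2$ and $\tau>0$ is the solution of $L^{\alpha/2}(\tau u)=\mathcal W$ with $\mathcal W$ Gaussian white noise on $L_2(G)$, i.e. $u=\tau^{-1}\sum_k\lambda_k^{-\alpha/2}\xi_ke_k$ with $\xi_k$ i.i.d. $N(0,1)$; here $\nabla(a\nabla)$ denotes the edgewise operator $f\mapsto(a_ef_e')'$. *)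

theory Defs
  imports "HOL-Probability.Probability"
begin

text \<open>A compact metric graph: finite edge type 'e, vertex type 'v, each edge e is
  identified with [0, len e], starting at vertex src e (t = 0) and ending at tgt e (t = len e).
  Edge endpoints are indexed by 'e \<times> bool: (e,False) is t = 0, (e,True) is t = len e.
  Functions on the graph are represented edgewise as f :: 'e \<Rightarrow> real \<Rightarrow> real.\<close>

definition graph_vertices :: "('e \<Rightarrow> 'v) \<Rightarrow> ('e \<Rightarrow> 'v) \<Rightarrow> 'v set" where
  "graph_vertices src tgt = range src \<union> range tgt"

definition connected_metric_graph ::
  "('e::finite \<Rightarrow> 'v) \<Rightarrow> ('e \<Rightarrow> 'v) \<Rightarrow> ('e \<Rightarrow> real) \<Rightarrow> bool" where
  "connected_metric_graph src tgt len \<longleftrightarrow>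
     (\<forall>e. 0 < len e) \<and>
     (\<forall>v\<in>graph_vertices src tgt. \<forall>w\<in>graph_vertices src tgt.
        (v, w) \<in> (\<Union>e. {(src e, tgt e), (tgt e, src e)})\<^sup>*)"

definition endpt :: "('e \<Rightarrow> 'v) \<Rightarrow> ('e \<Rightarrow> 'v) \<Rightarrow> 'e \<times> bool \<Rightarrow> 'v" where
  "endpt src tgt j = (if snd j then tgt (fst j) else src (fst j))"

definition endpt_pos :: "('e \<Rightarrow> real) \<Rightarrow> 'e \<times> bool \<Rightarrow> real" where
  "endpt_pos len j = (if snd j then len (fst j) else 0)"

text \<open>Value of an edgewise function at an edge endpoint.\<close>
definition at_endpt :: "('e \<Rightarrow> real) \<Rightarrow> ('e \<Rightarrow> real \<Rightarrow> 'a) \<Rightarrow> 'e \<times> bool \<Rightarrow> 'a" where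
  "at_endpt len f j = f (fst j) (endpt_pos len j)"

text \<open>L2 on [0,l] and weak derivatives on [0,l] (absolute continuity form).\<close>
definition L2_on :: "real \<Rightarrow> (real \<Rightarrow> real) \<Rightarrow> bool" where
  "L2_on l f \<longleftrightarrow> set_borel_measurable lborel {0..l} f \<and>
                  set_integrable lborel {0..l} (\<lambda>t. (f t)\<^sup>2)"

definition has_weak_deriv :: "real \<Rightarrow> (real \<Rightarrow> real) \<Rightarrow> (real \<Rightarrow> real) \<Rightarrow> bool" where
  "has_weak_deriv l f g \<longleftrightarrow> set_integrable lborel {0..l} g \<and>
     (\<forall>t\<in>{0..l}. f t = f 0 + (LBINT s:{0..t}. g s))"

definition H2_on :: "real \<Rightarrow> (real \<Rightarrow> real) \<Rightarrow> bool" where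
  "H2_on l f \<longleftrightarrow> L2_on l f \<and>
     (\<exists>g h. has_weak_deriv l f g \<and> L2_on l g \<and> has_weak_deriv l g h \<and> L2_on l h)"

text \<open>Inner product of L2(\<Gamma>).\<close>
definition graph_inner :: "('e::finite \<Rightarrow> real) \<Rightarrow> ('e \<Rightarrow> real \<Rightarrow> real) \<Rightarrow> ('e \<Rightarrow> real \<Rightarrow> real) \<Rightarrow> real" where
  "graph_inner len f h = (\<Sum>e\<in>UNIV. LBINT t:{0..len e}. f e t * h e t)"

definition graph_L2 :: "('e::finite \<Rightarrow> real) \<Rightarrow> ('e \<Rightarrow> real \<Rightarrow> real) \<Rightarrow> bool" where
  "graph_L2 len f \<longleftrightarrow> (\<forall>e. L2_on (len e) (f e))"

text \<open>(lam, phi) is an eigenpair of L f = -(a f')' + kappa^2 f with domain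
  edgewise H^2, continuity at the vertices and Kirchhoff conditions
  sum over e at v of (derivative of f_e at v pointing into e) = 0.
  Here g e is the (continuous) derivative of phi e, w e the derivative of a_e g_e.\<close>
definition kirchhoff_eigenpair ::
  "('e::finite \<Rightarrow> 'v) \<Rightarrow> ('e \<Rightarrow> 'v) \<Rightarrow> ('e \<Rightarrow> real) \<Rightarrow> ('e \<Rightarrow> real \<Rightarrow> real) \<Rightarrow>
   ('e \<Rightarrow> real \<Rightarrow> real) \<Rightarrow> real \<Rightarrow> ('e \<Rightarrow> real \<Rightarrow> real) \<Rightarrow> bool" where
  "kirchhoff_eigenpair src tgt len \<kappa> a lam \<phi> \<longleftrightarrow>
     (\<forall>e. H2_on (len e) (\<phi> e)) \<and>
     (\<forall>j j'. endpt src tgt j = endpt src tgt j' \<longrightarrow> at_endpt len \<phi> j = at_endpt len \<phi> j') \<and>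
     (\<exists>g w. (\<forall>e. has_weak_deriv (len e) (\<phi> e) (g e) \<and> L2_on (len e) (g e) \<and>
                 has_weak_deriv (len e) (\<lambda>t. a e t * g e t) (w e) \<and> L2_on (len e) (w e) \<and>
                 (AE t in lborel. t \<in> {0..len e} \<longrightarrow>
                     - w e t + (\<kappa> e t)\<^sup>2 * \<phi> e t = lam * \<phi> e t)) \<and>
            (\<forall>v. (\<Sum>e\<in>{e. src e = v}. g e 0) + (\<Sum>e\<in>{e. tgt e = v}. - g e (len e)) = 0))"

text \<open>A complete orthonormal system of eigenfunctions of L in L2(\<Gamma>).\<close>
definition eigenbasis ::
  "('e::finite \<Rightarrow> 'v) \<Rightarrow> ('e \<Rightarrow> 'v) \<Rightarrow> ('e \<Rightarrow> real) \<Rightarrow> ('e \<Rightarrow> real \<Rightarrow> real) \<Rightarrow>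
   ('e \<Rightarrow> real \<Rightarrow> real) \<Rightarrow> (nat \<Rightarrow> real) \<Rightarrow> (nat \<Rightarrow> 'e \<Rightarrow> real \<Rightarrow> real) \<Rightarrow> bool" where
  "eigenbasis src tgt len \<kappa> a lam \<phi> \<longleftrightarrow>
     (\<forall>k. kirchhoff_eigenpair src tgt len \<kappa> a (lam k) (\<phi> k)) \<and>
     (\<forall>k k'. graph_inner len (\<phi> k) (\<phi> k') = (if k = k' then 1 else 0)) \<and>
     (\<forall>f. graph_L2 len f \<longrightarrow> (\<forall>k. graph_inner len f (\<phi> k) = 0) \<longrightarrow> graph_inner len f f = 0)"

text \<open>X (defined on the probability space M) is the generalized Whittle--Matern field with
  exponent alpha and parameter tau: X = tau^{-1} sum_k lam_k^{-alpha/2} xi_k phi_k,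
  with xi_k iid N(0,1); the series converges a.s. at every point of the graph.\<close>
definition WM_field ::
  "('e::finite \<Rightarrow> 'v) \<Rightarrow> ('e \<Rightarrow> 'v) \<Rightarrow> ('e \<Rightarrow> real) \<Rightarrow> ('e \<Rightarrow> real \<Rightarrow> real) \<Rightarrow>
   ('e \<Rightarrow> real \<Rightarrow> real) \<Rightarrow> real \<Rightarrow> real \<Rightarrow> 'w measure \<Rightarrow> ('e \<Rightarrow> real \<Rightarrow> 'w \<Rightarrow> real) \<Rightarrow> bool" where
  "WM_field src tgt len \<kappa> a \<alpha> \<tau> M X \<longleftrightarrow>
     (\<exists>lam \<phi> \<xi>. eigenbasis src tgt len \<kappa> a lam \<phi> \<and>
        prob_space.indep_vars M (\<lambda>_. borel) \<xi> UNIV \<and>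
        (\<forall>k. distr M borel (\<xi> k) = std_normal_distribution) \<and>
        (\<forall>e. \<forall>t\<in>{0..len e}. AE \<omega> in M.
           (\<lambda>n. \<Sum>k<n. lam k powr (-\<alpha>/2) * \<xi> k \<omega> * \<phi> k e t / \<tau>) \<longlonglongrightarrow> X e t \<omega>))"

text \<open>Canonical probability space carrying an iid N(0,1) sequence.\<close>
definition gauss_seq_space :: "(nat \<Rightarrow> real) measure" where
  "gauss_seq_space = PiM UNIV (\<lambda>_. std_normal_distribution)"

text \<open>Equality of finite-dimensional distributions of two fields on the graph.\<close>
definition same_fdd ::
  "('e \<Rightarrow> real) \<Rightarrow> 'w measure \<Rightarrow> ('e \<Rightarrow> real \<Rightarrow> 'w \<Rightarrow> real) \<Rightarrow>
   'w2 measure \<Rightarrow> ('e \<Rightarrow> real \<Rightarrow> 'w2 \<Rightarrow> real) \<Rightarrow> bool" where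
  "same_fdd len M X N Y \<longleftrightarrow>
     (\<forall>ps. (\<forall>p\<in>set ps. snd p \<in> {0..len (fst p)}) \<longrightarrow>
        distr M (PiM {..<length ps} (\<lambda>_. borel))
              (\<lambda>\<omega>. \<lambda>i\<in>{..<length ps}. X (fst (ps!i)) (snd (ps!i)) \<omega>) =
        distr N (PiM {..<length ps} (\<lambda>_. borel))
              (\<lambda>\<omega>. \<lambda>i\<in>{..<length ps}. Y (fst (ps!i)) (snd (ps!i)) \<omega>))"

text \<open>X has the law of the generalized Whittle--Matern field.\<close>
definition has_WM_law ::
  "('e::finite \<Rightarrow> 'v) \<Rightarrow> ('e \<Rightarrow> 'v) \<Rightarrow> ('e \<Rightarrow> real) \<Rightarrow> ('e \<Rightarrow> real \<Rightarrow> real) \<Rightarrow>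
   ('e \<Rightarrow> real \<Rightarrow> real) \<Rightarrow> real \<Rightarrow> real \<Rightarrow> 'w measure \<Rightarrow> ('e \<Rightarrow> real \<Rightarrow> 'w \<Rightarrow> real) \<Rightarrow> bool" where
  "has_WM_law src tgt len \<kappa> a \<alpha> \<tau> M X \<longleftrightarrow>
     (\<exists>Y. WM_field src tgt len \<kappa> a \<alpha> \<tau> gauss_seq_space Y \<and> same_fdd len M X gauss_seq_space Y)"

text \<open>The single-edge metric graph [0, l] (vertices False at 0, True at l);
  Kirchhoff conditions become Neumann conditions.\<close>
definition edge_WM_field ::
  "real \<Rightarrow> (real \<Rightarrow> real) \<Rightarrow> (real \<Rightarrow> real) \<Rightarrow> real \<Rightarrow> real \<Rightarrow> 'w measure \<Rightarrow> (real \<Rightarrow> 'w \<Rightarrow> real) \<Rightarrow> bool" where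
  "edge_WM_field l \<kappa> a \<alpha> \<tau> M X \<longleftrightarrow>
     WM_field (\<lambda>_::unit. False) (\<lambda>_. True) (\<lambda>_. l) (\<lambda>_. \<kappa>) (\<lambda>_. a) \<alpha> \<tau> M (\<lambda>_. X)"

text \<open>Assumption A1.\<close>
definition assumption_A1 ::
  "('e::finite \<Rightarrow> 'v) \<Rightarrow> ('e \<Rightarrow> 'v) \<Rightarrow> ('e \<Rightarrow> real) \<Rightarrow> ('e \<Rightarrow> real \<Rightarrow> real) \<Rightarrow>
   ('e \<Rightarrow> real \<Rightarrow> real) \<Rightarrow> bool" where
  "assumption_A1 src tgt len \<kappa> a \<longleftrightarrow>
     (\<exists>\<kappa>0 C. 0 < \<kappa>0 \<and> (\<forall>e. set_borel_measurable lborel {0..len e} (\<kappa> e) \<and>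
        (AE t in lborel. t \<in> {0..len e} \<longrightarrow> \<kappa>0 \<le> \<kappa> e t \<and> \<bar>\<kappa> e t\<bar> \<le> C))) \<and>
     (\<exists>a0 La. 0 < a0 \<and>
        (\<forall>e. La-lipschitz_on {0..len e} (a e) \<and> (\<forall>t\<in>{0..len e}. a0 \<le> a e t)) \<and>
        (\<forall>j j'. endpt src tgt j = endpt src tgt j' \<longrightarrow> at_endpt len a j = at_endpt len a j'))"

end

theory Submission
  imports Defs "HOL-Library.Function_Algebras" "HOL-Complex_Analysis.Great_Picard"
begin

text \<open>Let \<open>E x y\<close> be the energy form \<open>\<integral> a x' y' + \<kappa>\<^sup>2 x y\<close>. Since the square of the operator in the field
  equation is \<open>L\<close> for \<open>\<alpha> = 1\<close>, the field is the isonormal process of the Hilbert space \<open>(V, E)\<close> scaled by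
  \<open>1/\<tau>\<close>: its value at a point \<open>p\<close> corresponds to the vector of \<open>V\<close> that represents \<open>x \<mapsto> x p\<close>. For the
  independent edge fields \<open>V\<close> is the space \<open>H\<close> of all edgewise \<open>H\<^sup>1\<close> functions, for the field on \<open>\<Gamma>\<close> it is
  the subspace of the functions that are continuous at the vertices; the Kirchhoff conditions are the
  natural boundary conditions of \<open>E\<close> on this subspace. The vectors that correspond to \<open>K B u\<close> span its
  orthogonal complement in \<open>H\<close>, and subtracting a conditional expectation projects onto the complement of
  this span. The projection maps the representer of a point evaluation on \<open>H\<close> to the one on \<open>V\<close>, so the
  conditioned field has the covariances of the field on \<open>\<Gamma>\<close>.\<close>

section \<open>Positive semidefinite forms and the spectral theorem\<close>


text \<open>The fields are given as series over an unspecified eigenbasis, so their laws must be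
  expressed without it. The vectors \<psi>_k = \<phi>_k / sqrt(\<lambda>_k) are orthonormal for E,
  and the coefficient \<lambda>_k^(-1/2) \<phi>_k(p) equals E(r_p, \<psi>_k) for the representer r_p
  of the evaluation at p. By Parseval, a finite combination of field values has variance E(x, x) /
  \<tau>^2, with x the same combination of representers, whatever the basis. Characteristic
  functions of such combinations then determine the finite-dimensional laws. If m_r is the vector of
  the r-th constraint, E(m_r, x) is the r-th row of K applied to the endpoint values of x. Hence the
  complement of all m_r consists of the x whose endpoint values lie in the kernel of K, and by the
  hypothesis on K these are the functions continuous at the vertices. Two analytic facts carry the
  rest: point values are bounded by the energy, which yields representers, and the energy space
  embeds compactly into L2, which yields an eigenbasis on \<Gamma>. The eigenvectors are found
  variationally; their regularity and the Kirchhoff conditions are recovered from the weak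
  equation.\<close>

lemma squeeze_null:
  fixes f g :: "nat \<Rightarrow> real"
  assumes "\<And>n. 0 \<le> f n" "\<And>n. f n \<le> g n" "g \<longlonglongrightarrow> 0"
  shows "f \<longlonglongrightarrow> 0"
  using assms by (intro Lim_null_comparison[OF _ assms(3)]) simp

text \<open>Only semidefinite: a function on an edge is represented by a function on all reals, and
  its derivative by one of many versions, so nonzero vectors with \<open>E x x = 0\<close> occur.
  Limits and representers are therefore unique only up to null vectors.\<close>

locale psd_form =
  fixes V :: "'a::real_vector set" and E :: "'a \<Rightarrow> 'a \<Rightarrow> real"
  assumes V_subspace: "subspace V"
    and sym: "\<lbrakk>x \<in> V; y \<in> V\<rbrakk> \<Longrightarrow> E x y = E y x"
    and add_left: "\<lbrakk>x \<in> V; y \<in> V; z \<in> V\<rbrakk> \<Longrightarrow> E (x + y) z = E x z + E y z"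
    and scale_left: "\<lbrakk>x \<in> V; y \<in> V\<rbrakk> \<Longrightarrow> E (c *\<^sub>R x) y = c * E x y"
    and nonneg: "x \<in> V \<Longrightarrow> 0 \<le> E x x"
begin

lemma V_add [simp, intro]: "\<lbrakk>x \<in> V; y \<in> V\<rbrakk> \<Longrightarrow> x + y \<in> V"
  and V_scale [simp, intro]: "x \<in> V \<Longrightarrow> c *\<^sub>R x \<in> V"
  and V_zero [simp, intro]: "0 \<in> V"
  and V_diff [simp, intro]: "\<lbrakk>x \<in> V; y \<in> V\<rbrakk> \<Longrightarrow> x - y \<in> V"
  and V_neg [simp, intro]: "x \<in> V \<Longrightarrow> - x \<in> V"
  and V_sum [intro]: "(\<And>i. i \<in> I \<Longrightarrow> f i \<in> V) \<Longrightarrow> sum f I \<in> V"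
  using V_subspace by (auto simp: subspace_add subspace_scale subspace_0 subspace_diff subspace_neg subspace_sum)

lemma add_right: "\<lbrakk>x \<in> V; y \<in> V; z \<in> V\<rbrakk> \<Longrightarrow> E z (x + y) = E z x + E z y"
  using sym[of z "x + y"] sym[of z x] sym[of z y] by (simp add: add_left)

lemma scale_right: "\<lbrakk>x \<in> V; y \<in> V\<rbrakk> \<Longrightarrow> E x (c *\<^sub>R y) = c * E x y"
  using sym[of x "c *\<^sub>R y"] sym[of x y] by (simp add: scale_left)

lemma diff_left: "\<lbrakk>x \<in> V; y \<in> V; z \<in> V\<rbrakk> \<Longrightarrow> E (x - y) z = E x z - E y z"
  using add_left[of x "(-1) *\<^sub>R y" z] scale_left[of y z "-1"] by simp

lemma diff_right: "\<lbrakk>x \<in> V; y \<in> V; z \<in> V\<rbrakk> \<Longrightarrow> E z (x - y) = E z x - E z y"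
  using sym[of z "x - y"] sym[of z x] sym[of z y] by (simp add: diff_left)

lemma zero_left [simp]: "z \<in> V \<Longrightarrow> E 0 z = 0"
  using scale_left[of 0 z 0] by simp

lemma zero_right [simp]: "z \<in> V \<Longrightarrow> E z 0 = 0"
  using scale_right[of z 0 0] by simp

lemma sum_left: "\<lbrakk>\<And>i. i \<in> I \<Longrightarrow> f i \<in> V; z \<in> V\<rbrakk> \<Longrightarrow> E (sum f I) z = (\<Sum>i\<in>I. E (f i) z)"
  by (induction I rule: infinite_finite_induct) (auto simp: add_left V_sum)

lemma sum_right: "\<lbrakk>\<And>i. i \<in> I \<Longrightarrow> f i \<in> V; z \<in> V\<rbrakk> \<Longrightarrow> E z (sum f I) = (\<Sum>i\<in>I. E z (f i))"
  by (induction I rule: infinite_finite_induct) (auto simp: add_right V_sum)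

lemma square_diff: "\<lbrakk>x \<in> V; y \<in> V\<rbrakk> \<Longrightarrow> E (x - y) (x - y) = E x x - 2 * E x y + E y y"
  by (simp add: diff_left diff_right sym[of y x])

lemma square_add: "\<lbrakk>x \<in> V; y \<in> V\<rbrakk> \<Longrightarrow> E (x + y) (x + y) = E x x + 2 * E x y + E y y"
  by (simp add: add_left add_right sym[of y x])

lemma cauchy_schwarz:
  assumes x: "x \<in> V" and y: "y \<in> V"
  shows "(E x y)\<^sup>2 \<le> E x x * E y y"
proof (cases "E y y = 0")
  case True
  have "E x y = 0"
  proof (rule ccontr)
    assume nz: "E x y \<noteq> 0"
    \<comment> \<open>Chosen so that the energy of \<open>x - c *\<^sub>R y\<close>, which is affine
      in \<open>c\<close> because \<open>E y y = 0\<close>, becomes -1.\<close>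
    define c where "c = (E x x + 1) / (2 * E x y)"
    have "0 \<le> E (x - c *\<^sub>R y) (x - c *\<^sub>R y)" using x y by (intro nonneg) simp
    also have "\<dots> = E x x - 2 * c * E x y"
      using x y True by (simp add: square_diff scale_left scale_right)
    also have "\<dots> = -1" using nz by (simp add: c_def field_simps)
    finally show False by simp
  qed
  then show ?thesis using True by simp
next
  case False
  then have pos: "E y y > 0" using nonneg[OF y] by simp
  define c where "c = E x y / E y y"
  have "0 \<le> E (x - c *\<^sub>R y) (x - c *\<^sub>R y)" using x y by (intro nonneg) simp
  also have "\<dots> = E x x - 2 * c * E x y + c * c * E y y"
    using x y by (simp add: square_diff scale_left scale_right)
  also have "\<dots> = E x x - (E x y)\<^sup>2 / E y y"
    using pos by (simp add: c_def power2_eq_square field_simps)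
  finally show ?thesis using pos by (simp add: field_simps)
qed

lemma null_left: "\<lbrakk>x \<in> V; y \<in> V; E x x = 0\<rbrakk> \<Longrightarrow> E x y = 0"
  using cauchy_schwarz[of x y] by simp

lemma null_right: "\<lbrakk>x \<in> V; y \<in> V; E x x = 0\<rbrakk> \<Longrightarrow> E y x = 0"
  using cauchy_schwarz[of y x] by simp

lemma abs_le: "\<lbrakk>x \<in> V; y \<in> V\<rbrakk> \<Longrightarrow> \<bar>E x y\<bar> \<le> sqrt (E x x) * sqrt (E y y)"
  using real_sqrt_le_mono[OF cauchy_schwarz[of x y]] by (simp add: real_sqrt_mult)

lemma lim_left:
  assumes f: "\<And>n. f n \<in> V" and g: "g \<in> V" and h: "h \<in> V"
    and lim: "(\<lambda>n. E (f n - g) (f n - g)) \<longlonglongrightarrow> 0"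
  shows "(\<lambda>n. E (f n) h) \<longlonglongrightarrow> E g h"
proof -
  have "(\<lambda>n. sqrt (E (f n - g) (f n - g)) * sqrt (E h h)) \<longlonglongrightarrow> sqrt 0 * sqrt (E h h)"
    by (intro tendsto_intros lim)
  then have "(\<lambda>n. sqrt (E (f n - g) (f n - g)) * sqrt (E h h)) \<longlonglongrightarrow> 0" by simp
  then have "(\<lambda>n. E (f n - g) h) \<longlonglongrightarrow> 0"
    by (rule Lim_null_comparison[OF always_eventually[OF allI], rotated])
      (use f g h abs_le in simp)
  then have "(\<lambda>n. E (f n) h - E g h) \<longlonglongrightarrow> 0" using f g h by (simp add: diff_left)
  then show ?thesis by (simp add: LIM_zero_iff)
qed

lemma lim_square:
  assumes f: "\<And>n. f n \<in> V" and g: "g \<in> V"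
    and lim: "(\<lambda>n. E (f n - g) (f n - g)) \<longlonglongrightarrow> 0"
  shows "(\<lambda>n. E (f n) (f n)) \<longlonglongrightarrow> E g g"
proof -
  have eq: "E (f n) (f n) = E (f n - g) (f n - g) + 2 * E (f n) g - E g g" for n
    using f[of n] g by (simp add: square_diff)
  have "(\<lambda>n. E (f n - g) (f n - g) + 2 * E (f n) g - E g g) \<longlonglongrightarrow> 0 + 2 * E g g - E g g"
    by (intro tendsto_intros lim lim_left f g)
  then show ?thesis by (simp add: eq)
qed

text \<open>Gram-Schmidt without a Gram matrix, since the \<open>m r\<close> may be dependent or
  null. The induction hypothesis is applied both to \<open>x\<close> and to the new vector
  \<open>m q\<close>, and \<open>m q\<close> is replaced by its residual \<open>y\<close>, which is
  orthogonal to the old vectors.\<close>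

lemma projection_exists:
  assumes "finite S" "\<And>r. r \<in> S \<Longrightarrow> m r \<in> V" "x \<in> V"
  shows "\<exists>\<gamma>. \<forall>r\<in>S. E (x - (\<Sum>s\<in>S. \<gamma> s *\<^sub>R m s)) (m r) = 0"
  using assms
proof (induction S arbitrary: x)
  case (insert q S)
  define P where "P = (\<lambda>\<gamma>. \<Sum>s\<in>S. \<gamma> s *\<^sub>R m s)"
  have P_in: "P \<gamma> \<in> V" for \<gamma> unfolding P_def using insert.prems by auto
  have mS: "\<And>r. r \<in> S \<Longrightarrow> m r \<in> V" and mq: "m q \<in> V" and xV: "x \<in> V" using insert.prems by auto
  obtain \<gamma> where \<gamma>: "\<And>r. r \<in> S \<Longrightarrow> E (x - P \<gamma>) (m r) = 0"
    using insert.IH[OF mS xV] unfolding P_def by blast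
  obtain \<delta> where \<delta>: "\<And>r. r \<in> S \<Longrightarrow> E (m q - P \<delta>) (m r) = 0"
    using insert.IH[OF mS mq] unfolding P_def by blast
  define y where "y = m q - P \<delta>"
  define z where "z = x - P \<gamma>"
  have yV: "y \<in> V" and zV: "z \<in> V" using xV mq P_in by (auto simp: y_def z_def)
  \<comment> \<open>If \<open>y\<close> is null, Cauchy-Schwarz makes every vector orthogonal to it,
    so the default coefficient 0 is correct.\<close>
  define t where "t = (if E y y = 0 then 0 else E z y / E y y)"
  \<comment> \<open>These coefficients rewrite \<open>P \<gamma> + t *\<^sub>R y\<close> in terms of
    the \<open>m s\<close>.\<close>
  define c where "c = (\<lambda>s. if s = q then t else \<gamma> s - t * \<delta> s)"
  have "(\<Sum>s\<in>insert q S. c s *\<^sub>R m s) = t *\<^sub>R m q + (\<Sum>s\<in>S. (\<gamma> s - t * \<delta> s) *\<^sub>R m s)"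
    using insert.hyps by (auto simp: c_def intro!: sum.cong)
  also have "\<dots> = P \<gamma> + t *\<^sub>R y"
    by (simp add: P_def y_def scaleR_diff_left sum_subtractf scaleR_diff_right scaleR_sum_right)
  finally have c: "x - (\<Sum>s\<in>insert q S. c s *\<^sub>R m s) = z - t *\<^sub>R y" by (simp add: z_def)
  have orth: "E (z - t *\<^sub>R y) (m r) = 0" if "r \<in> S" for r
    using \<gamma>[OF that] \<delta>[OF that] mS[OF that] yV zV
    by (simp add: diff_left scale_left y_def[symmetric] z_def[symmetric])
  have orth_y: "E (z - t *\<^sub>R y) y = 0"
  proof (cases "E y y = 0")
    case True
    then show ?thesis using zV yV by (simp add: null_right)
  next
    case False
    then show ?thesis using zV yV by (simp add: diff_left scale_left t_def)
  qed
  have "E (z - t *\<^sub>R y) (P \<delta>) = (\<Sum>r\<in>S. \<delta> r * E (z - t *\<^sub>R y) (m r))"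
    unfolding P_def using mS zV yV by (subst sum_right) (auto simp: scale_right)
  also have "\<dots> = 0" using orth by simp
  finally have "E (z - t *\<^sub>R y) (y + P \<delta>) = 0"
    using orth_y zV yV P_in by (simp add: add_right)
  then have "E (z - t *\<^sub>R y) (m q) = 0" by (simp add: y_def)
  then show ?case using orth c by (intro exI[of _ c]) simp
qed simp

end

section \<open>Orthonormal bases, Parseval and the Riesz representation\<close>

locale complete_form = psd_form +
  assumes complete: "\<lbrakk>\<And>n. f n \<in> V; \<And>e. e > 0 \<Longrightarrow> \<exists>N. \<forall>m\<ge>N. \<forall>n\<ge>N. E (f m - f n) (f m - f n) < e\<rbrakk>
     \<Longrightarrow> \<exists>g\<in>V. (\<lambda>n. E (f n - g) (f n - g)) \<longlonglongrightarrow> 0"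

locale orthonormal_basis = complete_form V E for V :: "'a::real_vector set" and E +
  fixes \<psi> :: "nat \<Rightarrow> 'a"
  assumes basis_in [simp, intro]: "\<psi> k \<in> V"
    and orthonormal: "E (\<psi> j) (\<psi> k) = (if j = k then 1 else 0)"
    and maximal: "\<lbrakk>x \<in> V; \<And>k. E x (\<psi> k) = 0\<rbrakk> \<Longrightarrow> E x x = 0"
begin

lemma comb_in [simp, intro]: "(\<Sum>k\<in>S. c k *\<^sub>R \<psi> k) \<in> V"
  by (intro V_sum V_scale basis_in)

lemma coeff_comb: "finite S \<Longrightarrow> E (\<Sum>k\<in>S. c k *\<^sub>R \<psi> k) (\<psi> j) = (if j \<in> S then c j else 0)"
  by (subst sum_left) (auto simp: scale_left orthonormal if_distrib sum.delta cong: if_cong)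

lemma square_comb: "finite S \<Longrightarrow> E (\<Sum>k\<in>S. c k *\<^sub>R \<psi> k) (\<Sum>k\<in>S. c k *\<^sub>R \<psi> k) = (\<Sum>k\<in>S. (c k)\<^sup>2)"
  by (subst sum_right) (auto simp: scale_right coeff_comb power2_eq_square)

lemma bessel: assumes "x \<in> V" shows "(\<Sum>k<n. (E x (\<psi> k))\<^sup>2) \<le> E x x"
proof -
  let ?s = "\<Sum>k<n. E x (\<psi> k) *\<^sub>R \<psi> k"
  have "E x ?s = (\<Sum>k<n. (E x (\<psi> k))\<^sup>2)"
    using assms by (subst sum_right) (auto simp: scale_right power2_eq_square)
  then show ?thesis
    using nonneg[of "x - ?s"] assms by (simp add: square_diff square_comb)
qed

lemma coeffs_summable: assumes "x \<in> V" shows "summable (\<lambda>k. (E x (\<psi> k))\<^sup>2)"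
  using bessel[OF assms] by (intro summableI_nonneg_bounded) auto

text \<open>Riesz-Fischer: by orthonormality the energy of a block of the series is the
  corresponding block of the sum of \<open>(c k)\<^sup>2\<close>, so the partial sums are
  Cauchy.\<close>

lemma series_converges:
  assumes "summable (\<lambda>k. (c k)\<^sup>2)"
  obtains s where "s \<in> V" "(\<lambda>n. E ((\<Sum>k<n. c k *\<^sub>R \<psi> k) - s) ((\<Sum>k<n. c k *\<^sub>R \<psi> k) - s)) \<longlonglongrightarrow> 0"
    "\<And>k. E s (\<psi> k) = c k"
proof -
  let ?s = "\<lambda>n. \<Sum>k<n. c k *\<^sub>R \<psi> k"
  have tail: "E (?s m - ?s n) (?s m - ?s n) = (\<Sum>k=n..<m. (c k)\<^sup>2)" if "n \<le> m" for m n
  proof -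
    have "?s m - ?s n = (\<Sum>k=n..<m. c k *\<^sub>R \<psi> k)"
      using sum_diff_nat_ivl[of 0 n m "\<lambda>k. c k *\<^sub>R \<psi> k"] that by (simp add: atLeast0LessThan)
    then show ?thesis by (simp add: square_comb)
  qed
  have "\<exists>N. \<forall>m\<ge>N. \<forall>n\<ge>N. E (?s m - ?s n) (?s m - ?s n) < e" if e: "e > 0" for e
  proof -
    obtain N where N: "\<And>m n. m \<ge> N \<Longrightarrow> norm (\<Sum>k=m..<n. (c k)\<^sup>2) < e"
      using assms[unfolded summable_Cauchy] e by meson
    have "E (?s m - ?s n) (?s m - ?s n) < e" if "m \<ge> N" "n \<ge> N" for m n
    proof (cases "n \<le> m")
      case True then show ?thesis using N[of n m] that by (simp add: tail)
    next
      case False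
      have "E (?s m - ?s n) (?s m - ?s n) = E (?s n - ?s m) (?s n - ?s m)"
        by (simp add: square_diff sym[of "?s m" "?s n"])
      then show ?thesis using N[of m n] that False by (simp add: tail)
    qed
    then show ?thesis by blast
  qed
  with complete[of ?s] obtain s where s: "s \<in> V" "(\<lambda>n. E (?s n - s) (?s n - s)) \<longlonglongrightarrow> 0" by auto
  have "E s (\<psi> k) = c k" for k
  proof -
    have "(\<lambda>n. E (?s n) (\<psi> k)) \<longlonglongrightarrow> E s (\<psi> k)" using s by (intro lim_left) auto
    moreover have "(\<lambda>n. E (?s n) (\<psi> k)) \<longlonglongrightarrow> c k"
      by (intro tendsto_eventually eventually_sequentiallyI[of "Suc k"]) (auto simp: coeff_comb)
    ultimately show ?thesis by (rule LIMSEQ_unique)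
  qed
  with s show thesis using that by blast
qed

text \<open>The series has some limit \<open>s\<close>, which need not be \<open>x\<close>. Both
  have the same coefficients, so \<open>s - x\<close> is null by \<open>maximal\<close>, and
  \<open>x\<close> is a limit as well.\<close>

lemma expansion:
  assumes x: "x \<in> V"
  shows "(\<lambda>n. E ((\<Sum>k<n. E x (\<psi> k) *\<^sub>R \<psi> k) - x) ((\<Sum>k<n. E x (\<psi> k) *\<^sub>R \<psi> k) - x)) \<longlonglongrightarrow> 0"
proof -
  let ?s = "\<lambda>n. \<Sum>k<n. E x (\<psi> k) *\<^sub>R \<psi> k"
  obtain s where s: "s \<in> V" "(\<lambda>n. E (?s n - s) (?s n - s)) \<longlonglongrightarrow> 0" "\<And>k. E s (\<psi> k) = E x (\<psi> k)"
    using series_converges[OF coeffs_summable[OF x]] by blast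
  have null: "E (s - x) (s - x) = 0" using s x by (intro maximal) (auto simp: diff_left)
  have "E (?s n - x) (?s n - x) = E (?s n - s) (?s n - s)" for n
  proof -
    have "E (?s n - x) (?s n - x) = E ((?s n - s) + (s - x)) ((?s n - s) + (s - x))" by simp
    also have "\<dots> = E (?s n - s) (?s n - s) + 2 * E (?s n - s) (s - x) + E (s - x) (s - x)"
      using s(1) x by (intro square_add) auto
    also have "E (?s n - s) (s - x) = 0" using s(1) x null by (simp add: null_right)
    finally show ?thesis using null by simp
  qed
  then show ?thesis using s(2) by simp
qed

lemma parseval:
  assumes x: "x \<in> V" and y: "y \<in> V"
  shows "(\<lambda>k. E x (\<psi> k) * E y (\<psi> k)) sums E x y"
proof -
  have "(\<lambda>n. E (\<Sum>k<n. E x (\<psi> k) *\<^sub>R \<psi> k) y) \<longlonglongrightarrow> E x y"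
    by (intro lim_left expansion x y comb_in)
  also have "(\<lambda>n. E (\<Sum>k<n. E x (\<psi> k) *\<^sub>R \<psi> k) y) = (\<lambda>n. \<Sum>k<n. E x (\<psi> k) * E y (\<psi> k))"
    using y sym[OF basis_in y] by (subst sum_left) (simp_all add: scale_left)
  finally show ?thesis by (simp add: sums_def)
qed

text \<open>The representer is the series with coefficients \<open>l (\<psi> k)\<close>. Inserting
  its own partial sum into \<open>l_bound\<close> gives q^2 \<le> C q, where q is the sum of the
  squared coefficients so far; hence q \<le> C and the series converges.\<close>

lemma riesz:
  fixes l :: "'a \<Rightarrow> real"
  assumes l_add: "\<And>x y. \<lbrakk>x \<in> V; y \<in> V\<rbrakk> \<Longrightarrow> l (x + y) = l x + l y"
    and l_scale: "\<And>c x. x \<in> V \<Longrightarrow> l (c *\<^sub>R x) = c * l x"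
    and l_bound: "\<And>x. x \<in> V \<Longrightarrow> (l x)\<^sup>2 \<le> C * E x x"
  obtains r where "r \<in> V" "\<And>x. x \<in> V \<Longrightarrow> E r x = l x"
proof -
  have l0: "l 0 = 0" using l_scale[of 0 0] by simp
  have l_sum: "l (\<Sum>k\<in>S. c k *\<^sub>R \<psi> k) = (\<Sum>k\<in>S. c k * l (\<psi> k))" if "finite S" for c and S :: "nat set"
    using that by induction (auto simp: l0 l_add l_scale)
  have le: "(\<Sum>k<n. (l (\<psi> k))\<^sup>2) \<le> C" for n
  proof -
    let ?q = "\<Sum>k<n. (l (\<psi> k))\<^sup>2"
    have "?q\<^sup>2 \<le> C * ?q"
      using l_bound[of "\<Sum>k<n. l (\<psi> k) *\<^sub>R \<psi> k"] by (simp add: l_sum square_comb power2_eq_square)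
    moreover have "?q \<ge> 0" by (intro sum_nonneg) simp
    moreover have "C \<ge> 0" using l_bound[of "\<psi> 0"] by (simp add: orthonormal) (meson order_trans zero_le_power2)
    ultimately show ?thesis by (cases "?q = 0") (auto simp: power2_eq_square)
  qed
  have "summable (\<lambda>k. (l (\<psi> k))\<^sup>2)" 
    using le by (intro summableI_nonneg_bounded) auto
  then obtain r where r: "r \<in> V" "\<And>k. E r (\<psi> k) = l (\<psi> k)" using series_converges by metis
  have "E r x = l x" if x: "x \<in> V" for x
  proof -
    let ?s = "\<lambda>n. \<Sum>k<n. E x (\<psi> k) *\<^sub>R \<psi> k"
    have l_diff: "l (y - z) = l y - l z" if "y \<in> V" "z \<in> V" for y z
      using l_add[of y "(-1) *\<^sub>R z"] l_scale[of z "-1"] that by simp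
    have "(\<lambda>n. C * E (?s n - x) (?s n - x)) \<longlonglongrightarrow> 0"
      using tendsto_mult_right_zero[OF expansion[OF x]] by simp
    then have "(\<lambda>n. (l (?s n - x))\<^sup>2) \<longlonglongrightarrow> 0"
      by (rule squeeze_null[rotated 2]) (use x l_bound in simp_all)
    then have "(\<lambda>n. l (?s n - x)) \<longlonglongrightarrow> 0" by (simp add: tendsto_null_power)
    then have "(\<lambda>n. l (?s n) - l x) \<longlonglongrightarrow> 0" using x by (simp add: l_diff)
    then have "(\<lambda>n. l (?s n)) \<longlonglongrightarrow> l x" by (simp add: LIM_zero_iff)
    then have "(\<lambda>k. E x (\<psi> k) * E r (\<psi> k)) sums l x" by (simp add: l_sum sums_def r(2))
    then have "E x r = l x" using parseval[OF x r(1)] sums_unique2 by blast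
    then show ?thesis using sym[OF x r(1)] by simp
  qed
  then show thesis using that r(1) by blast
qed

end

text \<open>\<open>E\<close> will be the energy and \<open>B\<close> the L2 mass.
  \<open>compact\<close> is the compact embedding of the energy space into L2; it yields only a
  Cauchy subsequence because limits for \<open>B\<close> alone need not lie in \<open>V\<close>.
  \<open>infinite_dim\<close> keeps the recursion for the eigenvectors from running out of
  directions, as the basis is indexed by all naturals.\<close>

locale spectral_pair = complete_form V E + form2: psd_form V B
  for V :: "'a::real_vector set" and E B +
  fixes C :: real
  assumes C_pos: "0 < C" and dominated: "x \<in> V \<Longrightarrow> B x x \<le> C * E x x"
    and definite: "\<lbrakk>x \<in> V; B x x = 0\<rbrakk> \<Longrightarrow> E x x = 0"
    and compact: "\<lbrakk>\<And>n. f n \<in> V; \<And>n. E (f n) (f n) \<le> c\<rbrakk> \<Longrightarrow>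
      \<exists>r::nat\<Rightarrow>nat. strict_mono r \<and> (\<forall>e>0. \<exists>N. \<forall>m\<ge>N. \<forall>n\<ge>N. B (f (r m) - f (r n)) (f (r m) - f (r n)) < e)"
    and infinite_dim: "\<exists>b::nat\<Rightarrow>'a. (\<forall>n. b n \<in> V) \<and> (\<forall>m n. B (b m) (b n) = (if m = n then 1 else 0))"
begin

text \<open>Double counting. If every vector orthogonal to the k given ones were null, each of the k
  + 1 vectors \<open>b j\<close> would have squared coefficients along the \<open>\<phi> i\<close>
  summing to exactly 1; by Bessel each \<open>\<phi> i\<close> receives at most 1 in total, so k + 1
  \<le> k.\<close>

lemma exists_orthogonal:
  fixes \<phi> :: "nat \<Rightarrow> 'a"
  assumes \<phi>: "\<And>i. i < k \<Longrightarrow> \<phi> i \<in> V" and on: "\<And>i j. i < k \<Longrightarrow> j < k \<Longrightarrow> B (\<phi> i) (\<phi> j) = (if i = j then 1 else 0)"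
  obtains h where "h \<in> V" "\<And>i. i < k \<Longrightarrow> B h (\<phi> i) = 0" "B h h = 1"
proof -
  have "\<exists>h\<in>V. (\<forall>i<k. B h (\<phi> i) = 0) \<and> B h h \<noteq> 0"
  proof (rule ccontr)
    assume "\<not> ?thesis"
    then have null: "B h h = 0" if "h \<in> V" "\<And>i. i < k \<Longrightarrow> B h (\<phi> i) = 0" for h using that by blast
    obtain b :: "nat \<Rightarrow> 'a" where b: "\<And>n. b n \<in> V" "\<And>m n. B (b m) (b n) = (if m = n then 1 else 0)"
      using infinite_dim by auto
    have gen: "B x x - (\<Sum>i\<in>S. (B x (f i))\<^sup>2) = B (x - (\<Sum>i\<in>S. B x (f i) *\<^sub>R f i)) (x - (\<Sum>i\<in>S. B x (f i) *\<^sub>R f i))"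
      and gen': "\<And>j. j \<in> S \<Longrightarrow> B (x - (\<Sum>i\<in>S. B x (f i) *\<^sub>R f i)) (f j) = 0"
      if S: "finite S" and x: "x \<in> V" and f: "\<And>i. i \<in> S \<Longrightarrow> f i \<in> V"
        and fo: "\<And>i j. i \<in> S \<Longrightarrow> j \<in> S \<Longrightarrow> B (f i) (f j) = (if i = j then 1 else 0)"
      for S :: "nat set" and x f
    proof -
      let ?s = "\<Sum>i\<in>S. B x (f i) *\<^sub>R f i"
      have sV: "?s \<in> V" using f by auto
      have s1: "B ?s (f j) = B x (f j)" if "j \<in> S" for j
      proof -
        have "B ?s (f j) = (\<Sum>i\<in>S. B x (f i) * B (f i) (f j))"
          using f that by (subst form2.sum_left) (auto simp: form2.scale_left)
        also have "\<dots> = (\<Sum>i\<in>S. if i = j then B x (f i) else 0)"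
          using fo that by (intro sum.cong) auto
        finally show ?thesis using S that by simp
      qed
      have s2: "B x ?s = (\<Sum>i\<in>S. (B x (f i))\<^sup>2)"
        using f x by (subst form2.sum_right) (auto simp: form2.scale_right power2_eq_square)
      have s3: "B ?s ?s = (\<Sum>i\<in>S. (B x (f i))\<^sup>2)"
        using f s1 sV by (subst (1) form2.sum_right) (auto simp: form2.scale_right power2_eq_square intro!: sum.cong)
      show "B x x - (\<Sum>i\<in>S. (B x (f i))\<^sup>2) = B (x - ?s) (x - ?s)"
        using sV x by (simp add: form2.square_diff s2 s3)
      show "\<And>j. j \<in> S \<Longrightarrow> B (x - ?s) (f j) = 0"
        using sV x f by (simp add: form2.diff_left s1)
    qed
    have one: "(\<Sum>i<k. (B (b j) (\<phi> i))\<^sup>2) = 1" for j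
    proof -
      let ?h = "b j - (\<Sum>i<k. B (b j) (\<phi> i) *\<^sub>R \<phi> i)"
      have "B ?h ?h = 0"
        using gen'[of "{..<k}" "b j" \<phi>] b \<phi> on by (intro null) (auto intro!: form2.V_diff form2.V_sum)
      then show ?thesis using gen[of "{..<k}" "b j" \<phi>] b \<phi> on by auto
    qed
    have le: "(\<Sum>j\<le>k. (B (b j) (\<phi> i))\<^sup>2) \<le> 1" if "i < k" for i
    proof -
      let ?h = "\<phi> i - (\<Sum>j\<le>k. B (\<phi> i) (b j) *\<^sub>R b j)"
      have "0 \<le> B ?h ?h" using b \<phi>[OF that] by (intro form2.nonneg) auto
      also have "B ?h ?h = 1 - (\<Sum>j\<le>k. (B (\<phi> i) (b j))\<^sup>2)"
        using gen[of "{..k}" "\<phi> i" b] b \<phi>[OF that] on[OF that that] by simp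
      finally show ?thesis using b \<phi>[OF that] by (simp add: form2.sym[of "b _" "\<phi> i"])
    qed
    have "real (Suc k) = (\<Sum>j\<le>k. \<Sum>i<k. (B (b j) (\<phi> i))\<^sup>2)" by (simp add: one)
    also have "\<dots> = (\<Sum>i<k. \<Sum>j\<le>k. (B (b j) (\<phi> i))\<^sup>2)" by (rule sum.swap)
    also have "\<dots> \<le> (\<Sum>i<k. 1)" by (intro sum_mono le) simp
    finally show False by simp
  qed
  then obtain h where h: "h \<in> V" "\<And>i. i < k \<Longrightarrow> B h (\<phi> i) = 0" "B h h \<noteq> 0" by blast
  then have pos: "B h h > 0" using form2.nonneg[of h] by simp
  show thesis
    by (rule that[of "(1 / sqrt (B h h)) *\<^sub>R h"])
      (use h \<phi> pos in \<open>auto simp: form2.scale_left form2.scale_right field_simps\<close>)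
qed

text \<open>Direct method for the Rayleigh quotient. A minimizing sequence has bounded energy,
  \<open>compact\<close> makes a subsequence Cauchy for \<open>B\<close>, and the parallelogram law
  promotes this to Cauchy for \<open>E\<close>. The last conclusion is homogeneous in
  \<open>h\<close>, so vectors without mass need no exception.\<close>

lemma exists_minimizer:
  fixes \<phi> :: "nat \<Rightarrow> 'a"
  assumes \<phi>: "\<And>i. i < k \<Longrightarrow> \<phi> i \<in> V" and on: "\<And>i j. i < k \<Longrightarrow> j < k \<Longrightarrow> B (\<phi> i) (\<phi> j) = (if i = j then 1 else 0)"
  obtains x where "x \<in> V" "\<And>i. i < k \<Longrightarrow> B x (\<phi> i) = 0" "B x x = 1"
    "\<And>h. \<lbrakk>h \<in> V; \<And>i. i < k \<Longrightarrow> B h (\<phi> i) = 0\<rbrakk> \<Longrightarrow> E x x * B h h \<le> E h h"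
proof -
  define S where "S = {h \<in> V. (\<forall>i<k. B h (\<phi> i) = 0) \<and> B h h = 1}"
  define \<mu> where "\<mu> = (INF h\<in>S. E h h)"
  obtain h0 where "h0 \<in> V" "\<And>i. i < k \<Longrightarrow> B h0 (\<phi> i) = 0" "B h0 h0 = 1"
    by (rule exists_orthogonal[of k \<phi>, OF \<phi> on]) (assumption+, rule that)
  then have "h0 \<in> S" by (simp add: S_def)
  have bdd: "bdd_below ((\<lambda>h. E h h) ` S)" by (intro bdd_belowI[of _ 0]) (auto simp: S_def nonneg)
  have \<mu>_le: "\<mu> * B h h \<le> E h h" if h: "h \<in> V" "\<And>i. i < k \<Longrightarrow> B h (\<phi> i) = 0" for h
  proof (cases "B h h = 0")
    case True then show ?thesis using nonneg[OF h(1)] by simp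
  next
    case False
    then have pos: "B h h > 0" using form2.nonneg[OF h(1)] by simp
    define g where "g = (1 / sqrt (B h h)) *\<^sub>R h"
    have "g \<in> S" using h \<phi> pos by (auto simp: S_def g_def form2.scale_left form2.scale_right field_simps)
    then have "\<mu> \<le> E g g" unfolding \<mu>_def by (intro cINF_lower bdd)
    also have "E g g = E h h / B h h" using h pos by (simp add: g_def scale_left scale_right)
    finally show ?thesis using pos by (simp add: field_simps)
  qed
  have "\<exists>h\<in>S. E h h < \<mu> + 1 / real (Suc n)" for n :: nat
    using cInf_lessD[of "(\<lambda>h. E h h) ` S" "\<mu> + 1 / real (Suc n)"] \<open>h0 \<in> S\<close> unfolding \<mu>_def by auto
  then obtain f :: "nat \<Rightarrow> 'a" where f: "\<And>n. f n \<in> S" "\<And>n. E (f n) (f n) < \<mu> + 1 / real (Suc n)" by metis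
  have fV: "f n \<in> V" and f1: "B (f n) (f n) = 1" and fo: "i < k \<Longrightarrow> B (f n) (\<phi> i) = 0" for n i
    using f(1)[of n] by (auto simp: S_def)
  have "E (f n) (f n) \<le> \<mu> + 1" for n
    using f(2)[of n] by (rule order_trans[OF less_imp_le]) (simp add: divide_le_eq)
  from compact[of f, OF fV this] obtain r :: "nat \<Rightarrow> nat" where r: "strict_mono r"
    "\<And>e. e > 0 \<Longrightarrow> \<exists>N. \<forall>m\<ge>N. \<forall>n\<ge>N. B (f (r m) - f (r n)) (f (r m) - f (r n)) < e" by blast
  have \<mu>0: "\<mu> \<ge> 0" unfolding \<mu>_def using \<open>h0 \<in> S\<close> by (intro cINF_greatest) (auto simp: S_def nonneg)
  define g where "g = f \<circ> r"
  have gV: "g n \<in> V" and g1: "B (g n) (g n) = 1" and go: "i < k \<Longrightarrow> B (g n) (\<phi> i) = 0" for n i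
    using fV f1 fo by (auto simp: g_def)
  \<comment> \<open>The subsequence keeps the rate because \<open>n \<le> r n\<close>.\<close>
  have gE: "E (g n) (g n) \<le> \<mu> + 1 / real (Suc n)" for n
  proof -
    have "1 / real (Suc (r n)) \<le> 1 / real (Suc n)"
      using seq_suble[OF r(1), of n] by (intro divide_left_mono) auto
    then show ?thesis using f(2)[of "r n"] by (simp add: g_def)
  qed
  \<comment> \<open>Parallelogram law: the sum of two near-minimizers has \<open>B\<close>-square 4
    minus that of the difference, hence energy at least \<open>\<mu>\<close> times this, which
    leaves little energy for the difference.\<close>
  have par: "E (g m - g n) (g m - g n) \<le> 2 / real (Suc m) + 2 / real (Suc n) + \<mu> * B (g m - g n) (g m - g n)" for m n
  proof -
    have "\<mu> * B (g m + g n) (g m + g n) \<le> E (g m + g n) (g m + g n)"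
      using gV go \<phi> by (intro \<mu>_le) (auto simp: form2.add_left)
    moreover have "B (g m + g n) (g m + g n) = 4 - B (g m - g n) (g m - g n)"
      using gV by (simp add: form2.square_add form2.square_diff g1)
    moreover have "E (g m - g n) (g m - g n) = 2 * E (g m) (g m) + 2 * E (g n) (g n) - E (g m + g n) (g m + g n)"
      using gV by (simp add: square_add square_diff)
    moreover have "2 * E (g m) (g m) \<le> 2 * \<mu> + 2 / real (Suc m)" "2 * E (g n) (g n) \<le> 2 * \<mu> + 2 / real (Suc n)"
      using gE[of m] gE[of n] by auto
    ultimately show ?thesis by (simp add: right_diff_distrib)
  qed
  have "\<exists>N. \<forall>m\<ge>N. \<forall>n\<ge>N. E (g m - g n) (g m - g n) < e" if e: "e > 0" for e
  proof -
    \<comment> \<open>The denominator contains \<open>\<mu> + 1\<close> since \<open>\<mu>\<close>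
      may be 0. One half of \<open>e\<close> is spent on the \<open>B\<close> term of
      \<open>par\<close>, the other on its two rate terms.\<close>
    obtain N1 where N1: "\<And>m n. m \<ge> N1 \<Longrightarrow> n \<ge> N1 \<Longrightarrow> B (g m - g n) (g m - g n) < e / (2 * (\<mu> + 1))"
      using r(2)[of "e / (2 * (\<mu> + 1))"] e \<mu>0 unfolding g_def by auto
    obtain N2 where N2: "1 / real (Suc N2) < e / 8" using nat_approx_posE[of "e/8"] e by (metis divide_pos_pos zero_less_numeral)
    have "E (g m - g n) (g m - g n) < e" if mn: "m \<ge> max N1 N2" "n \<ge> max N1 N2" for m n
    proof -
      have "1 / real (Suc j) < e / 8" if "j \<ge> max N1 N2" for j
        using N2 that by (intro le_less_trans[OF _ N2] divide_left_mono) auto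
      from this[OF mn(1)] this[OF mn(2)] have "2 / real (Suc m) + 2 / real (Suc n) < e / 2" by simp
      moreover have "\<mu> * B (g m - g n) (g m - g n) \<le> (\<mu> + 1) * (e / (2 * (\<mu> + 1)))"
        using N1[of m n] mn \<mu>0 gV by (intro mult_mono form2.nonneg) auto
      moreover have "(\<mu> + 1) * (e / (2 * (\<mu> + 1))) = e / 2" using \<mu>0 by (simp add: field_simps)
      ultimately show ?thesis using par[of m n] by linarith
    qed
    then show ?thesis by blast
  qed
  from complete[OF gV this] obtain x where x: "x \<in> V" "(\<lambda>n. E (g n - x) (g n - x)) \<longlonglongrightarrow> 0" by blast
  have "(\<lambda>n. C * E (g n - x) (g n - x)) \<longlonglongrightarrow> 0"
    using tendsto_mult_right_zero[OF x(2)] by simp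
  then have xB: "(\<lambda>n. B (g n - x) (g n - x)) \<longlonglongrightarrow> 0"
    by (rule squeeze_null[rotated 2]) (use x gV dominated form2.nonneg in simp_all)
  have "(\<lambda>n. B (g n) (g n)) \<longlonglongrightarrow> B x x" using gV x(1) xB by (intro form2.lim_square)
  then have x1: "B x x = 1" by (simp add: g1 LIMSEQ_const_iff)
  have xo: "B x (\<phi> i) = 0" if "i < k" for i
    using form2.lim_left[OF gV x(1) \<phi>[OF that] xB] by (simp add: go[OF that] LIMSEQ_const_iff)
  have "(\<lambda>n. E (g n) (g n)) \<longlonglongrightarrow> E x x" using gV x by (intro lim_square)
  moreover have "(\<lambda>n. \<mu> + 1 / real (Suc n)) \<longlonglongrightarrow> \<mu> + 0" by (intro tendsto_intros LIMSEQ_Suc[OF lim_1_over_n])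
  ultimately have "E x x \<le> \<mu>" using LIMSEQ_le gE by (metis (no_types, lifting) add.right_neutral)
  then have "E x x * B h h \<le> E h h" if "h \<in> V" "\<And>i. i < k \<Longrightarrow> B h (\<phi> i) = 0" for h
    using \<mu>_le[OF that] mult_right_mono[OF _ form2.nonneg[OF that(1)]] order_trans by blast
  with x(1) xo x1 show thesis using that by blast
qed

text \<open>No variation is differentiated. Minimality says that \<open>E\<close> minus
  \<open>E x x\<close> times \<open>B\<close> is positive semidefinite on the complement
  \<open>W\<close> of the earlier eigenvectors. Since \<open>x\<close> is a null vector of this
  form, Cauchy-Schwarz annihilates its product with all of \<open>W\<close>. A general
  \<open>h\<close> differs from \<open>W\<close> by a combination of earlier eigenvectors, to which
  \<open>x\<close> is orthogonal in both forms.\<close>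

lemma eigenvector_of_minimizer:
  fixes \<phi> :: "nat \<Rightarrow> 'a"
  assumes \<phi>: "\<And>i. i < k \<Longrightarrow> \<phi> i \<in> V" and on: "\<And>i j. i < k \<Longrightarrow> j < k \<Longrightarrow> B (\<phi> i) (\<phi> j) = (if i = j then 1 else 0)"
    and eig: "\<And>i h. i < k \<Longrightarrow> h \<in> V \<Longrightarrow> E (\<phi> i) h = l i * B (\<phi> i) h"
    and x: "x \<in> V" "\<And>i. i < k \<Longrightarrow> B x (\<phi> i) = 0" "B x x = 1"
    and min: "\<And>h. \<lbrakk>h \<in> V; \<And>i. i < k \<Longrightarrow> B h (\<phi> i) = 0\<rbrakk> \<Longrightarrow> E x x * B h h \<le> E h h"
    and h: "h \<in> V"
  shows "E x h = E x x * B x h"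
proof -
  define W where "W = {h \<in> V. \<forall>i<k. B h (\<phi> i) = 0}"
  have WV: "y \<in> V" if "y \<in> W" for y using that by (simp add: W_def)
  have Q: "psd_form W (\<lambda>y z. E y z - E x x * B y z)"
  proof (rule psd_form.intro)
    show "subspace W"
      using \<phi> by (auto simp: W_def subspace_def form2.add_left form2.scale_left)
    show "E y z - E x x * B y z = E z y - E x x * B z y" if "y \<in> W" "z \<in> W" for y z
      using that[THEN WV] sym[of y z] form2.sym[of y z] by simp
    show "0 \<le> E y y - E x x * B y y" if "y \<in> W" for y
      using min[of y] that by (simp add: W_def)
    show "E (y + z) w - E x x * B (y + z) w = (E y w - E x x * B y w) + (E z w - E x x * B z w)"
      if "y \<in> W" "z \<in> W" "w \<in> W" for y z w
      by (simp only: add_left[OF that[THEN WV]] form2.add_left[OF that[THEN WV]] distrib_left)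
    show "E (c *\<^sub>R y) z - E x x * B (c *\<^sub>R y) z = c * (E y z - E x x * B y z)"
      if "y \<in> W" "z \<in> W" for c y z
      by (simp only: scale_left[OF that[THEN WV]] form2.scale_left[OF that[THEN WV]] right_diff_distrib mult.left_commute)
  qed
  define p where "p = (\<Sum>i<k. B h (\<phi> i) *\<^sub>R \<phi> i)"
  have pV: "p \<in> V" unfolding p_def using \<phi> by auto
  have pj: "B p (\<phi> j) = B h (\<phi> j)" if "j < k" for j
  proof -
    have "B p (\<phi> j) = (\<Sum>i<k. B h (\<phi> i) * B (\<phi> i) (\<phi> j))"
      unfolding p_def using \<phi> that by (subst form2.sum_left) (auto simp: form2.scale_left)
    also have "\<dots> = (\<Sum>i<k. if i = j then B h (\<phi> i) else 0)" using on that by (intro sum.cong) auto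
    finally show ?thesis using that by simp
  qed
  have hp: "h - p \<in> W" using h pV \<phi> by (simp add: W_def form2.diff_left pj)
  have xW: "x \<in> W" using x by (simp add: W_def)
  have "E x (h - p) - E x x * B x (h - p) = 0" by (rule psd_form.null_left[OF Q xW hp]) (simp add: x)
  moreover have "E x (\<phi> i) = 0" if "i < k" for i
    using eig[OF that x(1)] x(2)[OF that] sym[OF x(1) \<phi>[OF that]] form2.sym[OF x(1) \<phi>[OF that]] by simp
  then have "E x p = 0"
    unfolding p_def using \<phi> x by (subst sum_right) (auto simp: scale_right)
  moreover have "B x p = 0"
    unfolding p_def using \<phi> x by (subst form2.sum_right) (auto simp: form2.scale_right)
  ultimately show ?thesis using x h pV by (simp add: diff_right form2.diff_right)
qed

text \<open>The recursion records minimality as well, because completeness rests on it: a non-null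
  \<open>h\<close> orthogonal to all \<open>\<phi> k\<close> would bound all their energies, and a
  subsequence would be Cauchy for \<open>B\<close>, although distinct orthonormal vectors are at
  squared distance 2.\<close>

theorem spectral_basis:
  obtains \<phi> :: "nat \<Rightarrow> 'a" and \<mu> :: "nat \<Rightarrow> real" where "\<And>k. \<phi> k \<in> V" "\<And>j k. B (\<phi> j) (\<phi> k) = (if j = k then 1 else 0)"
    "\<And>k h. h \<in> V \<Longrightarrow> E (\<phi> k) h = \<mu> k * B (\<phi> k) h"
    "\<And>h. \<lbrakk>h \<in> V; \<And>k. B h (\<phi> k) = 0\<rbrakk> \<Longrightarrow> B h h = 0"
proof -
  define P where "P = (\<lambda>(\<phi> :: nat \<Rightarrow> 'a) k x. x \<in> V \<and> (\<forall>i<k. B x (\<phi> i) = 0) \<and> B x x = 1 \<and> (\<forall>h\<in>V. E x h = E x x * B x h)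
      \<and> (\<forall>h\<in>V. (\<forall>i<k. B h (\<phi> i) = 0) \<longrightarrow> E x x * B h h \<le> E h h))"
  have "\<exists>\<phi>. \<forall>k::nat. P \<phi> k (\<phi> k)"
  \<comment> \<open>\<open>P \<phi> k\<close> looks only at the values of \<open>\<phi>\<close>
    below \<open>k\<close>, which makes the recursion legitimate.\<close>
  proof (rule dependent_wellorder_choice)
    show "P f x r = P g x r" if "\<And>y. y < x \<Longrightarrow> f y = g y" for r f g and x :: nat
      using that by (auto simp: P_def)
    show "\<exists>r. P f x r" if prev: "\<And>y. y < x \<Longrightarrow> P f y (f y)" for x :: nat and f
    proof -
      have fV: "f i \<in> V" and f1: "B (f i) (f i) = 1" and fo: "j < i \<Longrightarrow> B (f i) (f j) = 0"
        and eig: "h \<in> V \<Longrightarrow> E (f i) h = E (f i) (f i) * B (f i) h" if "i < x" for i j h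
        using prev[OF that] unfolding P_def by blast+
      have on: "B (f i) (f j) = (if i = j then 1 else 0)" if "i < x" "j < x" for i j
        using f1[OF that(1)] fo[OF that(1), of j] fo[OF that(2), of i] form2.sym[OF fV[OF that(1)] fV[OF that(2)]]
        by (cases i j rule: linorder_cases) auto
      obtain y where y: "y \<in> V" "\<And>i. i < x \<Longrightarrow> B y (f i) = 0" "B y y = 1"
        "\<And>h. \<lbrakk>h \<in> V; \<And>i. i < x \<Longrightarrow> B h (f i) = 0\<rbrakk> \<Longrightarrow> E y y * B h h \<le> E h h"
        by (rule exists_minimizer[of x f, OF fV on]) (assumption+, rule that, assumption+, meson)
      have eq: "E y h = E y y * B y h" if "h \<in> V" for h
        by (rule eigenvector_of_minimizer[OF fV on eig y that])
      show ?thesis unfolding P_def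
        by (intro exI[of _ y] conjI ballI allI impI; (rule eq | rule y); simp)
    qed
  qed
  then obtain \<phi> where \<phi>': "\<forall>k. P \<phi> k (\<phi> k)" ..
  have \<phi>: "P \<phi> k (\<phi> k)" for k using \<phi>' ..
  note P = \<phi>[unfolded P_def]
  have \<phi>V: "\<phi> i \<in> V" for i by (rule P[THEN conjunct1])
  have \<phi>o: "B (\<phi> i) (\<phi> j) = 0" if "j < i" for i j
    by (rule P[THEN conjunct2, THEN conjunct1, rule_format, OF that])
  have \<phi>1: "B (\<phi> i) (\<phi> i) = 1" for i
    by (rule P[THEN conjunct2, THEN conjunct2, THEN conjunct1])
  have eig: "E (\<phi> i) h = E (\<phi> i) (\<phi> i) * B (\<phi> i) h" if "h \<in> V" for i h
    by (rule P[THEN conjunct2, THEN conjunct2, THEN conjunct2, THEN conjunct1, rule_format, OF that])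
  have min: "E (\<phi> i) (\<phi> i) * B h h \<le> E h h" if "h \<in> V" "\<And>j. B h (\<phi> j) = 0" for i h
    by (rule P[THEN conjunct2, THEN conjunct2, THEN conjunct2, THEN conjunct2, rule_format, OF that(1) that(2)])
  have on: "B (\<phi> i) (\<phi> j) = (if i = j then 1 else 0)" for i j
    using \<phi>1[of i] \<phi>o[of j i] \<phi>o[of i j] form2.sym[OF \<phi>V[of i] \<phi>V[of j]]
    by (cases i j rule: linorder_cases) auto
  have null: "B h h = 0" if h: "h \<in> V" "\<And>k. B h (\<phi> k) = 0" for h
  proof (rule ccontr)
    assume "B h h \<noteq> 0"
    then have pos: "B h h > 0" using form2.nonneg[OF h(1)] by simp
    have "E (\<phi> k) (\<phi> k) * B h h \<le> E h h" for k by (rule min[OF h])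
    then have "E (\<phi> k) (\<phi> k) \<le> E h h / B h h" for k using pos by (simp add: field_simps)
    from compact[of \<phi>, OF \<phi>V this] obtain r :: "nat \<Rightarrow> nat" where r: "strict_mono r"
      "\<And>e. e > 0 \<Longrightarrow> \<exists>N. \<forall>m\<ge>N. \<forall>n\<ge>N. B (\<phi> (r m) - \<phi> (r n)) (\<phi> (r m) - \<phi> (r n)) < e" by blast
    obtain N where "B (\<phi> (r N) - \<phi> (r (Suc N))) (\<phi> (r N) - \<phi> (r (Suc N))) < 1"
      using r(2)[of 1] by (metis le_SucI order_refl zero_less_one)
    moreover have "r N \<noteq> r (Suc N)" using r(1) by (metis n_not_Suc_n strict_mono_eq)
    ultimately show False by (simp add: form2.square_diff \<phi>V on)
  qed
  show thesis by (rule that[OF \<phi>V on eig null])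
qed

end

text \<open>Turns random variables, edgewise functions and pairs of them into vectors, so that
  \<open>subspace\<close> and \<open>span\<close> apply to all of them.\<close>

instantiation "fun" :: (type, real_vector) real_vector
begin

definition scaleR_fun_def: "a *\<^sub>R f = (\<lambda>x. a *\<^sub>R f x)"

instance
  by standard (auto simp: scaleR_fun_def fun_eq_iff scaleR_add_right scaleR_add_left)

end

lemma scaleR_fun_apply [simp]: "(a *\<^sub>R f) x = a *\<^sub>R f x"
  by (simp add: scaleR_fun_def)

lemma sum_fun_apply: "(sum f I) x = (\<Sum>i\<in>I. f i x)"
  by (induction I rule: infinite_finite_induct) auto

section \<open>Square-integrable functions and weak derivatives on an interval\<close>

abbreviation Ivl :: "real \<Rightarrow> real measure" where
  "Ivl l \<equiv> restrict_space lborel {0..l}"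

lemma space_Ivl [simp]: "space (Ivl l) = {0..l}"
  by (simp add: space_restrict_space)

lemma finite_measure_Ivl: "finite_measure (Ivl l)"
  by (rule finite_measureI) (simp add: emeasure_restrict_space emeasure_lborel_Icc_eq)

lemma measurable_Ivl [measurable (raw)]: "f \<in> borel_measurable borel \<Longrightarrow> f \<in> borel_measurable (Ivl l)"
  by (simp add: measurable_restrict_space1)

lemma measurable_Ivl_id [measurable]: "(\<lambda>x. x) \<in> borel_measurable (Ivl l)"
  by (rule measurable_Ivl) simp

lemma integral_Ivl_indicator:
  fixes g :: "real \<Rightarrow> real"
  assumes "t \<le> l"
  shows "(LINT s|Ivl l. indicator {0..t} s * g s) = (LBINT s:{0..t}. g s)"
proof -
  have "(LINT s|Ivl l. indicator {0..t} s * g s) = (LBINT s. indicator {0..l} s *\<^sub>R (indicator {0..t} s * g s))"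
    by (subst integral_restrict_space) auto
  also have "\<dots> = (LBINT s. indicator {0..t} s *\<^sub>R g s)"
    using assms by (intro Bochner_Integration.integral_cong) (auto simp: indicator_def)
  finally show ?thesis by (simp add: set_lebesgue_integral_def)
qed

lemma integral_Ivl: "(LINT s|Ivl l. (g s :: real)) = (LBINT s:{0..l}. g s)"
  unfolding set_lebesgue_integral_def by (subst integral_restrict_space) auto

lemma integrable_Ivl: "integrable (Ivl l) (g :: real \<Rightarrow> real) \<longleftrightarrow> set_integrable lborel {0..l} g"
  unfolding set_integrable_def by (subst integrable_restrict_space) auto

lemma AE_Ivl: "(AE t in Ivl l. P t) \<longleftrightarrow> (AE t in lborel. t \<in> {0..l} \<longrightarrow> P t)"
  by (simp add: AE_restrict_space_iff)

definition in_L2 :: "real \<Rightarrow> (real \<Rightarrow> real) \<Rightarrow> bool" where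
  "in_L2 l f \<longleftrightarrow> f \<in> borel_measurable (Ivl l) \<and> integrable (Ivl l) (\<lambda>t. (f t)\<^sup>2)"

lemma L2_on_iff: "L2_on l f \<longleftrightarrow> in_L2 l f"
  unfolding L2_on_def in_L2_def integrable_Ivl set_borel_measurable_def
  by (simp add: borel_measurable_restrict_space_iff)

lemma in_L2_measurable [measurable_dest]: "in_L2 l f \<Longrightarrow> f \<in> borel_measurable (Ivl l)"
  by (simp add: in_L2_def)

lemma in_L2_square: "in_L2 l f \<Longrightarrow> integrable (Ivl l) (\<lambda>t. (f t)\<^sup>2)"
  by (simp add: in_L2_def)

lemma bounded_AE_in_L2:
  assumes [measurable]: "f \<in> borel_measurable (Ivl l)" and "AE t in Ivl l. \<bar>f t\<bar> \<le> C"
  shows "in_L2 l f"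
proof -
  have "AE t in Ivl l. norm ((f t)\<^sup>2) \<le> C\<^sup>2"
    using assms(2) by eventually_elim (auto intro: power2_le_iff_abs_le[THEN iffD2] simp: abs_le_square_iff[symmetric])
  then have "integrable (Ivl l) (\<lambda>t. (f t)\<^sup>2)"
    by (intro finite_measure.integrable_const_bound[OF finite_measure_Ivl]) auto
  then show ?thesis using assms(1) by (simp add: in_L2_def)
qed

lemma bounded_in_L2:
  assumes "f \<in> borel_measurable (Ivl l)" and "\<And>t. t \<in> {0..l} \<Longrightarrow> \<bar>f t\<bar> \<le> C"
  shows "in_L2 l f"
  using assms by (intro bounded_AE_in_L2[of _ _ C] AE_I2) auto

lemma in_L2_mult_integrable:
  assumes f: "in_L2 l f" and g: "in_L2 l g"
  shows "integrable (Ivl l) (\<lambda>t. f t * g t)"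
proof (rule Bochner_Integration.integrable_bound)
  show "integrable (Ivl l) (\<lambda>t. (f t)\<^sup>2 + (g t)\<^sup>2)"
    using f g by (intro Bochner_Integration.integrable_add in_L2_square)
  show "(\<lambda>t. f t * g t) \<in> borel_measurable (Ivl l)" using f g by measurable
  have "\<bar>x * y\<bar> \<le> x\<^sup>2 + y\<^sup>2" for x y :: real
    using sum_squares_bound[of "\<bar>x\<bar>" "\<bar>y\<bar>"] abs_ge_zero[of "x * y"] unfolding abs_mult power2_abs by linarith
  then show "AE t in Ivl l. norm (f t * g t) \<le> norm ((f t)\<^sup>2 + (g t)\<^sup>2)" by simp
qed

lemma in_L2_bounded_mult:
  assumes f: "in_L2 l f" and [measurable]: "h \<in> borel_measurable (Ivl l)" and h: "AE t in Ivl l. \<bar>h t\<bar> \<le> C"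
  shows "in_L2 l (\<lambda>t. h t * f t)"
proof -
  have [measurable]: "f \<in> borel_measurable (Ivl l)" using f by measurable
  have "integrable (Ivl l) (\<lambda>t. (h t * f t)\<^sup>2)"
  proof (rule Bochner_Integration.integrable_bound)
    show "integrable (Ivl l) (\<lambda>t. C\<^sup>2 * (f t)\<^sup>2)" using f by (simp add: in_L2_square)
    show "AE t in Ivl l. norm ((h t * f t)\<^sup>2) \<le> norm (C\<^sup>2 * (f t)\<^sup>2)"
      using h
    proof eventually_elim
      case (elim t)
      then have "(h t)\<^sup>2 \<le> C\<^sup>2" by (rule power2_le_iff_abs_le[THEN iffD2, rotated]) (use elim in linarith)
      then show ?case by (simp add: power_mult_distrib mult_right_mono)
    qed
  qed simp
  then show ?thesis by (simp add: in_L2_def)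
qed

lemma in_L2_add: assumes f: "in_L2 l f" and g: "in_L2 l g" shows "in_L2 l (\<lambda>t. f t + g t)"
proof -
  have "integrable (Ivl l) (\<lambda>t. (f t)\<^sup>2 + (g t)\<^sup>2 + 2 * (f t * g t))"
    using f g by (intro Bochner_Integration.integrable_add integrable_mult_right in_L2_square in_L2_mult_integrable)
  moreover have "(\<lambda>t. f t + g t) \<in> borel_measurable (Ivl l)" using f g by measurable
  ultimately show ?thesis by (simp add: in_L2_def power2_sum mult.assoc)
qed

lemma in_L2_scale: "in_L2 l f \<Longrightarrow> in_L2 l (\<lambda>t. c * f t)"
  by (rule in_L2_bounded_mult[of _ _ _ "\<bar>c\<bar>"]) auto

lemma in_L2_diff: "in_L2 l f \<Longrightarrow> in_L2 l g \<Longrightarrow> in_L2 l (\<lambda>t. f t - g t)"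
  using in_L2_add[of l f "\<lambda>t. (-1) * g t"] in_L2_scale[of l g "-1"] by simp

lemma in_L2_const [simp]: "in_L2 l (\<lambda>t. c)"
  by (rule bounded_in_L2[of _ _ "\<bar>c\<bar>"]) auto

lemma in_L2_integrable: "in_L2 l f \<Longrightarrow> integrable (Ivl l) f"
  using in_L2_mult_integrable[of l f "\<lambda>t. 1"] by simp

lemma in_L2_indicator [measurable]: "A \<in> sets borel \<Longrightarrow> in_L2 l (indicator A)"
  by (rule bounded_in_L2[of _ _ 1]) (auto simp: indicator_def)

lemma L2_psd_form: "psd_form {f. in_L2 l f} (\<lambda>f g. LINT t|Ivl l. f t * g t)"
proof
  show "subspace {f. in_L2 l f}"
    unfolding subspace_def using in_L2_add in_L2_scale in_L2_const[of l 0]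
    by (simp add: plus_fun_def scaleR_fun_def zero_fun_def)
  fix f g h :: "real \<Rightarrow> real" and c :: real
  assume "f \<in> {f. in_L2 l f}" "g \<in> {f. in_L2 l f}"
  then have fg: "in_L2 l f" "in_L2 l g" by simp_all
  show "(LINT t|Ivl l. f t * g t) = (LINT t|Ivl l. g t * f t)" by (simp only: mult.commute)
  show "(LINT t|Ivl l. (c *\<^sub>R f) t * g t) = c * (LINT t|Ivl l. f t * g t)" by (simp add: mult.assoc)
  show "(LINT t|Ivl l. (f + g) t * h t) = (LINT t|Ivl l. f t * h t) + (LINT t|Ivl l. g t * h t)" if "h \<in> {f. in_L2 l f}"
    using fg that by (simp add: distrib_right in_L2_mult_integrable)
qed simp

lemma L2_cauchy_schwarz:
  assumes "in_L2 l f" "in_L2 l g"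
  shows "(LINT t|Ivl l. f t * g t)\<^sup>2 \<le> (LINT t|Ivl l. (f t)\<^sup>2) * (LINT t|Ivl l. (g t)\<^sup>2)"
  using psd_form.cauchy_schwarz[OF L2_psd_form, of f l g] assms by (simp add: power2_eq_square)

lemma measure_Ivl_subinterval: "0 \<le> s \<Longrightarrow> t \<le> l \<Longrightarrow> s \<le> t \<Longrightarrow> measure (Ivl l) {s..t} = t - s"
  by (subst measure_restrict_space) auto

text \<open>Riesz-Fischer on a finite measure space: Cauchy in L2 implies Cauchy in L1, so a
  subsequence converges almost everywhere to some \<open>g\<close>, and Fatou along this subsequence
  bounds the L2 distance from \<open>f m\<close> to \<open>g\<close>.\<close>

lemma L2_complete:
  fixes f :: "nat \<Rightarrow> real \<Rightarrow> real"
  assumes f: "\<And>n. in_L2 l (f n)"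
    and cauchy: "\<And>e. e > 0 \<Longrightarrow> \<exists>N. \<forall>m\<ge>N. \<forall>n\<ge>N. (LINT t|Ivl l. (f m t - f n t)\<^sup>2) < e"
  shows "\<exists>g. in_L2 l g \<and> (\<lambda>n. LINT t|Ivl l. (f n t - g t)\<^sup>2) \<longlonglongrightarrow> 0"
proof -
  let ?M = "Ivl l"
  define \<mu> where "\<mu> = measure ?M {0..l}"
  have \<mu>0: "\<mu> \<ge> 0" by (simp add: \<mu>_def)
  have \<mu>: "(LINT t|?M. 1) = \<mu>" by (simp add: \<mu>_def)
  have [measurable]: "f n \<in> borel_measurable ?M" for n using f[of n] by measurable
  have "\<exists>N. \<forall>i\<ge>N. \<forall>j\<ge>N. (LINT x|?M. norm (f i x - f j x)) < e" if e: "e > 0" for e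
  proof -
    \<comment> \<open>The measure \<open>\<mu>\<close> of the interval enters through Cauchy-Schwarz
      against the constant 1. Adding 1 covers \<open>\<mu> = 0\<close> and makes the final
      inequality strict.\<close>
    have pos: "e\<^sup>2 / (\<mu> + 1) > 0" using e by (simp add: \<mu>_def add_nonneg_pos)
    obtain N where N: "\<And>m n. m \<ge> N \<Longrightarrow> n \<ge> N \<Longrightarrow> (LINT t|?M. (f m t - f n t)\<^sup>2) < e\<^sup>2 / (\<mu> + 1)"
      using cauchy[OF pos] by blast
    have "(LINT x|?M. \<bar>f i x - f j x\<bar>) < e" if ij: "i \<ge> N" "j \<ge> N" for i j
    proof -
      have abs: "in_L2 l (\<lambda>x. \<bar>f i x - f j x\<bar>)"
        using in_L2_diff[OF f[of i] f[of j]] by (simp add: in_L2_def)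
      have "(LINT x|?M. \<bar>f i x - f j x\<bar>)\<^sup>2 \<le> (LINT t|?M. (f i t - f j t)\<^sup>2) * \<mu>"
        using L2_cauchy_schwarz[OF abs in_L2_const[of l 1]] \<mu> by simp
      also have "\<dots> \<le> (e\<^sup>2 / (\<mu> + 1)) * \<mu>"
        using N[OF ij] by (intro mult_right_mono) (auto simp: \<mu>_def)
      also have "\<dots> = e\<^sup>2 * (\<mu> / (\<mu> + 1))" by simp
      also have "\<dots> < e\<^sup>2 * 1"
        using e \<mu>0 by (intro mult_strict_left_mono) (simp_all add: divide_less_eq_1_pos)
      finally show ?thesis using e by (intro power2_less_imp_less[of _ e]) simp_all
    qed
    then show ?thesis unfolding real_norm_def by blast
  qed
  from cauchy_L1_AE_cauchy_subseq[OF in_L2_integrable[OF f] this]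
  obtain r where r: "strict_mono r" "AE x in ?M. Cauchy (\<lambda>i. f (r i) x)" .
  define g where "g = (\<lambda>x. lim (\<lambda>i. f (r i) x))"
  have [measurable]: "g \<in> borel_measurable ?M" unfolding g_def by (rule borel_measurable_lim_metric) measurable
  have conv: "AE x in ?M. (\<lambda>i. f (r i) x) \<longlonglongrightarrow> g x"
    using r(2) by eventually_elim (simp only: g_def Cauchy_convergent_iff convergent_LIMSEQ_iff)
  have key: "integrable ?M (\<lambda>t. (f m t - g t)\<^sup>2) \<and> (LINT t|?M. (f m t - g t)\<^sup>2) \<le> e"
    if e: "e > 0" and N: "\<And>m n. m \<ge> N \<Longrightarrow> n \<ge> N \<Longrightarrow> (LINT t|?M. (f m t - f n t)\<^sup>2) < e" and m: "m \<ge> N" for e N m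
  proof -
    have fin: "(\<integral>\<^sup>+t. ennreal ((f m t - g t)\<^sup>2) \<partial>?M) \<le> ennreal e"
    proof -
      have "(\<integral>\<^sup>+t. ennreal ((f m t - g t)\<^sup>2) \<partial>?M) = (\<integral>\<^sup>+t. liminf (\<lambda>n. ennreal ((f m t - f (r n) t)\<^sup>2)) \<partial>?M)"
      proof (rule nn_integral_cong_AE)
        show "AE t in ?M. ennreal ((f m t - g t)\<^sup>2) = liminf (\<lambda>n. ennreal ((f m t - f (r n) t)\<^sup>2))"
          using conv
        proof eventually_elim
          case (elim t)
          have "(\<lambda>n. ennreal ((f m t - f (r n) t)\<^sup>2)) \<longlonglongrightarrow> ennreal ((f m t - g t)\<^sup>2)"
            by (intro tendsto_ennrealI tendsto_intros elim)
          then show ?case by (rule lim_imp_Liminf[OF sequentially_bot, symmetric])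
        qed
      qed
      also have "\<dots> \<le> liminf (\<lambda>n. \<integral>\<^sup>+t. ennreal ((f m t - f (r n) t)\<^sup>2) \<partial>?M)"
        by (rule nn_integral_liminf) measurable
      also have "\<dots> \<le> limsup (\<lambda>n. \<integral>\<^sup>+t. ennreal ((f m t - f (r n) t)\<^sup>2) \<partial>?M)"
        by (rule Liminf_le_Limsup) simp
      also have "\<dots> \<le> ennreal e"
      proof (rule Limsup_bounded, rule eventually_sequentiallyI[of N])
        fix n assume "n \<ge> N"
        then have "r n \<ge> N" using seq_suble[OF r(1), of n] by simp
        have "(\<integral>\<^sup>+t. ennreal ((f m t - f (r n) t)\<^sup>2) \<partial>?M) = ennreal (LINT t|?M. (f m t - f (r n) t)\<^sup>2)"
          using in_L2_diff[OF f[of m] f[of "r n"]] by (intro nn_integral_eq_integral) (auto simp: in_L2_def)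
        also have "\<dots> \<le> ennreal e" using N[OF m \<open>r n \<ge> N\<close>] by (intro ennreal_leI) simp
        finally show "(\<integral>\<^sup>+t. ennreal ((f m t - f (r n) t)\<^sup>2) \<partial>?M) \<le> ennreal e" .
      qed
      finally show ?thesis .
    qed
    have int: "integrable ?M (\<lambda>t. (f m t - g t)\<^sup>2)"
      using fin by (intro integrableI_bounded) (auto simp: top_unique less_top[symmetric] intro: le_less_trans)
    moreover have "(LINT t|?M. (f m t - g t)\<^sup>2) \<le> e"
      using fin e nn_integral_eq_integral[OF int] by (simp add: ennreal_le_iff)
    ultimately show ?thesis by simp
  qed
  obtain N1 where N1: "\<And>m n. m \<ge> N1 \<Longrightarrow> n \<ge> N1 \<Longrightarrow> (LINT t|?M. (f m t - f n t)\<^sup>2) < 1"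
    using cauchy[of 1] by auto
  have "in_L2 l (\<lambda>t. f N1 t - g t)" using key[OF _ N1, of N1] by (simp add: in_L2_def)
  from in_L2_diff[OF f[of N1] this] have g: "in_L2 l g" by simp
  have "(\<lambda>n. LINT t|?M. (f n t - g t)\<^sup>2) \<longlonglongrightarrow> 0"
  proof (rule LIMSEQ_I)
    fix e :: real assume e: "e > 0"
    then obtain N where N: "\<And>m n. m \<ge> N \<Longrightarrow> n \<ge> N \<Longrightarrow> (LINT t|?M. (f m t - f n t)\<^sup>2) < e / 2"
      using cauchy[of "e/2"] by auto
    have "norm ((LINT t|?M. (f n t - g t)\<^sup>2) - 0) < e" if "n \<ge> N" for n
    proof -
      have "(LINT t|?M. (f n t - g t)\<^sup>2) \<le> e / 2" using key[OF _ N that] e by simp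
      moreover have "(LINT t|?M. (f n t - g t)\<^sup>2) \<ge> 0" by simp
      ultimately show ?thesis using e unfolding real_norm_def diff_0_right by linarith
    qed
    then show "\<exists>N. \<forall>n\<ge>N. norm ((LINT t|?M. (f n t - g t)\<^sup>2) - 0) < e" by blast
  qed
  with g show ?thesis by blast
qed

text \<open>The positive and negative parts of \<open>g\<close>, cut off outside the interval, are
  densities of the finite measures \<open>N 1\<close> and \<open>N (-1)\<close>. A vanishing
  primitive makes their distribution functions equal, so the measures and hence the densities agree.
  The two parts are never positive at the same point, so both vanish.\<close>

lemma AE_zero_of_primitive_zero:
  fixes g :: "real \<Rightarrow> real"
  assumes g: "integrable (Ivl l) g" and zero: "\<And>t. t \<in> {0..l} \<Longrightarrow> (LINT s|Ivl l. indicator {0..t} s * g s) = 0"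
  shows "AE t in Ivl l. g t = 0"
proof -
  define h where "h = (\<lambda>t. indicator {0..l} t * g t)"
  have h: "integrable lborel h" using g by (simp add: h_def integrable_Ivl set_integrable_def)
  have [measurable]: "h \<in> borel_measurable borel" using h by auto
  define N where "N = (\<lambda>s::real. density lborel (\<lambda>t. ennreal (max 0 (s * h t))))"
  have intm: "integrable lborel (\<lambda>t. max 0 (s * h t))" for s using h by (intro integrable_max) auto
  have meas: "measure (N s) A = (LINT t|lborel. indicator A t * max 0 (s * h t))" if "A \<in> sets borel" for A s
  proof -
    have "integrable lborel (\<lambda>t. indicator A t * max 0 (s * h t))"
      using intm[of s] that by (intro integrable_real_mult_indicator[of _ _ "\<lambda>t. max 0 (s * h t)", simplified mult.commute]) auto
    then have "(\<integral>\<^sup>+t. ennreal (indicator A t * max 0 (s * h t)) \<partial>lborel) = ennreal (LINT t|lborel. indicator A t * max 0 (s * h t))"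
      by (rule nn_integral_eq_integral) simp
    moreover have "emeasure (N s) A = (\<integral>\<^sup>+t. ennreal (indicator A t * max 0 (s * h t)) \<partial>lborel)"
      unfolding N_def using that by (subst emeasure_density) (auto intro!: nn_integral_cong simp: indicator_def)
    ultimately show ?thesis by (simp add: Sigma_Algebra.measure_def)
  qed
  have fin: "finite_borel_measure (N s)" for s
  proof -
    have "emeasure (N s) UNIV = (\<integral>\<^sup>+t. ennreal (max 0 (s * h t)) \<partial>lborel)"
      unfolding N_def by (subst emeasure_density) simp_all
    also have "\<dots> = ennreal (LINT t|lborel. max 0 (s * h t))"
      by (rule nn_integral_eq_integral[OF intm]) simp
    finally have "emeasure (N s) UNIV = ennreal (LINT t|lborel. max 0 (s * h t))" .
    then have "finite_measure (N s)" by (intro finite_measureI) (simp add: N_def)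
    then show ?thesis by (simp add: finite_borel_measure_def finite_borel_measure_axioms_def N_def)
  qed
  have cdf: "cdf (N 1) x = cdf (N (-1)) x" for x
  proof -
    have "(LINT t|lborel. indicator {..x} t * max 0 (h t)) - (LINT t|lborel. indicator {..x} t * max 0 (- h t))
        = (LINT t|lborel. indicator {..x} t * h t)"
      using intm[of 1] intm[of "-1"]
      by (subst Bochner_Integration.integral_diff[symmetric])
        (auto intro!: integrable_real_mult_indicator Bochner_Integration.integral_cong simp: mult.commute[of "indicator _ _"] max_def split: if_splits)
    also have "\<dots> = 0"
    proof (cases "x < 0")
      case True
      then have "(\<lambda>t. indicator {..x} t * h t) = (\<lambda>t. 0)" by (auto simp: h_def indicator_def fun_eq_iff)
      then show ?thesis by simp
    next
      case False
      define y where "y = min x l"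
      show ?thesis
      proof (cases "0 \<le> l")
        case True
        then have y: "y \<in> {0..l}" using False by (auto simp: y_def)
        have "(\<lambda>t. indicator {..x} t * h t) = (\<lambda>t. indicator {0..y} t * g t)"
          by (auto simp: h_def indicator_def fun_eq_iff y_def)
        then show ?thesis using zero[OF y] y by (simp add: integral_Ivl_indicator set_lebesgue_integral_def)
      next
        case False
        then have "(\<lambda>t. indicator {..x} t * h t) = (\<lambda>t. 0)" by (auto simp: h_def indicator_def fun_eq_iff)
        then show ?thesis by simp
      qed
    qed
    finally show ?thesis by (simp add: cdf_def meas)
  qed
  have "N 1 = N (-1)" by (rule cdf_unique'[OF fin fin]) (simp add: fun_eq_iff cdf)
  then have "AE t in lborel. ennreal (max 0 (1 * h t)) = ennreal (max 0 ((-1) * h t))"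
    unfolding N_def by (subst (asm) sigma_finite_measure.density_unique_iff[OF sigma_finite_lborel]) auto
  then have "AE t in lborel. t \<in> {0..l} \<longrightarrow> g t = 0"
    by eventually_elim (auto simp: h_def max_def split: if_splits)
  then show ?thesis by (simp add: AE_Ivl)
qed

section \<open>Primitives and functions of class H1 on an interval\<close>

definition prim :: "real \<Rightarrow> (real \<Rightarrow> real) \<Rightarrow> real \<Rightarrow> real" where
  "prim l g t = (LINT s|Ivl l. indicator {0..t} s * g s)"

definition weak_deriv :: "real \<Rightarrow> (real \<Rightarrow> real) \<Rightarrow> (real \<Rightarrow> real) \<Rightarrow> bool" where
  "weak_deriv l f g \<longleftrightarrow> in_L2 l g \<and> (\<forall>t\<in>{0..l}. prim l g t = f t - f 0)"

lemma weak_deriv_iff: "has_weak_deriv l f g \<and> L2_on l g \<longleftrightarrow> weak_deriv l f g"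
proof -
  have eq: "(\<forall>t\<in>{0..l}. f t = f 0 + (LBINT s:{0..t}. g s)) \<longleftrightarrow> (\<forall>t\<in>{0..l}. prim l g t = f t - f 0)"
  proof (intro ball_cong refl)
    fix t assume "t \<in> {0..l}"
    then have "prim l g t = (LBINT s:{0..t}. g s)" by (simp add: prim_def integral_Ivl_indicator)
    then show "(f t = f 0 + (LBINT s:{0..t}. g s)) \<longleftrightarrow> (prim l g t = f t - f 0)" by auto
  qed
  show ?thesis
    unfolding has_weak_deriv_def weak_deriv_def L2_on_iff integrable_Ivl[symmetric] eq
    using in_L2_integrable[of l g] by argo
qed

lemma weak_deriv_in_L2: "weak_deriv l f g \<Longrightarrow> in_L2 l g"
  by (simp add: weak_deriv_def)

lemma integrable_indicator_mult:
  assumes "integrable (Ivl l) g" and [measurable]: "A \<in> sets borel"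
  shows "integrable (Ivl l) (\<lambda>t. indicator A t * g t :: real)"
proof -
  have [measurable]: "g \<in> borel_measurable (Ivl l)" using assms(1) by measurable
  show ?thesis
    by (rule Bochner_Integration.integrable_bound[OF assms(1)]) (auto simp: indicator_def intro!: AE_I2)
qed

lemma prim_add: "in_L2 l g \<Longrightarrow> in_L2 l h \<Longrightarrow> prim l (\<lambda>t. g t + h t) t = prim l g t + prim l h t"
  unfolding prim_def distrib_left
  by (intro Bochner_Integration.integral_add integrable_indicator_mult in_L2_integrable) auto

lemma prim_scale: "prim l (\<lambda>t. c * g t) t = c * prim l g t"
  unfolding prim_def by (simp add: mult.left_commute)

lemma prim_0: "prim l g 0 = 0"
proof -
  have "AE s in Ivl l. indicator {0..0} s * g s = 0"
    unfolding AE_Ivl using AE_lborel_singleton[of 0] by eventually_elim auto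
  then show ?thesis unfolding prim_def by (rule integral_eq_zero_AE)
qed

lemma prim_full: "prim l g l = (LINT s|Ivl l. g s)"
  unfolding prim_def by (intro Bochner_Integration.integral_cong) auto

lemma weak_deriv_prim: "in_L2 l g \<Longrightarrow> weak_deriv l (\<lambda>t. c + prim l g t) g"
  by (simp add: weak_deriv_def prim_0)

lemma weak_deriv_add: "weak_deriv l f g \<Longrightarrow> weak_deriv l f' g' \<Longrightarrow> weak_deriv l (\<lambda>t. f t + f' t) (\<lambda>t. g t + g' t)"
  unfolding weak_deriv_def by (auto simp: in_L2_add prim_add)

lemma weak_deriv_scale: "weak_deriv l f g \<Longrightarrow> weak_deriv l (\<lambda>t. c * f t) (\<lambda>t. c * g t)"
  unfolding weak_deriv_def by (auto simp: in_L2_scale prim_scale right_diff_distrib)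

lemma weak_deriv_cong_AE:
  assumes "weak_deriv l f g" and [measurable]: "g' \<in> borel_measurable (Ivl l)" and eq: "AE t in Ivl l. g t = g' t"
  shows "weak_deriv l f g'"
proof -
  have g: "in_L2 l g" using assms(1) by (rule weak_deriv_in_L2)
  have [measurable]: "g \<in> borel_measurable (Ivl l)" using g by measurable
  have "integrable (Ivl l) (\<lambda>t. (g t)\<^sup>2) \<longleftrightarrow> integrable (Ivl l) (\<lambda>t. (g' t)\<^sup>2)"
    by (intro integrable_cong_AE) (use eq in auto)
  then have "in_L2 l g'" using g by (simp add: in_L2_def)
  moreover have "prim l g t = prim l g' t" for t
    unfolding prim_def by (intro integral_cong_AE) (use eq in auto)
  ultimately show ?thesis using assms(1) by (simp add: weak_deriv_def)
qed

lemma prim_increment: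
  assumes g: "integrable (Ivl l) g" and st: "0 \<le> s" "s \<le> t"
  shows "prim l g t - prim l g s = (LINT r|Ivl l. indicator {s<..t} r * g r)"
proof -
  have "prim l g t - prim l g s = (LINT r|Ivl l. indicator {0..t} r * g r - indicator {0..s} r * g r)"
    unfolding prim_def using g by (intro Bochner_Integration.integral_diff[symmetric] integrable_indicator_mult) auto
  also have "\<dots> = (LINT r|Ivl l. indicator {s<..t} r * g r)"
    using st by (intro Bochner_Integration.integral_cong) (auto simp: indicator_def)
  finally show ?thesis .
qed

lemma measure_Ivl_Ioc: "\<lbrakk>0 \<le> s; s \<le> t; t \<le> l\<rbrakk> \<Longrightarrow> (LINT r|Ivl l. indicator {s<..t} r) = t - s"
proof -
  assume st: "0 \<le> s" "s \<le> t" "t \<le> l"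
  have "{s<..t} \<inter> {0..l} = {s<..t}" using st by auto
  moreover have "measure (Ivl l) {s<..t} = t - s"
    using st by (subst measure_restrict_space) auto
  ultimately show ?thesis by simp
qed

text \<open>Cauchy-Schwarz against the indicator of \<open>{s<..t}\<close>. This estimate drives
  continuity, the bound on point values and the compactness of the embedding.\<close>

lemma weak_deriv_holder:
  assumes fg: "weak_deriv l f g" and st: "s \<in> {0..l}" "t \<in> {0..l}"
  shows "(f t - f s)\<^sup>2 \<le> \<bar>t - s\<bar> * (LINT r|Ivl l. (g r)\<^sup>2)"
proof -
  have main: "(f t - f s)\<^sup>2 \<le> (t - s) * (LINT r|Ivl l. (g r)\<^sup>2)"
    if "s \<in> {0..l}" "t \<in> {0..l}" "s \<le> t" for s t
  proof -
    have "f t - f s = prim l g t - prim l g s" using fg that by (simp add: weak_deriv_def)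
    also have "\<dots> = (LINT r|Ivl l. indicator {s<..t} r * g r)"
      using fg that by (intro prim_increment in_L2_integrable weak_deriv_in_L2) auto
    also have "\<dots>\<^sup>2 \<le> (LINT r|Ivl l. (indicator {s<..t} r)\<^sup>2) * (LINT r|Ivl l. (g r)\<^sup>2)"
      using fg by (intro L2_cauchy_schwarz in_L2_indicator weak_deriv_in_L2) auto
    also have "(\<lambda>r. (indicator {s<..t} r :: real)\<^sup>2) = indicator {s<..t}" by (auto simp: indicator_def fun_eq_iff)
    also have "(LINT r|Ivl l. indicator {s<..t} r) = t - s" using that by (intro measure_Ivl_Ioc) auto
    finally show ?thesis .
  qed
  show ?thesis
  proof (cases "s \<le> t")
    case True then show ?thesis using main[OF st] by simp
  next
    case False
    then show ?thesis using main[OF st(2,1)] by (simp add: power2_commute[of "f t"])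
  qed
qed

lemma weak_deriv_continuous:
  assumes fg: "weak_deriv l f g" shows "continuous_on {0..l} f"
  unfolding continuous_on_def
proof
  fix s assume s: "s \<in> {0..l}"
  let ?C = "LINT r|Ivl l. (g r)\<^sup>2"
  have "((\<lambda>t. sqrt (\<bar>t - s\<bar> * ?C)) \<longlongrightarrow> sqrt (\<bar>s - s\<bar> * ?C)) (at s within {0..l})"
    by (intro tendsto_intros)
  then have lim: "((\<lambda>t. sqrt (\<bar>t - s\<bar> * ?C)) \<longlongrightarrow> 0) (at s within {0..l})" by simp
  have "\<forall>\<^sub>F t in at s within {0..l}. norm (f t - f s) \<le> sqrt (\<bar>t - s\<bar> * ?C)"
    unfolding eventually_at_filter
  proof (intro always_eventually allI impI)
    fix t assume "t \<in> {0..l}"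
    then have "sqrt ((f t - f s)\<^sup>2) \<le> sqrt (\<bar>t - s\<bar> * ?C)"
      using weak_deriv_holder[OF fg s] by (intro real_sqrt_le_mono) auto
    then show "norm (f t - f s) \<le> sqrt (\<bar>t - s\<bar> * ?C)" by simp
  qed
  then have "((\<lambda>t. f t - f s) \<longlongrightarrow> 0) (at s within {0..l})" by (rule Lim_null_comparison[OF _ lim])
  then show "(f \<longlongrightarrow> f s) (at s within {0..l})" by (simp add: LIM_zero_iff)
qed

lemma continuous_measurable_Ivl: "continuous_on {0..l} f \<Longrightarrow> f \<in> borel_measurable (Ivl l)"
  using borel_measurable_continuous_on_restrict[of "{0..l}" f]
  by (simp add: measurable_def sets_restrict_space space_restrict_space)

lemma continuous_in_L2: assumes "continuous_on {0..l} f" shows "in_L2 l f"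
proof -
  have "bounded (f ` {0..l})" using assms by (intro compact_imp_bounded compact_continuous_image) auto
  then obtain C where "\<And>x. x \<in> {0..l} \<Longrightarrow> \<bar>f x\<bar> \<le> C" unfolding bounded_iff by (metis imageI real_norm_def)
  then show ?thesis using continuous_measurable_Ivl[OF assms] bounded_in_L2 by blast
qed

lemma weak_deriv_in_L2': "weak_deriv l f g \<Longrightarrow> in_L2 l f"
  by (rule continuous_in_L2[OF weak_deriv_continuous])

text \<open>The inequality f(t)^2 \<le> 2 f(s)^2 + 2 (f(t) - f(s))^2 is integrated over s, with the
  Hoelder estimate for the second term.\<close>

lemma weak_deriv_sup_bound:
  assumes fg: "weak_deriv l f g" and t: "t \<in> {0..l}"
  shows "l * (f t)\<^sup>2 \<le> 2 * (LINT s|Ivl l. (f s)\<^sup>2) + 2 * l\<^sup>2 * (LINT s|Ivl l. (g s)\<^sup>2)"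
proof -
  let ?C = "LINT s|Ivl l. (g s)\<^sup>2"
  have C: "?C \<ge> 0" by simp
  have "measure (Ivl l) {0..l} = l" using t by (intro measure_Ivl_subinterval[of 0 l l, simplified]) auto
  then have L: "(LINT s|Ivl l. c) = l * c" for c :: real by simp
  have "l * (f t)\<^sup>2 = (LINT s|Ivl l. (f t)\<^sup>2)" by (rule L[symmetric])
  also have "\<dots> \<le> (LINT s|Ivl l. 2 * (f s)\<^sup>2 + 2 * l * ?C)"
  proof (rule integral_mono)
    show "integrable (Ivl l) (\<lambda>s. (f t)\<^sup>2)" using in_L2_integrable[OF in_L2_const] .
    show "integrable (Ivl l) (\<lambda>s. 2 * (f s)\<^sup>2 + 2 * l * ?C)"
      using in_L2_integrable[OF in_L2_const] in_L2_square[OF weak_deriv_in_L2'[OF fg]]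
      by (intro Bochner_Integration.integrable_add integrable_mult_right) auto
    fix s assume "s \<in> space (Ivl l)"
    then have s: "s \<in> {0..l}" by simp
    have "(f t)\<^sup>2 \<le> 2 * (f s)\<^sup>2 + 2 * (f t - f s)\<^sup>2"
      using sum_squares_bound[of "f s" "f t - f s"] by (simp add: power2_eq_square algebra_simps)
    also have "(f t - f s)\<^sup>2 \<le> \<bar>t - s\<bar> * ?C" by (rule weak_deriv_holder[OF fg s t])
    also have "\<dots> \<le> l * ?C" using s t C by (intro mult_right_mono) auto
    finally show "(f t)\<^sup>2 \<le> 2 * (f s)\<^sup>2 + 2 * l * ?C" by simp
  qed
  also have "\<dots> = (LINT s|Ivl l. 2 * (f s)\<^sup>2) + (LINT s|Ivl l. 2 * l * ?C)"
    using in_L2_square[OF weak_deriv_in_L2'[OF fg]] in_L2_integrable[OF in_L2_const]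
    by (intro Bochner_Integration.integral_add integrable_mult_right)
  also have "\<dots> = 2 * (LINT s|Ivl l. (f s)\<^sup>2) + l * (2 * l * ?C)"
    by (simp only: L integral_mult_right_zero)
  finally show ?thesis by (simp add: power2_eq_square)
qed

lemma continuous_AE_zero:
  assumes "continuous_on {0..l} f" and "0 < l" and "AE t in Ivl l. f t = 0" and "t \<in> {0..l}"
  shows "f t = (0::real)"
proof (rule ccontr)
  assume nz: "f t \<noteq> 0"
  then obtain d where d: "d > 0" "\<And>s. s \<in> {0..l} \<Longrightarrow> dist s t < d \<Longrightarrow> dist (f s) (f t) < \<bar>f t\<bar>"
    using assms(1,4) unfolding continuous_on_iff by (metis zero_less_abs_iff)
  define a where "a = max 0 (t - d)"
  define b where "b = min l (t + d)"
  have ab: "a < b" using d(1) assms(2,4) by (auto simp: a_def b_def)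
  have ne: "f s \<noteq> 0" if "s \<in> {a<..<b}" for s
  proof
    assume "f s = 0"
    moreover have "dist s t < d" "s \<in> {0..l}" using that by (auto simp: a_def b_def dist_real_def abs_less_iff)
    ultimately show False using d(2)[of s] by simp
  qed
  have "AE s in lborel. s \<notin> {a<..<b}"
    using assms(3) unfolding AE_Ivl by eventually_elim (use ne in \<open>auto simp: a_def b_def\<close>)
  then have "{a<..<b} \<in> null_sets lborel" by (subst AE_iff_null_sets) auto
  then show False using ab by (simp add: null_sets_def)
qed

lemma weak_deriv_zero:
  assumes "weak_deriv l f g" and "\<And>t. t \<in> {0..l} \<Longrightarrow> f t = 0"
  shows "AE t in Ivl l. g t = 0"
proof (cases "0 \<le> l")
  case True
  then show ?thesis
    using assms by (intro AE_zero_of_primitive_zero in_L2_integrable) (auto simp: weak_deriv_def prim_def)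
next
  case False then show ?thesis by (intro AE_I2) simp
qed

text \<open>Fubini on a square: the product of the integrals of \<open>g\<close> and
  \<open>k\<close> over [0, T] is split along the diagonal, and the inner integral on either side of
  it is an increment of \<open>h\<close> or of \<open>f\<close>. Rearranging gives the product rule
  in integrated form.\<close>

lemma weak_deriv_mult:
  assumes fg: "weak_deriv l f g" and hk: "weak_deriv l h k"
  shows "weak_deriv l (\<lambda>t. f t * h t) (\<lambda>t. g t * h t + f t * k t)"
proof -
  let ?M = "Ivl l"
  interpret finite_measure ?M by (rule finite_measure_Ivl)
  interpret P: pair_sigma_finite ?M ?M ..
  have gL: "in_L2 l g" and kL: "in_L2 l k" using fg hk by (auto simp: weak_deriv_in_L2)
  have [measurable]: "g \<in> borel_measurable ?M" "k \<in> borel_measurable ?M" using gL kL by measurable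
  have cf: "continuous_on {0..l} f" and ch: "continuous_on {0..l} h" using weak_deriv_continuous fg hk by auto
  have [measurable]: "f \<in> borel_measurable ?M" "h \<in> borel_measurable ?M"
    using cf ch continuous_measurable_Ivl by auto
  have gi: "integrable ?M g" and ki: "integrable ?M k" using gL kL in_L2_integrable by auto
  have bdd: "\<exists>C. \<forall>t\<in>{0..l}. \<bar>f t\<bar> \<le> C" if "continuous_on {0..l} f" for f :: "real \<Rightarrow> real"
    using compact_imp_bounded[OF compact_continuous_image[OF that compact_Icc]] by (auto simp: bounded_iff)
  obtain Cf Ch where Cf: "\<And>t. t \<in> {0..l} \<Longrightarrow> \<bar>f t\<bar> \<le> Cf" and Ch: "\<And>t. t \<in> {0..l} \<Longrightarrow> \<bar>h t\<bar> \<le> Ch"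
    using bdd[OF cf] bdd[OF ch] by blast
  have fk: "in_L2 l (\<lambda>t. f t * k t)" and hg: "in_L2 l (\<lambda>t. h t * g t)"
    by (rule in_L2_bounded_mult[OF kL _ AE_I2, of _ Cf] in_L2_bounded_mult[OF gL _ AE_I2, of _ Ch]; use Cf Ch in simp)+
  have L2: "in_L2 l (\<lambda>t. g t * h t + f t * k t)" using in_L2_add[OF hg fk] by (simp add: mult.commute)
  have "prim l (\<lambda>t. g t * h t + f t * k t) T = f T * h T - f 0 * h 0" if T: "T \<in> {0..l}" for T
  proof -
    define \<Phi> where "\<Phi> = (\<lambda>p::real\<times>real. indicator {0..T} (fst p) * g (fst p) * (indicator {0..T} (snd p) * k (snd p)))"
    define g' where "g' = (\<lambda>s. indicator {0..T} s * g s)"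
    define k' where "k' = (\<lambda>s. indicator {0..T} s * k s)"
    have gi': "integrable ?M g'" and ki': "integrable ?M k'"
      unfolding g'_def k'_def using gi ki by (auto intro: integrable_indicator_mult)
    have [measurable]: "g' \<in> borel_measurable ?M" "k' \<in> borel_measurable ?M" using gi' ki' by auto
    have prod: "integrable (?M \<Otimes>\<^sub>M ?M) (\<lambda>p. g' (fst p) * k' (snd p))"
    proof (rule P.Fubini_integrable)
      show "integrable ?M (\<lambda>x. LINT y|?M. norm (g' (fst (x, y)) * k' (snd (x, y))))"
        unfolding fst_conv snd_conv real_norm_def abs_mult integral_mult_right_zero integral_mult_left_zero
        by (intro integrable_mult_left integrable_abs gi')
      show "AE x in ?M. integrable ?M (\<lambda>y. g' (fst (x, y)) * k' (snd (x, y)))"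
        unfolding fst_conv snd_conv by (intro AE_I2 integrable_mult_right ki')
    qed measurable
    have [measurable]: "fst \<in> borel_measurable (?M \<Otimes>\<^sub>M ?M)" "snd \<in> borel_measurable (?M \<Otimes>\<^sub>M ?M)"
      using measurable_compose[OF measurable_fst measurable_Ivl_id] measurable_compose[OF measurable_snd measurable_Ivl_id] by simp_all
    have swap: "integrable (?M \<Otimes>\<^sub>M ?M) (\<lambda>p. g' (snd p) * k' (fst p))"
      using P.integrable_product_swap[OF prod] by (simp add: case_prod_unfold)
    have "(LINT s|?M. g' s * (LINT r|?M. (if r \<le> s then 1 else 0) * k' r)) = (LINT s|?M. g' s * (h s - h 0))"
    proof (rule Bochner_Integration.integral_cong)
      fix s assume "s \<in> space ?M"
      then have s: "s \<in> {0..l}" by simp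
      show "g' s * (LINT r|?M. (if r \<le> s then 1 else 0) * k' r) = g' s * (h s - h 0)"
      proof (cases "s \<le> T")
        case True
        have "(LINT r|?M. (if r \<le> s then 1 else 0) * k' r) = prim l k s"
          unfolding prim_def using True by (intro Bochner_Integration.integral_cong) (auto simp: k'_def indicator_def)
        then show ?thesis using hk s by (simp add: weak_deriv_def)
      qed (simp add: g'_def)
    qed (rule refl)
    also have "\<dots> = prim l (\<lambda>t. g t * h t) T - h 0 * prim l g T"
    proof -
      have "(LINT s|?M. g' s * (h s - h 0)) = (LINT s|?M. indicator {0..T} s * (g s * h s) - h 0 * g' s)"
        by (intro Bochner_Integration.integral_cong) (auto simp: g'_def algebra_simps)
      also have "\<dots> = (LINT s|?M. indicator {0..T} s * (g s * h s)) - (LINT s|?M. h 0 * g' s)"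
        using hg gi' by (intro Bochner_Integration.integral_diff integrable_indicator_mult integrable_mult_right)
          (auto simp: mult.commute dest: in_L2_integrable)
      finally show ?thesis by (simp add: prim_def g'_def)
    qed
    finally have I1: "(LINT s|?M. g' s * (LINT r|?M. (if r \<le> s then 1 else 0) * k' r)) = prim l (\<lambda>t. g t * h t) T - h 0 * prim l g T" .
    have "(LINT s|?M. LINT r|?M. (if s < r then 1 else 0) * (g' s * k' r)) = (LINT r|?M. LINT s|?M. (if s < r then 1 else 0) * (g' s * k' r))"
    proof (rule P.Fubini_integral[of "\<lambda>r s. (if s < r then 1 else 0) * (g' s * k' r)"])
      show "integrable (?M \<Otimes>\<^sub>M ?M) (\<lambda>(r, s). (if s < r then 1 else 0) * (g' s * k' r))"
        by (rule Bochner_Integration.integrable_bound[OF swap]) (auto simp: case_prod_beta intro!: AE_I2)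
    qed
    also have "\<dots> = (LINT r|?M. k' r * (f r - f 0))"
    proof (rule Bochner_Integration.integral_cong)
      fix r assume "r \<in> space ?M"
      then have r: "r \<in> {0..l}" by simp
      show "(LINT s|?M. (if s < r then 1 else 0) * (g' s * k' r)) = k' r * (f r - f 0)"
      proof (cases "r \<le> T")
        case True
        \<comment> \<open>The two triangles must be disjoint, so one of them excludes the diagonal;
          its section differs from \<open>{0..r}\<close> only by the null set
          \<open>s = r\<close>.\<close>
        have "(LINT s|?M. (if s < r then 1 else 0) * (g' s * k' r)) = (LINT s|?M. k' r * (indicator {0..r} s * g s))"
        proof (rule integral_cong_AE)
          show "AE s in ?M. (if s < r then 1 else 0) * (g' s * k' r) = k' r * (indicator {0..r} s * g s)"
            unfolding AE_Ivl using AE_lborel_singleton[of r]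
            by eventually_elim (use True in \<open>auto simp: g'_def indicator_def\<close>)
        qed measurable
        then show ?thesis using fg r by (simp add: weak_deriv_def prim_def)
      qed (simp add: k'_def)
    qed (rule refl)
    also have "\<dots> = prim l (\<lambda>t. f t * k t) T - f 0 * prim l k T"
    proof -
      have "(LINT s|?M. k' s * (f s - f 0)) = (LINT s|?M. indicator {0..T} s * (f s * k s) - f 0 * k' s)"
        by (intro Bochner_Integration.integral_cong) (auto simp: k'_def algebra_simps)
      also have "\<dots> = (LINT s|?M. indicator {0..T} s * (f s * k s)) - (LINT s|?M. f 0 * k' s)"
        using in_L2_integrable[OF fk] ki' by (intro Bochner_Integration.integral_diff integrable_indicator_mult integrable_mult_right) auto
      finally show ?thesis by (simp add: prim_def k'_def)
    qed
    finally have I2: "(LINT s|?M. LINT r|?M. (if s < r then 1 else 0) * (g' s * k' r)) = prim l (\<lambda>t. f t * k t) T - f 0 * prim l k T" .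
    have cut: "integrable ?M (\<lambda>r. (if Q r then 1 else 0) * k' r)" if "Measurable.pred ?M Q" for Q
      using that by (intro Bochner_Integration.integrable_bound[OF ki']) (auto intro!: AE_I2)
    have "prim l g T * prim l k T = (LINT s|?M. g' s * (LINT r|?M. k' r))"
      by (simp add: prim_def g'_def k'_def)
    also have "\<dots> = (LINT s|?M. g' s * (LINT r|?M. (if r \<le> s then 1 else 0) * k' r) + (LINT r|?M. (if s < r then 1 else 0) * (g' s * k' r)))"
    proof (rule Bochner_Integration.integral_cong)
      fix s
      have "(LINT r|?M. k' r) = (LINT r|?M. (if r \<le> s then 1 else 0) * k' r + (if s < r then 1 else 0) * k' r)"
        by (intro Bochner_Integration.integral_cong) auto
      also have "\<dots> = (LINT r|?M. (if r \<le> s then 1 else 0) * k' r) + (LINT r|?M. (if s < r then 1 else 0) * k' r)"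
        by (intro Bochner_Integration.integral_add cut) measurable
      finally show "g' s * (LINT r|?M. k' r) = g' s * (LINT r|?M. (if r \<le> s then 1 else 0) * k' r) + (LINT r|?M. (if s < r then 1 else 0) * (g' s * k' r))"
        by (simp add: distrib_left mult.left_commute)
    qed simp
    also have "\<dots> = (LINT s|?M. g' s * (LINT r|?M. (if r \<le> s then 1 else 0) * k' r)) + (LINT s|?M. LINT r|?M. (if s < r then 1 else 0) * (g' s * k' r))"
    proof (rule Bochner_Integration.integral_add)
      have "integrable (?M \<Otimes>\<^sub>M ?M) (\<lambda>p. (if fst p < snd p then 1 else 0) * (g' (fst p) * k' (snd p)))"
        by (rule Bochner_Integration.integrable_bound[OF prod]) (auto intro!: AE_I2)
      from P.integrable_fst'[OF this]
      show "integrable ?M (\<lambda>s. LINT r|?M. (if s < r then 1 else 0) * (g' s * k' r))" by simp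
      have "integrable (?M \<Otimes>\<^sub>M ?M) (\<lambda>p. (if snd p \<le> fst p then 1 else 0) * (g' (fst p) * k' (snd p)))"
        by (rule Bochner_Integration.integrable_bound[OF prod]) (auto intro!: AE_I2)
      from P.integrable_fst'[OF this]
      show "integrable ?M (\<lambda>s. g' s * (LINT r|?M. (if r \<le> s then 1 else 0) * k' r))"
        by (simp add: mult.left_commute)
    qed
    also have "\<dots> = (prim l (\<lambda>t. g t * h t) T - h 0 * prim l g T) + (prim l (\<lambda>t. f t * k t) T - f 0 * prim l k T)"
      by (simp only: I1 I2)
    finally have eq: "prim l g T * prim l k T = \<dots>" .
    have gh: "in_L2 l (\<lambda>t. g t * h t)" using hg by (simp add: mult.commute)
    have T_eq: "f T = f 0 + prim l g T" "h T = h 0 + prim l k T" using fg hk T by (auto simp: weak_deriv_def)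
    have "f T * h T - f 0 * h 0 = f 0 * prim l k T + h 0 * prim l g T + prim l g T * prim l k T"
      unfolding T_eq by (simp add: algebra_simps)
    then show ?thesis unfolding eq prim_add[OF gh fk] by simp
  qed
  then show ?thesis using L2 by (simp add: weak_deriv_def)
qed

text \<open>Adding L times the identity makes both \<open>f\<close> and its negative nondecreasing,
  so their increments define Stieltjes measures \<open>\<mu> 1\<close> and
  \<open>\<mu> (-1)\<close>. The sum of the two is 2 L times Lebesgue measure on the interval. Hence
  \<open>\<mu> 1\<close> has a density \<open>D\<close> between 0 and 2 L, and \<open>D - L\<close>
  is the derivative of \<open>f\<close>.\<close>

lemma lipschitz_weak_deriv:
  fixes f :: "real \<Rightarrow> real"
  assumes l: "0 \<le> l" and lip: "L-lipschitz_on {0..l} f"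
  obtains g where "weak_deriv l f g" "\<And>t. \<bar>g t\<bar> \<le> L" "g \<in> borel_measurable borel"
proof -
  have L0: "L \<ge> 0" using lip by (rule lipschitz_on_nonneg)
  have fL: "\<bar>f s - f t\<bar> \<le> L * \<bar>s - t\<bar>" if "s \<in> {0..l}" "t \<in> {0..l}" for s t
    using lipschitz_onD[OF lip that] by (simp add: dist_real_def)
  \<comment> \<open>Clamping to the interval extends \<open>f\<close> to the line by constants, so
    the distribution functions have limits at both infinities.\<close>
  define c where "c = (\<lambda>t::real. max 0 (min l t))"
  have c_in: "c t \<in> {0..l}" and c_id: "t \<in> {0..l} \<Longrightarrow> c t = t" for t using l by (auto simp: c_def)
  have c_cont: "continuous_on UNIV c" unfolding c_def by (intro continuous_intros)
  have c_mono: "x \<le> y \<Longrightarrow> c x \<le> c y" for x y by (auto simp: c_def)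
  define \<rho> where "\<rho> = interval_measure c"
  define F where "F = (\<lambda>s t. s * (f (c t) - f 0) + L * c t)"
  define \<mu> where "\<mu> = (\<lambda>s::real. interval_measure (F s))"
  have f_cont: "continuous_on {0..l} f" using lip by (rule lipschitz_on_continuous_on)
  have "continuous_on UNIV (\<lambda>t. f (c t))"
    using c_in by (intro continuous_on_compose2[OF f_cont c_cont]) auto
  then have F_cont: "continuous_on UNIV (F s)" for s unfolding F_def by (intro continuous_intros c_cont)
  have F_mono: "F s x \<le> F s y" if "x \<le> y" "\<bar>s\<bar> = 1" for s x y
  proof -
    have "\<bar>f (c x) - f (c y)\<bar> \<le> L * (c y - c x)"
      using fL[OF c_in c_in, of x y] c_mono[OF that(1)] by simp
    moreover have "s * (f (c x) - f (c y)) \<le> \<bar>f (c x) - f (c y)\<bar>"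
      using abs_ge_self[of "s * (f (c x) - f (c y))"] that(2) by (simp add: abs_mult)
    ultimately show ?thesis by (simp add: F_def algebra_simps)
  qed
  have right: "continuous (at_right a) h" if "continuous_on UNIV h" for h :: "real \<Rightarrow> real" and a
    using that by (metis UNIV_I at_within_open continuous_on_eq_continuous_within continuous_within_subset open_UNIV subset_UNIV)
  have c_bot: "(c \<longlongrightarrow> 0) at_bot"
    by (intro tendsto_eventually) (auto simp: eventually_at_bot_linorder c_def intro!: exI[of _ 0])
  have c_top: "(c \<longlongrightarrow> l) at_top"
    using l by (intro tendsto_eventually) (auto simp: eventually_at_top_linorder c_def intro!: exI[of _ l])
  have F_bot: "(F s \<longlongrightarrow> 0) at_bot" for s
    by (intro tendsto_eventually) (auto simp: eventually_at_bot_linorder c_def F_def intro!: exI[of _ 0])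
  have F_top: "(F s \<longlongrightarrow> F s l) at_top" for s
    using l by (intro tendsto_eventually) (auto simp: eventually_at_top_linorder c_def F_def intro!: exI[of _ l])
  have F0: "F s 0 = 0" for s using l by (simp add: F_def c_def)
  have fin_\<rho>: "finite_borel_measure \<rho>"
    unfolding \<rho>_def by (rule finite_borel_measure_interval_measure[OF c_mono right[OF c_cont] c_bot c_top l])
  have fin_\<mu>: "finite_borel_measure (\<mu> s)" if "\<bar>s\<bar> = 1" for s
    unfolding \<mu>_def using F_mono[OF l that, unfolded F0]
    by (intro finite_borel_measure_interval_measure[OF F_mono[OF _ that] right[OF F_cont] F_bot F_top])
  interpret R: finite_borel_measure \<rho> by (rule fin_\<rho>)
  interpret M1: finite_borel_measure "\<mu> 1" by (rule fin_\<mu>) simp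
  interpret M2: finite_borel_measure "\<mu> (-1)" by (rule fin_\<mu>) simp
  have sets: "sets \<rho> = sets borel" "sets (\<mu> s) = sets borel" "space \<rho> = UNIV" "space (\<mu> s) = UNIV" for s
    by (simp_all add: \<rho>_def \<mu>_def)
  have UNIV_eq: "measure (\<mu> 1) UNIV + measure (\<mu> (-1)) UNIV = 2 * L * measure \<rho> UNIV"
  proof -
    have "0 \<le> F s l" if "\<bar>s\<bar> = 1" for s using F_mono[OF l that, unfolded F0] .
    then have "measure (\<mu> s) UNIV = F s l" if "\<bar>s\<bar> = 1" for s
      using interval_measure_UNIV[OF F_mono[OF _ that] right[OF F_cont] F_bot F_top] that
      by (simp add: \<mu>_def Sigma_Algebra.measure_def)
    moreover have "measure \<rho> UNIV = l"
      using interval_measure_UNIV[OF c_mono right[OF c_cont] c_bot c_top l] l by (simp add: \<rho>_def Sigma_Algebra.measure_def)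
    ultimately show ?thesis using l by (simp add: F_def c_def)
  qed
  let ?G = "range (\<lambda>(a, b). {a<..b::real})"
  \<comment> \<open>Half-open intervals form an intersection-stable generator, on which the identity
    is read off from \<open>F 1\<close> and \<open>F (-1)\<close>, whose sum is
    \<open>2 * L * c\<close>. Complements and disjoint unions preserve it.\<close>
  have sum: "measure (\<mu> 1) A + measure (\<mu> (-1)) A = 2 * L * measure \<rho> A" if A: "A \<in> sets borel" for A
  proof (rule sigma_sets_induct_disjoint[where G="?G" and \<Omega>=UNIV])
    show "Int_stable ?G" by (auto simp: Int_stable_def)
    show "?G \<subseteq> Pow UNIV" by simp
    show "A \<in> sigma_sets UNIV ?G" using A by (simp add: borel_sigma_sets_Ioc)
    show "measure (\<mu> 1) {} + measure (\<mu> (-1)) {} = 2 * L * measure \<rho> {}" by simp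
  next
    fix B assume "B \<in> ?G"
    then obtain a b where B: "B = {a<..b}" by auto
    show "measure (\<mu> 1) B + measure (\<mu> (-1)) B = 2 * L * measure \<rho> B"
    proof (cases "a \<le> b")
      case True
      have m: "measure (\<mu> s) B = F s b - F s a" if "\<bar>s\<bar> = 1" for s
        unfolding \<mu>_def B by (rule measure_interval_measure_Ioc[OF True F_mono[OF _ that] right[OF F_cont]])
      have eq: "measure \<rho> B = c b - c a"
        unfolding \<rho>_def B by (rule measure_interval_measure_Ioc[OF True c_mono right[OF c_cont]])
      show ?thesis by (simp add: eq m F_def algebra_simps)
    qed (simp add: B)
  next
    fix B assume B: "B \<in> sigma_sets UNIV ?G" and eq: "measure (\<mu> 1) B + measure (\<mu> (-1)) B = 2 * L * measure \<rho> B"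
    then have "B \<in> sets borel" by (simp add: borel_sigma_sets_Ioc)
    then show "measure (\<mu> 1) (UNIV - B) + measure (\<mu> (-1)) (UNIV - B) = 2 * L * measure \<rho> (UNIV - B)"
      using UNIV_eq eq M1.finite_measure_compl[of B] M2.finite_measure_compl[of B] R.finite_measure_compl[of B]
      by (simp add: sets right_diff_distrib)
  next
    fix B :: "nat \<Rightarrow> real set" assume dis: "disjoint_family B" and B: "range B \<subseteq> sigma_sets UNIV ?G"
      and eq: "\<And>i. measure (\<mu> 1) (B i) + measure (\<mu> (-1)) (B i) = 2 * L * measure \<rho> (B i)"
    have B': "range B \<subseteq> sets borel" using B by (simp add: borel_sigma_sets_Ioc)
    have "(\<lambda>i. measure (\<mu> 1) (B i) + measure (\<mu> (-1)) (B i)) sums (measure (\<mu> 1) (\<Union>i. B i) + measure (\<mu> (-1)) (\<Union>i. B i))"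
      using B' dis by (intro sums_add M1.finite_measure_UNION M2.finite_measure_UNION) (simp_all add: sets)
    moreover have "(\<lambda>i. 2 * L * measure \<rho> (B i)) sums (2 * L * measure \<rho> (\<Union>i. B i))"
      using B' dis by (intro sums_mult R.finite_measure_UNION) (simp_all add: sets)
    ultimately show "measure (\<mu> 1) (\<Union>i. B i) + measure (\<mu> (-1)) (\<Union>i. B i) = 2 * L * measure \<rho> (\<Union>i. B i)"
      unfolding eq by (rule sums_unique2)
  qed
  have dom: "emeasure (\<mu> 1) A \<le> ennreal (2 * L) * emeasure \<rho> A" if "A \<in> sets borel" for A
  proof -
    have "measure (\<mu> 1) A \<le> 2 * L * measure \<rho> A"
      using sum[OF that] measure_nonneg[of "\<mu> (-1)" A] by linarith
    then show ?thesis
      using L0 by (simp add: M1.emeasure_eq_measure R.emeasure_eq_measure ennreal_mult[symmetric] ennreal_leI)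
  qed
  have "absolutely_continuous \<rho> (\<mu> 1)"
    unfolding absolutely_continuous_def
  proof
    fix A assume A: "A \<in> null_sets \<rho>"
    then have "emeasure (\<mu> 1) A \<le> 0" using dom[of A] by (auto simp: null_sets_def sets)
    then show "A \<in> null_sets (\<mu> 1)" using A by (auto simp: null_sets_def sets)
  qed
  then obtain D where D [measurable]: "D \<in> borel_measurable borel" and dens: "density \<rho> D = \<mu> 1"
    using R.Radon_Nikodym_finite_measure[OF M1.finite_measure_axioms] sets by (auto simp: measurable_cong_sets[OF sets(1) refl])
  have D\<rho> [measurable]: "D \<in> borel_measurable \<rho>" using D by (simp add: measurable_cong_sets[OF sets(1) refl])
  \<comment> \<open>The integral of \<open>D - 2 * L\<close> over the set where it is positive is 0
    by \<open>dom\<close>, so that set is null.\<close>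
  have D_le: "AE t in \<rho>. D t \<le> ennreal (2 * L)"
  proof -
    define A where "A = {t. ennreal (2 * L) < D t}"
    have A [measurable]: "A \<in> sets borel" unfolding A_def by measurable
    have A\<rho> [measurable]: "A \<in> sets \<rho>" by (simp add: sets)
    have "(\<integral>\<^sup>+t. (D t * indicator A t - ennreal (2 * L) * indicator A t) \<partial>\<rho>)
       = (\<integral>\<^sup>+t. D t * indicator A t \<partial>\<rho>) - (\<integral>\<^sup>+t. ennreal (2 * L) * indicator A t \<partial>\<rho>)"
    proof (rule nn_integral_diff)
      show "(\<integral>\<^sup>+t. ennreal (2 * L) * indicator A t \<partial>\<rho>) \<noteq> \<infinity>"
        by (simp add: nn_integral_cmult_indicator R.emeasure_eq_measure ennreal_mult_eq_top_iff)
    qed (auto simp: A_def indicator_def)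
    also have "(\<integral>\<^sup>+t. D t * indicator A t \<partial>\<rho>) = emeasure (\<mu> 1) A"
      unfolding dens[symmetric] by (rule emeasure_density[symmetric]) (simp_all add: D\<rho>)
    also have "(\<integral>\<^sup>+t. ennreal (2 * L) * indicator A t \<partial>\<rho>) = ennreal (2 * L) * emeasure \<rho> A"
      by (simp add: nn_integral_cmult_indicator)
    also have "emeasure (\<mu> 1) A - ennreal (2 * L) * emeasure \<rho> A = 0"
      using dom[OF A] by (rule diff_eq_0_ennreal[rotated]) (simp add: M1.emeasure_eq_measure)
    finally have "AE t in \<rho>. D t * indicator A t - ennreal (2 * L) * indicator A t = 0"
      by (subst (asm) nn_integral_0_iff_AE) auto
    then show ?thesis
    proof eventually_elim
      case (elim t)
      show ?case
      proof (rule ccontr)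
        assume "\<not> D t \<le> ennreal (2 * L)"
        then have "ennreal (2 * L) < D t" "t \<in> A" by (auto simp: A_def)
        then show False using elim by (auto simp: diff_eq_0_iff_ennreal dest: leD)
      qed
    qed
  qed
  have \<rho>_eq: "\<rho> = density lborel (indicator {0..l})"
  proof (rule cdf_unique'[OF fin_\<rho>])
    have em: "emeasure (density lborel (indicator {0..l})) A = emeasure lborel (A \<inter> {0..l})" if "A \<in> sets borel" for A :: "real set"
      using that by (subst emeasure_density) (auto simp: indicator_inter_arith[symmetric] mult.commute)
    show "finite_borel_measure (density lborel (indicator {0..l}))"
      by (intro finite_borel_measure.intro finite_measureI finite_borel_measure_axioms.intro) (simp_all add: em emeasure_lborel_Icc_eq)
    show "cdf \<rho> = cdf (density lborel (indicator {0..l}))"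
    proof
      fix x
      have "cdf \<rho> x = c x" unfolding \<rho>_def by (simp add: cdf_interval_measure[OF c_mono right[OF c_cont] c_bot])
      also have "{..x} \<inter> {0..l} = {0..min x l}" by auto
      then have "c x = measure lborel ({..x} \<inter> {0..l})"
        using l by (simp add: c_def min_def)
      also have "\<dots> = cdf (density lborel (indicator {0..l})) x"
        by (simp add: cdf_def Sigma_Algebra.measure_def em)
      finally show "cdf \<rho> x = cdf (density lborel (indicator {0..l})) x" .
    qed
  qed
  \<comment> \<open>Truncation makes the bound by \<open>L\<close> hold at every point; almost
    everywhere it leaves \<open>D - L\<close> unchanged.\<close>
  define g where "g = (\<lambda>t. max (-L) (min L (enn2real (D t) - L)))"
  have g_meas [measurable]: "g \<in> borel_measurable borel" unfolding g_def by measurable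
  have g_le: "\<bar>g t\<bar> \<le> L" for t using L0 by (auto simp: g_def abs_le_iff min_def max_def)
  have g_ge: "0 \<le> g t + L" for t using g_le[of t] by linarith
  have gL2: "in_L2 l g" by (rule bounded_in_L2[of _ _ L]) (use g_le in auto)
  have Dg: "AE t in \<rho>. D t = ennreal (g t + L)"
    using D_le
  proof eventually_elim
    case (elim t)
    then have "enn2real (D t) \<le> 2 * L" using L0 by (intro enn2real_leI) auto
    then have "g t + L = enn2real (D t)" by (auto simp: g_def)
    moreover have "D t \<noteq> \<infinity>" using elim by (auto simp: top_unique)
    ultimately show ?case by (simp add: ennreal_enn2real_if)
  qed
  have "prim l g t = f t - f 0" if t: "t \<in> {0..l}" for t
  proof -
    have int: "integrable (Ivl l) (\<lambda>s. indicator {0<..t} s * (g s + L))"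
      using gL2 by (intro integrable_indicator_mult Bochner_Integration.integrable_add in_L2_integrable) auto
    have "ennreal (F 1 t) = ennreal (F 1 t - F 1 0)" by (simp add: F0)
    also have "\<dots> = emeasure (\<mu> 1) {0<..t}"
      unfolding \<mu>_def using t by (subst emeasure_interval_measure_Ioc[OF _ F_mono right[OF F_cont]]) auto
    also have "\<dots> = (\<integral>\<^sup>+s. D s * indicator {0<..t} s \<partial>\<rho>)"
      unfolding dens[symmetric] by (rule emeasure_density) (simp_all add: D\<rho> sets)
    also have "\<dots> = (\<integral>\<^sup>+s. ennreal (g s + L) * indicator {0<..t} s \<partial>\<rho>)"
      using Dg by (intro nn_integral_cong_AE) (auto elim: eventually_mono)
    also have "\<dots> = (\<integral>\<^sup>+s. indicator {0..l} s * (ennreal (g s + L) * indicator {0<..t} s) \<partial>lborel)"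
      unfolding \<rho>_eq by (subst nn_integral_density) auto
    also have "\<dots> = (\<integral>\<^sup>+s. ennreal (indicator {0<..t} s * (g s + L)) \<partial>Ivl l)"
      by (subst nn_integral_restrict_space) (auto intro!: nn_integral_cong simp: indicator_def)
    also have "\<dots> = ennreal (LINT s|Ivl l. indicator {0<..t} s * (g s + L))"
      by (rule nn_integral_eq_integral[OF int], rule AE_I2) (use g_ge in \<open>auto simp: indicator_def\<close>)
    finally have "F 1 t = (LINT s|Ivl l. indicator {0<..t} s * (g s + L))"
    proof (subst (asm) ennreal_inj)
      show "0 \<le> F 1 t" using F_mono[of 0 t 1] t by (simp add: F0)
      show "0 \<le> (LINT s|Ivl l. indicator {0<..t} s * (g s + L))"
        by (rule Bochner_Integration.integral_nonneg) (use g_ge in \<open>auto simp: indicator_def\<close>)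
    qed
    also have "\<dots> = (LINT s|Ivl l. indicator {0<..t} s * g s + indicator {0<..t} s * L)"
      by (simp only: distrib_left)
    also have "\<dots> = (LINT s|Ivl l. indicator {0<..t} s * g s) + (LINT s|Ivl l. indicator {0<..t} s * L)"
      using gL2 in_L2_integrable[OF in_L2_const]
      by (intro Bochner_Integration.integral_add integrable_indicator_mult) (auto dest: in_L2_integrable)
    also have "(LINT s|Ivl l. indicator {0<..t} s * L) = t * L"
      using t measure_Ivl_Ioc[of 0 t l] by (subst integral_mult_left_zero) simp
    also have "(LINT s|Ivl l. indicator {0<..t} s * g s) = prim l g t"
      using t prim_increment[OF in_L2_integrable[OF gL2], of 0 t] by (simp add: prim_0)
    finally show ?thesis using c_id[OF t] by (simp add: F_def mult.commute)
  qed
  then have "weak_deriv l f g" using gL2 by (simp add: weak_deriv_def)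
  then show thesis by (rule that[OF _ g_le g_meas])
qed

section \<open>The energy space of a metric graph\<close>

type_synonym 'e graph_fun = "'e \<Rightarrow> real \<Rightarrow> real"

text \<open>A function is paired with its derivative: the derivative is determined only up to null
  sets, and carrying a version along makes the energy a plain bilinear expression.\<close>

definition H1_space :: "('e \<Rightarrow> real) \<Rightarrow> ('e graph_fun \<times> 'e graph_fun) set" where
  "H1_space len = {x. \<forall>e. weak_deriv (len e) (fst x e) (snd x e)}"

definition H1_graph :: "('e \<Rightarrow> 'v) \<Rightarrow> ('e \<Rightarrow> 'v) \<Rightarrow> ('e \<Rightarrow> real) \<Rightarrow> ('e graph_fun \<times> 'e graph_fun) set" where
  "H1_graph src tgt len = {x \<in> H1_space len. \<forall>j j'. endpt src tgt j = endpt src tgt j' \<longrightarrow>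
     at_endpt len (fst x) j = at_endpt len (fst x) j'}"

definition energy :: "('e::finite \<Rightarrow> real) \<Rightarrow> 'e graph_fun \<Rightarrow> 'e graph_fun \<Rightarrow>
    'e graph_fun \<times> 'e graph_fun \<Rightarrow> 'e graph_fun \<times> 'e graph_fun \<Rightarrow> real" where
  "energy len \<kappa> a x y = (\<Sum>e\<in>UNIV. LINT t|Ivl (len e).
     a e t * (snd x e t * snd y e t) + (\<kappa> e t)\<^sup>2 * (fst x e t * fst y e t))"

definition mass :: "('e::finite \<Rightarrow> real) \<Rightarrow> 'e graph_fun \<times> 'e graph_fun \<Rightarrow> 'e graph_fun \<times> 'e graph_fun \<Rightarrow> real" where
  "mass len x y = (\<Sum>e\<in>UNIV. LINT t|Ivl (len e). fst x e t * fst y e t)"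

lemma psd_form_subspace: "psd_form V E \<Longrightarrow> W \<subseteq> V \<Longrightarrow> subspace W \<Longrightarrow> psd_form W E"
  unfolding psd_form_def by (simp add: subset_eq)

lemma weak_deriv_const: "weak_deriv l (\<lambda>t. c) (\<lambda>t. 0)"
  by (simp add: weak_deriv_def prim_def)

lemma H1_space_subspace: "subspace (H1_space len)"
proof (rule subspaceI)
  show "0 \<in> H1_space len" by (simp add: H1_space_def zero_fun_def weak_deriv_const)
  show "x + y \<in> H1_space len" if xy: "x \<in> H1_space len" "y \<in> H1_space len" for x y
    unfolding H1_space_def mem_Collect_eq fst_add snd_add plus_fun_def
  proof
    fix e show "weak_deriv (len e) (\<lambda>t. fst x e t + fst y e t) (\<lambda>t. snd x e t + snd y e t)"
      by (rule weak_deriv_add) (use xy in \<open>auto simp: H1_space_def\<close>)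
  qed
  show "c *\<^sub>R x \<in> H1_space len" if x: "x \<in> H1_space len" for c x
    unfolding H1_space_def mem_Collect_eq fst_scaleR snd_scaleR scaleR_fun_def real_scaleR_def
  proof
    fix e show "weak_deriv (len e) (\<lambda>t. c * fst x e t) (\<lambda>t. c * snd x e t)"
      by (rule weak_deriv_scale) (use x in \<open>auto simp: H1_space_def\<close>)
  qed
qed

lemma H1_graphD: "\<lbrakk>x \<in> H1_graph src tgt len; endpt src tgt j = endpt src tgt j'\<rbrakk> \<Longrightarrow>
    at_endpt len (fst x) j = at_endpt len (fst x) j'"
  unfolding H1_graph_def by blast

lemma H1_graphI: "\<lbrakk>x \<in> H1_space len; \<And>j j'. endpt src tgt j = endpt src tgt j' \<Longrightarrow>
    at_endpt len (fst x) j = at_endpt len (fst x) j'\<rbrakk> \<Longrightarrow> x \<in> H1_graph src tgt len"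
  unfolding H1_graph_def by blast

lemma H1_graph_space: "x \<in> H1_graph src tgt len \<Longrightarrow> x \<in> H1_space len"
  unfolding H1_graph_def by blast

lemma H1_graph_subspace: "subspace (H1_graph src tgt len)"
proof (rule subspaceI)
  note S = H1_space_subspace[of len]
  show "0 \<in> H1_graph src tgt len"
    by (rule H1_graphI[OF subspace_0[OF S]]) (simp add: at_endpt_def)
  show "x + y \<in> H1_graph src tgt len" if x: "x \<in> H1_graph src tgt len" and y: "y \<in> H1_graph src tgt len" for x y
  proof (rule H1_graphI)
    show "x + y \<in> H1_space len" by (rule subspace_add[OF S H1_graph_space[OF x] H1_graph_space[OF y]])
    have eq: "at_endpt len (fst (x + y)) j = at_endpt len (fst x) j + at_endpt len (fst y) j" for j
      by (simp add: at_endpt_def)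
    show "at_endpt len (fst (x + y)) j = at_endpt len (fst (x + y)) j'" if "endpt src tgt j = endpt src tgt j'" for j j'
      unfolding eq H1_graphD[OF x that] H1_graphD[OF y that] by (rule refl)
  qed
  show "c *\<^sub>R x \<in> H1_graph src tgt len" if x: "x \<in> H1_graph src tgt len" for c x
  proof (rule H1_graphI)
    show "c *\<^sub>R x \<in> H1_space len" by (rule subspace_scale[OF S H1_graph_space[OF x]])
    have eq: "at_endpt len (fst (c *\<^sub>R x)) j = c * at_endpt len (fst x) j" for j
      by (simp add: at_endpt_def)
    show "at_endpt len (fst (c *\<^sub>R x)) j = at_endpt len (fst (c *\<^sub>R x)) j'" if "endpt src tgt j = endpt src tgt j'" for j j'
      unfolding eq H1_graphD[OF x that] by (rule refl)
  qed
qed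

lemma H1_graph_subset: "H1_graph src tgt len \<subseteq> H1_space len"
  by (rule subsetI, rule H1_graph_space)

text \<open>The coefficients without the vertex structure: \<open>H\<close> belongs to the
  disconnected edges. The locale is also instantiated with a single edge, indexed by
  \<open>unit\<close>, and its constants are parameters so that all edges share them.\<close>

locale graph_coeffs =
  fixes len :: "'e::finite \<Rightarrow> real" and \<kappa> a :: "'e graph_fun" and \<kappa>0 C\<kappa> a0 Ca La :: real
  assumes len_pos: "0 < len e"
    and \<kappa>_meas [measurable]: "\<kappa> e \<in> borel_measurable (Ivl (len e))"
    and \<kappa>_bounds: "AE t in Ivl (len e). \<kappa>0 \<le> \<kappa> e t \<and> \<bar>\<kappa> e t\<bar> \<le> C\<kappa>"
    and \<kappa>0_pos: "0 < \<kappa>0" and a0_pos: "0 < a0"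
    and a_lipschitz: "La-lipschitz_on {0..len e} (a e)"
    and a_bounds: "t \<in> {0..len e} \<Longrightarrow> a0 \<le> a e t \<and> a e t \<le> Ca"
begin

abbreviation "H \<equiv> H1_space len"
abbreviation "E \<equiv> energy len \<kappa> a"
abbreviation "B \<equiv> mass len"

lemma len_nonneg [simp]: "0 \<le> len e"
  using len_pos[of e] by simp

lemma a_meas [measurable]: "a e \<in> borel_measurable (Ivl (len e))"
  using a_lipschitz[of e] by (intro continuous_measurable_Ivl lipschitz_on_continuous_on)

lemma H_weak_deriv: "x \<in> H \<Longrightarrow> weak_deriv (len e) (fst x e) (snd x e)"
  by (simp add: H1_space_def)

lemma H_in_L2: "x \<in> H \<Longrightarrow> in_L2 (len e) (fst x e)" "x \<in> H \<Longrightarrow> in_L2 (len e) (snd x e)"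
  using weak_deriv_in_L2'[OF H_weak_deriv, of x e] weak_deriv_in_L2[OF H_weak_deriv, of x e] by simp_all

lemma a_mult_L2: assumes "in_L2 (len e) g" shows "in_L2 (len e) (\<lambda>t. a e t * g t)"
proof (rule in_L2_bounded_mult[OF assms _ AE_I2])
  show "\<bar>a e t\<bar> \<le> Ca" if "t \<in> space (Ivl (len e))" for t
    using a_bounds[of t e] a0_pos that by simp
qed measurable

lemma \<kappa>_mult_L2: "in_L2 (len e) f \<Longrightarrow> in_L2 (len e) (\<lambda>t. (\<kappa> e t)\<^sup>2 * f t)"
proof (rule in_L2_bounded_mult[of _ _ _ "C\<kappa>\<^sup>2"])
  show "AE t in Ivl (len e). \<bar>(\<kappa> e t)\<^sup>2\<bar> \<le> C\<kappa>\<^sup>2"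
    using \<kappa>_bounds[of e] by eventually_elim (unfold abs_power2, subst abs_le_square_iff[symmetric], linarith)
qed measurable

lemma E_integrable:
  assumes "x \<in> H" "y \<in> H"
  shows "integrable (Ivl (len e)) (\<lambda>t. a e t * (snd x e t * snd y e t))"
    "integrable (Ivl (len e)) (\<lambda>t. (\<kappa> e t)\<^sup>2 * (fst x e t * fst y e t))"
    "integrable (Ivl (len e)) (\<lambda>t. fst x e t * fst y e t)"
  using in_L2_mult_integrable[OF a_mult_L2[OF H_in_L2(2)[OF assms(1)]] H_in_L2(2)[OF assms(2)], of e]
    in_L2_mult_integrable[OF \<kappa>_mult_L2[OF H_in_L2(1)[OF assms(1)]] H_in_L2(1)[OF assms(2)], of e]
    in_L2_mult_integrable[OF H_in_L2(1)[OF assms(1)] H_in_L2(1)[OF assms(2)], of e]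
  by (simp_all add: mult.assoc)

lemma energy_split:
  assumes "x \<in> H" "y \<in> H"
  shows "E x y = (\<Sum>e\<in>UNIV. (LINT t|Ivl (len e). a e t * (snd x e t * snd y e t)) +
     (LINT t|Ivl (len e). (\<kappa> e t)\<^sup>2 * (fst x e t * fst y e t)))"
  unfolding energy_def
  by (intro sum.cong refl Bochner_Integration.integral_add E_integrable assms)

lemma E_psd: "psd_form H E"
proof
  show "subspace H" by (rule H1_space_subspace)
  fix x y z :: "'e graph_fun \<times> 'e graph_fun" and c :: real
  assume x: "x \<in> H"
  have "0 \<le> a e t * (snd x e t * snd x e t) + (\<kappa> e t)\<^sup>2 * (fst x e t * fst x e t)" if "t \<in> {0..len e}" for e t
    by (intro add_nonneg_nonneg mult_nonneg_nonneg[of "a e t"] mult_nonneg_nonneg[of "(\<kappa> e t)\<^sup>2"] zero_le_square zero_le_power2)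
      (use a_bounds[OF that] a0_pos in linarith)
  then show "0 \<le> E x x"
    unfolding energy_def by (intro sum_nonneg Bochner_Integration.integral_nonneg) simp
  assume y: "y \<in> H"
  have "a e t * (snd x e t * snd y e t) + (\<kappa> e t)\<^sup>2 * (fst x e t * fst y e t) =
      a e t * (snd y e t * snd x e t) + (\<kappa> e t)\<^sup>2 * (fst y e t * fst x e t)" for e t by simp
  then show "E x y = E y x" unfolding energy_def by presburger
  have "a e t * (snd (c *\<^sub>R x) e t * snd y e t) + (\<kappa> e t)\<^sup>2 * (fst (c *\<^sub>R x) e t * fst y e t) =
      c * (a e t * (snd x e t * snd y e t) + (\<kappa> e t)\<^sup>2 * (fst x e t * fst y e t))" for e t
    by (simp add: distrib_left)
  then show "E (c *\<^sub>R x) y = c * E x y"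
    unfolding energy_def by (simp only: integral_mult_right_zero sum_distrib_left)
  assume z: "z \<in> H"
  have "E (x + y) z = (\<Sum>e\<in>UNIV. LINT t|Ivl (len e). (a e t * (snd x e t * snd z e t) + (\<kappa> e t)\<^sup>2 * (fst x e t * fst z e t))
     + (a e t * (snd y e t * snd z e t) + (\<kappa> e t)\<^sup>2 * (fst y e t * fst z e t)))"
    unfolding energy_def by (intro sum.cong refl Bochner_Integration.integral_cong) (simp_all add: distrib_left distrib_right)
  also have "\<dots> = E x z + E y z"
    unfolding energy_def sum.distrib[symmetric]
    by (intro sum.cong refl Bochner_Integration.integral_add Bochner_Integration.integrable_add E_integrable x y z)
  finally show "E (x + y) z = E x z + E y z" .
qed

lemma B_psd: "psd_form H B"
proof
  show "subspace H" by (rule H1_space_subspace)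
  fix x y z :: "'e graph_fun \<times> 'e graph_fun" and c :: real
  assume x: "x \<in> H"
  show "0 \<le> B x x" unfolding mass_def by (intro sum_nonneg Bochner_Integration.integral_nonneg) simp
  assume y: "y \<in> H"
  have "fst x e t * fst y e t = fst y e t * fst x e t" for e t by simp
  then show "B x y = B y x" unfolding mass_def by presburger
  have "fst (c *\<^sub>R x) e t * fst y e t = c * (fst x e t * fst y e t)" for e t by simp
  then show "B (c *\<^sub>R x) y = c * B x y"
    unfolding mass_def by (simp only: integral_mult_right_zero sum_distrib_left)
  assume z: "z \<in> H"
  have "B (x + y) z = (\<Sum>e\<in>UNIV. LINT t|Ivl (len e). fst x e t * fst z e t + fst y e t * fst z e t)"
    unfolding mass_def by (simp add: distrib_right)
  also have "\<dots> = B x z + B y z"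
    unfolding mass_def sum.distrib[symmetric]
    by (intro sum.cong refl Bochner_Integration.integral_add E_integrable x y z)
  finally show "B (x + y) z = B x z + B y z" .
qed

lemma coercive:
  assumes x: "x \<in> H"
  shows "a0 * (\<Sum>e\<in>UNIV. LINT t|Ivl (len e). (snd x e t)\<^sup>2) + \<kappa>0\<^sup>2 * B x x \<le> E x x"
proof -
  have "a0 * (LINT t|Ivl (len e). (snd x e t)\<^sup>2) \<le> (LINT t|Ivl (len e). a e t * (snd x e t * snd x e t))" for e
    unfolding integral_mult_right_zero[symmetric]
  proof (rule integral_mono)
    show "integrable (Ivl (len e)) (\<lambda>t. a0 * (snd x e t)\<^sup>2)" using in_L2_square[OF H_in_L2(2)[OF x]] by simp
    show "integrable (Ivl (len e)) (\<lambda>t. a e t * (snd x e t * snd x e t))" by (rule E_integrable[OF x x])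
    show "a0 * (snd x e t)\<^sup>2 \<le> a e t * (snd x e t * snd x e t)" if "t \<in> space (Ivl (len e))" for t
      using a_bounds[of t e] that by (auto simp: power2_eq_square intro!: mult_right_mono)
  qed
  moreover have "\<kappa>0\<^sup>2 * (LINT t|Ivl (len e). fst x e t * fst x e t) \<le> (LINT t|Ivl (len e). (\<kappa> e t)\<^sup>2 * (fst x e t * fst x e t))" for e
    unfolding integral_mult_right_zero[symmetric]
  proof (rule integral_mono_AE)
    show "AE t in Ivl (len e). \<kappa>0\<^sup>2 * (fst x e t * fst x e t) \<le> (\<kappa> e t)\<^sup>2 * (fst x e t * fst x e t)"
      using \<kappa>_bounds[of e] by eventually_elim (use \<kappa>0_pos in \<open>auto intro!: mult_right_mono power_mono\<close>)
  qed (use E_integrable[OF x x] in auto)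
  ultimately have "(\<Sum>e\<in>UNIV. a0 * (LINT t|Ivl (len e). (snd x e t)\<^sup>2) + \<kappa>0\<^sup>2 * (LINT t|Ivl (len e). fst x e t * fst x e t)) \<le> E x x"
    unfolding energy_split[OF x x] by (intro sum_mono add_mono)
  then show ?thesis by (simp only: mass_def sum.distrib sum_distrib_left)
qed

lemma B_nonneg: "x \<in> H \<Longrightarrow> 0 \<le> B x x"
  using psd_form.nonneg[OF B_psd] .

lemma E_nonneg: "x \<in> H \<Longrightarrow> 0 \<le> E x x"
  using psd_form.nonneg[OF E_psd] .

lemma deriv_le_energy:
  assumes x: "x \<in> H" shows "(LINT t|Ivl (len e). (snd x e t)\<^sup>2) \<le> E x x / a0"
proof -
  have "(LINT t|Ivl (len e). (snd x e t)\<^sup>2) \<le> (\<Sum>e\<in>UNIV. LINT t|Ivl (len e). (snd x e t)\<^sup>2)"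
    by (intro member_le_sum) auto
  moreover have "a0 * (\<Sum>e\<in>UNIV. LINT t|Ivl (len e). (snd x e t)\<^sup>2) \<le> E x x"
    using coercive[OF x] B_nonneg[OF x] by (smt (verit) zero_le_mult_iff zero_le_power2)
  ultimately have "a0 * (LINT t|Ivl (len e). (snd x e t)\<^sup>2) \<le> E x x"
    using a0_pos by (meson mult_left_mono less_imp_le order_trans)
  then show ?thesis using a0_pos by (simp add: field_simps)
qed

lemma mass_le_energy: assumes x: "x \<in> H" shows "B x x \<le> (1 / \<kappa>0\<^sup>2) * E x x"
proof -
  have "0 \<le> a0 * (\<Sum>e\<in>UNIV. LINT t|Ivl (len e). (snd x e t)\<^sup>2)"
    using a0_pos by (intro mult_nonneg_nonneg sum_nonneg) auto
  then have "\<kappa>0\<^sup>2 * B x x \<le> E x x" using coercive[OF x] by linarith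
  then show ?thesis using \<kappa>0_pos by (simp add: field_simps)
qed

text \<open>The constant of \<open>weak_deriv_sup_bound\<close> divided by the length, after mass
  and derivative have been bounded by the energy. Summing over the edges makes it the same for all
  of them.\<close>

definition Cev :: real where
  "Cev = (\<Sum>e\<in>UNIV. (2 / \<kappa>0\<^sup>2 + 2 * (len e)\<^sup>2 / a0) / len e)"

lemma evaluation:
  assumes x: "x \<in> H" and t: "t \<in> {0..len e}"
  shows "(fst x e t)\<^sup>2 \<le> Cev * E x x"
proof -
  have "(LINT s|Ivl (len e). (fst x e s)\<^sup>2) \<le> B x x"
    unfolding mass_def power2_eq_square by (rule member_le_sum) auto
  then have "2 * (LINT s|Ivl (len e). (fst x e s)\<^sup>2) \<le> 2 / \<kappa>0\<^sup>2 * E x x"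
    using mass_le_energy[OF x] by simp
  moreover have "2 * (len e)\<^sup>2 * (LINT s|Ivl (len e). (snd x e s)\<^sup>2) \<le> 2 * (len e)\<^sup>2 * (E x x / a0)"
    using deriv_le_energy[OF x] by (intro mult_left_mono) auto
  ultimately have "len e * (fst x e t)\<^sup>2 \<le> 2 / \<kappa>0\<^sup>2 * E x x + 2 * (len e)\<^sup>2 * (E x x / a0)"
    using weak_deriv_sup_bound[OF H_weak_deriv[OF x] t] by linarith
  also have "\<dots> = (2 / \<kappa>0\<^sup>2 + 2 * (len e)\<^sup>2 / a0) * E x x" by (simp add: distrib_right)
  finally have "(fst x e t)\<^sup>2 \<le> ((2 / \<kappa>0\<^sup>2 + 2 * (len e)\<^sup>2 / a0) / len e) * E x x"
    using len_pos[of e] by (simp add: pos_le_divide_eq mult.commute)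
  also have "\<dots> \<le> Cev * E x x"
    unfolding Cev_def using E_nonneg[OF x] a0_pos
    by (intro mult_right_mono member_le_sum) (auto intro!: divide_nonneg_nonneg add_nonneg_nonneg)
  finally show ?thesis .
qed

lemma Cev_nonneg: "0 \<le> Cev"
  unfolding Cev_def using a0_pos by (intro sum_nonneg divide_nonneg_nonneg add_nonneg_nonneg) auto

text \<open>Bounds the energy by the two quantities whose limits are constructed in the completeness
  proof: the values at the starting points and the L2 norms of the derivatives.\<close>

lemma energy_upper:
  obtains M where "0 \<le> M" "\<And>x. x \<in> H \<Longrightarrow> E x x \<le> M * (\<Sum>e\<in>UNIV. (fst x e 0)\<^sup>2 + (LINT t|Ivl (len e). (snd x e t)\<^sup>2))"
proof -
  \<comment> \<open>Collects the bounds \<open>Ca\<close> for \<open>a\<close> and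
    \<open>C\<kappa>\<close> for \<open>\<kappa>\<close>, together with f(t)^2 \<le> 2 f(0)^2 + 2
    \<open>len e\<close> times the square integral of the derivative.\<close>
  define N where "N = (\<lambda>e. Ca + 2 * C\<kappa>\<^sup>2 * len e + 2 * C\<kappa>\<^sup>2 * (len e)\<^sup>2)"
  define M where "M = (\<Sum>e\<in>UNIV. N e)"
  have Ca: "0 \<le> Ca" using a_bounds[of 0 undefined] a0_pos by auto
  have N0: "0 \<le> N e" for e unfolding N_def using Ca by (intro add_nonneg_nonneg mult_nonneg_nonneg) auto
  have "E x x \<le> M * (\<Sum>e\<in>UNIV. (fst x e 0)\<^sup>2 + (LINT t|Ivl (len e). (snd x e t)\<^sup>2))" if x: "x \<in> H" for x
  proof -
    have edge: "(LINT t|Ivl (len e). a e t * (snd x e t * snd x e t)) + (LINT t|Ivl (len e). (\<kappa> e t)\<^sup>2 * (fst x e t * fst x e t))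
      \<le> M * ((fst x e 0)\<^sup>2 + (LINT t|Ivl (len e). (snd x e t)\<^sup>2))" for e
    proof -
      let ?g = "LINT t|Ivl (len e). (snd x e t)\<^sup>2"
      let ?f = "(fst x e 0)\<^sup>2"
      have g0: "0 \<le> ?g" by simp
      have "(LINT t|Ivl (len e). a e t * (snd x e t * snd x e t)) \<le> Ca * ?g"
        unfolding integral_mult_right_zero[symmetric]
      proof (rule integral_mono)
        show "integrable (Ivl (len e)) (\<lambda>t. Ca * (snd x e t)\<^sup>2)" using in_L2_square[OF H_in_L2(2)[OF x]] by simp
        show "integrable (Ivl (len e)) (\<lambda>t. a e t * (snd x e t * snd x e t))" by (rule E_integrable[OF x x])
        show "a e t * (snd x e t * snd x e t) \<le> Ca * (snd x e t)\<^sup>2" if "t \<in> space (Ivl (len e))" for t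
          using a_bounds[of t e] that by (auto simp: power2_eq_square intro!: mult_right_mono)
      qed
      moreover have "(LINT t|Ivl (len e). (\<kappa> e t)\<^sup>2 * (fst x e t * fst x e t)) \<le> (LINT t|Ivl (len e). C\<kappa>\<^sup>2 * (2 * ?f + 2 * len e * ?g))"
      proof (rule integral_mono_AE)
        show "integrable (Ivl (len e)) (\<lambda>t. C\<kappa>\<^sup>2 * (2 * ?f + 2 * len e * ?g))" by (rule in_L2_integrable[OF in_L2_const])
        show "AE t in Ivl (len e). (\<kappa> e t)\<^sup>2 * (fst x e t * fst x e t) \<le> C\<kappa>\<^sup>2 * (2 * ?f + 2 * len e * ?g)"
          using \<kappa>_bounds[of e] AE_space
        proof eventually_elim
          case (elim t)
          then have t: "t \<in> {0..len e}" by simp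
          have "(fst x e t)\<^sup>2 \<le> 2 * ?f + 2 * (fst x e t - fst x e 0)\<^sup>2"
            using sum_squares_bound[of "fst x e 0" "fst x e t - fst x e 0"] by (simp add: power2_eq_square algebra_simps)
          also have "(fst x e t - fst x e 0)\<^sup>2 \<le> \<bar>t - 0\<bar> * ?g"
            by (rule weak_deriv_holder[OF H_weak_deriv[OF x] _ t]) simp
          also have "\<dots> \<le> len e * ?g" using t g0 by (intro mult_right_mono) auto
          finally have "(fst x e t)\<^sup>2 \<le> 2 * ?f + 2 * len e * ?g" by simp
          moreover have "(\<kappa> e t)\<^sup>2 \<le> C\<kappa>\<^sup>2" using elim by (subst abs_le_square_iff[symmetric]) linarith
          ultimately show ?case unfolding power2_eq_square[of "fst x e t", symmetric] by (intro mult_mono) auto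
        qed
      qed (rule E_integrable[OF x x])
      moreover have "(LINT t|Ivl (len e). C\<kappa>\<^sup>2 * (2 * ?f + 2 * len e * ?g)) = len e * (C\<kappa>\<^sup>2 * (2 * ?f + 2 * len e * ?g))"
        using measure_Ivl_subinterval[of 0 "len e" "len e"] by simp
      ultimately have "(LINT t|Ivl (len e). a e t * (snd x e t * snd x e t)) + (LINT t|Ivl (len e). (\<kappa> e t)\<^sup>2 * (fst x e t * fst x e t))
        \<le> Ca * ?g + len e * (C\<kappa>\<^sup>2 * (2 * ?f + 2 * len e * ?g))" by linarith
      also have "\<dots> = (2 * C\<kappa>\<^sup>2 * len e) * ?f + (Ca + 2 * C\<kappa>\<^sup>2 * (len e)\<^sup>2) * ?g"
        by (simp add: power2_eq_square algebra_simps)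
      also have "\<dots> \<le> N e * ?f + N e * ?g"
        using Ca g0 unfolding N_def by (intro add_mono mult_right_mono) (auto intro!: add_nonneg_nonneg mult_nonneg_nonneg)
      also have "\<dots> = N e * (?f + ?g)" by (simp add: distrib_left)
      also have "\<dots> \<le> M * (?f + ?g)"
        unfolding M_def using N0 g0 by (intro mult_right_mono member_le_sum) auto
      finally show ?thesis .
    qed
    show ?thesis unfolding energy_split[OF x x] sum_distrib_left by (intro sum_mono edge)
  qed
  moreover have "0 \<le> M" unfolding M_def by (intro sum_nonneg N0)
  ultimately show thesis using that by blast
qed

text \<open>The limit is assembled from the L2 limit \<open>g\<close> of the derivatives and the
  limits \<open>c\<close> of the values at 0, as \<open>c\<close> plus the primitive of
  \<open>g\<close>. Convergence in energy follows from \<open>energy_upper\<close>.\<close>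

lemma E_complete: "complete_form H E"
proof -
  interpret psd_form H E by (rule E_psd)
  show ?thesis
  proof
    fix f :: "nat \<Rightarrow> 'e graph_fun \<times> 'e graph_fun"
    assume f: "\<And>n. f n \<in> H" and cauchy: "\<And>e. e > 0 \<Longrightarrow> \<exists>N. \<forall>m\<ge>N. \<forall>n\<ge>N. E (f m - f n) (f m - f n) < e"
    have d: "f m - f n \<in> H" for m n using f by auto
    have "\<exists>g. in_L2 (len e) g \<and> (\<lambda>n. LINT t|Ivl (len e). (snd (f n) e t - g t)\<^sup>2) \<longlonglongrightarrow> 0" for e
    proof (rule L2_complete)
      show "in_L2 (len e) (snd (f n) e)" for n using f by (rule H_in_L2)
      fix r :: real assume "r > 0"
      then have "r * a0 > 0" using a0_pos by simp
      then obtain N where N: "\<And>m n. m \<ge> N \<Longrightarrow> n \<ge> N \<Longrightarrow> E (f m - f n) (f m - f n) < r * a0"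
        using cauchy by meson
      have "(LINT t|Ivl (len e). (snd (f m) e t - snd (f n) e t)\<^sup>2) < r" if "m \<ge> N" "n \<ge> N" for m n
      proof -
        have "(LINT t|Ivl (len e). (snd (f m) e t - snd (f n) e t)\<^sup>2) \<le> E (f m - f n) (f m - f n) / a0"
          using deriv_le_energy[OF d[of m n], of e] by simp
        also have "\<dots> < r" using N[OF that] a0_pos by (simp add: field_simps)
        finally show ?thesis .
      qed
      then show "\<exists>N. \<forall>m\<ge>N. \<forall>n\<ge>N. (LINT t|Ivl (len e). (snd (f m) e t - snd (f n) e t)\<^sup>2) < r" by meson
    qed
    from choice[OF allI[OF this]]
    obtain g where g': "\<forall>e. in_L2 (len e) (g e) \<and> (\<lambda>n. LINT t|Ivl (len e). (snd (f n) e t - g e t)\<^sup>2) \<longlonglongrightarrow> 0" ..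
    have g: "in_L2 (len e) (g e)" "(\<lambda>n. LINT t|Ivl (len e). (snd (f n) e t - g e t)\<^sup>2) \<longlonglongrightarrow> 0" for e
      using spec[OF g', of e] by (rule conjunct1, rule conjunct2)
    have "Cauchy (\<lambda>n. fst (f n) e 0)" for e
    proof (rule metric_CauchyI)
      fix r :: real assume r: "r > 0"
      then have "r\<^sup>2 / (Cev + 1) > 0" using Cev_nonneg by simp
      then obtain N where N: "\<And>m n. m \<ge> N \<Longrightarrow> n \<ge> N \<Longrightarrow> E (f m - f n) (f m - f n) < r\<^sup>2 / (Cev + 1)"
        using cauchy by meson
      have "dist (fst (f m) e 0) (fst (f n) e 0) < r" if "m \<ge> N" "n \<ge> N" for m n
      proof -
        have "(fst (f m) e 0 - fst (f n) e 0)\<^sup>2 \<le> Cev * E (f m - f n) (f m - f n)"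
          using evaluation[OF d[of m n], of 0 e] by simp
        also have "\<dots> \<le> (Cev + 1) * E (f m - f n) (f m - f n)"
          using E_nonneg[OF d] by (intro mult_right_mono) auto
        also have "\<dots> < r\<^sup>2" using N[OF that] Cev_nonneg by (simp add: field_simps add_pos_nonneg)
        finally have "\<bar>fst (f m) e 0 - fst (f n) e 0\<bar> < r" using r by (metis abs_of_pos power2_abs power2_less_imp_less abs_ge_zero less_imp_le)
        then show ?thesis by (simp add: dist_real_def)
      qed
      then show "\<exists>N. \<forall>m\<ge>N. \<forall>n\<ge>N. dist (fst (f m) e 0) (fst (f n) e 0) < r" by meson
    qed
    then have c: "(\<lambda>n. fst (f n) e 0) \<longlonglongrightarrow> lim (\<lambda>n. fst (f n) e 0)" for e
      using Cauchy_convergent convergent_LIMSEQ_iff by blast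
    define c where "c = (\<lambda>e. lim (\<lambda>n. fst (f n) e 0))"
    have c: "(\<lambda>n. fst (f n) e 0) \<longlonglongrightarrow> c e" for e unfolding c_def by (rule c)
    define x where "x = ((\<lambda>e t. c e + prim (len e) (g e) t), g)"
    have x: "x \<in> H" using weak_deriv_prim[OF g(1)] by (simp add: x_def H1_space_def)
    obtain M where M': "0 \<le> M" "\<forall>x\<in>H. E x x \<le> M * (\<Sum>e\<in>UNIV. (fst x e 0)\<^sup>2 + (LINT t|Ivl (len e). (snd x e t)\<^sup>2))"
      by (rule energy_upper) (rule that, assumption, rule ballI)
    note M = M'(1) M'(2)[rule_format]
    have "(\<lambda>n. M * (\<Sum>e\<in>UNIV. (fst (f n) e 0 - c e)\<^sup>2 + (LINT t|Ivl (len e). (snd (f n) e t - g e t)\<^sup>2))) \<longlonglongrightarrow>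
       M * (\<Sum>e\<in>UNIV. (c e - c e)\<^sup>2 + 0)"
      by (intro tendsto_intros c g(2))
    then have lim: "(\<lambda>n. M * (\<Sum>e\<in>UNIV. (fst (f n) e 0 - c e)\<^sup>2 + (LINT t|Ivl (len e). (snd (f n) e t - g e t)\<^sup>2))) \<longlonglongrightarrow> 0" by simp
    have "(\<lambda>n. E (f n - x) (f n - x)) \<longlonglongrightarrow> 0"
    proof (rule squeeze_null[OF _ _ lim])
      show "0 \<le> E (f n - x) (f n - x)" for n using f x by (intro nonneg V_diff)
      show "E (f n - x) (f n - x) \<le> M * (\<Sum>e\<in>UNIV. (fst (f n) e 0 - c e)\<^sup>2 + (LINT t|Ivl (len e). (snd (f n) e t - g e t)\<^sup>2))" for n
        using M(2)[OF V_diff[OF f x], of n] by (simp add: x_def prim_0)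
    qed
    with x show "\<exists>g\<in>H. (\<lambda>n. E (f n - g) (f n - g)) \<longlonglongrightarrow> 0" by blast
  qed
qed

end

section \<open>The subspace of functions that are continuous at the vertices\<close>

locale graph_form = graph_coeffs len \<kappa> a \<kappa>0 C\<kappa> a0 Ca La
  for len :: "'e::finite \<Rightarrow> real" and \<kappa> a :: "'e graph_fun" and \<kappa>0 C\<kappa> a0 Ca La :: real +
  fixes src tgt :: "'e \<Rightarrow> 'v"
begin

abbreviation "V \<equiv> H1_graph src tgt len"

lemma V_H: "x \<in> V \<Longrightarrow> x \<in> H"
  by (rule H1_graph_space)

text \<open>\<open>V\<close> is closed in \<open>H\<close> because point evaluations are continuous
  in energy.\<close>

lemma E_complete_V: "complete_form V E"
proof -
  interpret psd_form H E by (rule E_psd)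
  interpret V: psd_form V E by (rule psd_form_subspace[OF E_psd H1_graph_subset H1_graph_subspace])
  interpret HC: complete_form H E by (rule E_complete)
  show ?thesis
  proof
    fix f :: "nat \<Rightarrow> 'e graph_fun \<times> 'e graph_fun"
    assume f: "\<And>n. f n \<in> V" and cauchy: "\<And>e. e > 0 \<Longrightarrow> \<exists>N. \<forall>m\<ge>N. \<forall>n\<ge>N. E (f m - f n) (f m - f n) < e"
    obtain x where x: "x \<in> H" "(\<lambda>n. E (f n - x) (f n - x)) \<longlonglongrightarrow> 0"
      using HC.complete[OF V_H[OF f] cauchy] by blast
    have ev: "(\<lambda>n. fst (f n) e t) \<longlonglongrightarrow> fst x e t" if t: "t \<in> {0..len e}" for e t
    proof -
      have "(\<lambda>n. (fst (f n) e t - fst x e t)\<^sup>2) \<longlonglongrightarrow> 0"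
      proof (rule squeeze_null)
        show "(\<lambda>n. Cev * E (f n - x) (f n - x)) \<longlonglongrightarrow> 0" using tendsto_mult_right_zero[OF x(2)] .
        show "(fst (f n) e t - fst x e t)\<^sup>2 \<le> Cev * E (f n - x) (f n - x)" for n
          using evaluation[OF V_diff[OF V_H[OF f] x(1)] t, of n] by simp
      qed simp
      then have "(\<lambda>n. fst (f n) e t - fst x e t) \<longlonglongrightarrow> 0" by (simp add: tendsto_null_power)
      then show ?thesis by (simp add: LIM_zero_iff)
    qed
    have ev': "(\<lambda>n. at_endpt len (fst (f n)) j) \<longlonglongrightarrow> at_endpt len (fst x) j" for j
      unfolding at_endpt_def by (rule ev) (auto simp: endpt_pos_def)
    have "at_endpt len (fst x) j = at_endpt len (fst x) j'" if "endpt src tgt j = endpt src tgt j'" for j j'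
    proof (rule LIMSEQ_unique[OF ev'])
      have "at_endpt len (fst (f n)) j = at_endpt len (fst (f n)) j'" for n
        by (rule H1_graphD[OF f that])
      then show "(\<lambda>n. at_endpt len (fst (f n)) j) \<longlonglongrightarrow> at_endpt len (fst x) j'" using ev'[of j'] by simp
    qed
    then have "x \<in> V" by (rule H1_graphI[OF x(1)])
    with x(2) show "\<exists>g\<in>V. (\<lambda>n. E (f n - g) (f n - g)) \<longlonglongrightarrow> 0" by blast
  qed
qed

end

definition hat :: "real \<Rightarrow> real \<Rightarrow> real \<Rightarrow> real" where
  "hat \<alpha> \<beta> t = max 0 (min (t - \<alpha>) (\<beta> - t))"

lemma hat_lipschitz: "1-lipschitz_on S (hat \<alpha> \<beta>)"
  by (rule lipschitz_onI) (auto simp: hat_def dist_real_def)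

lemma hat_disjoint: "\<beta> \<le> \<alpha>' \<or> \<beta>' \<le> \<alpha> \<Longrightarrow> hat \<alpha> \<beta> t * hat \<alpha>' \<beta>' t = 0"
  by (auto simp: hat_def)

context graph_form
begin

lemma B_psd_V: "psd_form V B"
  by (rule psd_form_subspace[OF B_psd H1_graph_subset H1_graph_subspace])

text \<open>By continuity the function vanishes on its edges everywhere and not only almost
  everywhere; its derivative is then almost everywhere 0, and no energy is left.\<close>

lemma mass_definite:
  assumes x: "x \<in> H" and 0: "B x x = 0"
  shows "\<And>t e. t \<in> {0..len e} \<Longrightarrow> fst x e t = 0" and "E x x = 0"
proof -
  have sq: "(LINT t|Ivl (len e). fst x e t * fst x e t) = 0" for e
    using 0 unfolding mass_def by (subst (asm) sum_nonneg_eq_0_iff) auto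
  have f0: "fst x e t = 0" if t: "t \<in> {0..len e}" for e t
  proof (rule continuous_AE_zero[OF weak_deriv_continuous[OF H_weak_deriv[OF x]] len_pos _ t])
    have "AE t in Ivl (len e). fst x e t * fst x e t = 0"
      using sq[of e] E_integrable(3)[OF x x, of e] by (subst (asm) integral_nonneg_eq_0_iff_AE) auto
    then show "AE t in Ivl (len e). fst x e t = 0" by eventually_elim simp
  qed
  then show "\<And>t e. t \<in> {0..len e} \<Longrightarrow> fst x e t = 0" .
  have "(LINT t|Ivl (len e). a e t * (snd x e t * snd x e t) + (\<kappa> e t)\<^sup>2 * (fst x e t * fst x e t)) = 0" for e
  proof (rule integral_eq_zero_AE)
    have "AE t in Ivl (len e). snd x e t = 0" using weak_deriv_zero[OF H_weak_deriv[OF x] f0] .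
    then show "AE t in Ivl (len e). a e t * (snd x e t * snd x e t) + (\<kappa> e t)\<^sup>2 * (fst x e t * fst x e t) = 0"
      using AE_space by eventually_elim (simp add: f0)
  qed
  then show "E x x = 0" unfolding energy_def by simp
qed

text \<open>Arzela-Ascoli with the estimate \<open>weak_deriv_holder\<close>. All edges are rescaled
  to [0, 1] and bundled into one function with values in \<open>real^'e\<close>, so that a single
  subsequence serves every edge.\<close>

lemma V_compact:
  assumes f: "\<And>n. f n \<in> V" and c: "\<And>n. E (f n) (f n) \<le> c"
  shows "\<exists>r::nat\<Rightarrow>nat. strict_mono r \<and> (\<forall>e>0. \<exists>N. \<forall>m\<ge>N. \<forall>n\<ge>N. B (f (r m) - f (r n)) (f (r m) - f (r n)) < e)"
proof -
  have fH: "f n \<in> H" for n using f by (rule V_H)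
  have c0: "0 \<le> c" using E_nonneg[OF fH] c order_trans by blast
  define F where "F = (\<lambda>n s. (\<chi> e. fst (f n) e (s * len e)) :: real^'e)"
  have st: "s * len e \<in> {0..len e}" if "s \<in> {0..1}" for s e
    using that len_pos[of e] mult_right_mono[of s 1 "len e"] by auto
  define K where "K = (\<Sum>e\<in>UNIV. sqrt (len e * (c / a0)))"
  have K0: "0 \<le> K" unfolding K_def using c0 a0_pos by (intro sum_nonneg) simp
  have norm_le: "norm (F n s) \<le> (\<Sum>e\<in>(UNIV::'e set). sqrt (Cev * c))" if s: "s \<in> {0..1}" for n s
  proof -
    have "norm (F n s) \<le> (\<Sum>e\<in>UNIV. \<bar>F n s $ e\<bar>)" by (rule norm_le_l1_cart)
    also have "\<dots> \<le> (\<Sum>e\<in>(UNIV::'e set). sqrt (Cev * c))"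
    proof (rule sum_mono)
      fix e
      have "(F n s $ e)\<^sup>2 \<le> Cev * E (f n) (f n)" unfolding F_def using evaluation[OF fH st[OF s]] by simp
      also have "\<dots> \<le> Cev * c" using c Cev_nonneg by (rule mult_left_mono)
      finally show "\<bar>F n s $ e\<bar> \<le> sqrt (Cev * c)" by (rule real_le_rsqrt[of "\<bar>F n s $ e\<bar>", unfolded power2_abs])
    qed
    finally show ?thesis .
  qed
  have holder: "norm (F n s - F n s') \<le> sqrt \<bar>s - s'\<bar> * K" if s: "s \<in> {0..1}" "s' \<in> {0..1}" for n s s'
  proof -
    have "norm (F n s - F n s') \<le> (\<Sum>e\<in>UNIV. \<bar>(F n s - F n s') $ e\<bar>)" by (rule norm_le_l1_cart)
    also have "\<dots> \<le> (\<Sum>e\<in>UNIV. sqrt \<bar>s - s'\<bar> * sqrt (len e * (c / a0)))"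
    proof (rule sum_mono)
      fix e
      have "((F n s - F n s') $ e)\<^sup>2 \<le> \<bar>s * len e - s' * len e\<bar> * (LINT r|Ivl (len e). (snd (f n) e r)\<^sup>2)"
        unfolding F_def using weak_deriv_holder[OF H_weak_deriv[OF fH] st[OF s(2)] st[OF s(1)]] by simp
      also have "\<dots> \<le> \<bar>s * len e - s' * len e\<bar> * (c / a0)"
        using order_trans[OF deriv_le_energy[OF fH[of n], of e] divide_right_mono[OF c[of n], of a0]] a0_pos
        by (intro mult_left_mono) simp_all
      also have "\<bar>s * len e - s' * len e\<bar> = \<bar>s - s'\<bar> * len e"
        using len_pos[of e] by (simp add: left_diff_distrib[symmetric] abs_mult)
      finally have "((F n s - F n s') $ e)\<^sup>2 \<le> \<bar>s - s'\<bar> * (len e * (c / a0))" by (simp only: mult.assoc)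
      from real_le_rsqrt[of "\<bar>(F n s - F n s') $ e\<bar>", unfolded power2_abs, OF this]
      show "\<bar>(F n s - F n s') $ e\<bar> \<le> sqrt \<bar>s - s'\<bar> * sqrt (len e * (c / a0))" by (simp only: real_sqrt_mult)
    qed
    also have "\<dots> = sqrt \<bar>s - s'\<bar> * K" by (simp only: K_def sum_distrib_left)
    finally show ?thesis .
  qed
  obtain g r where r: "strict_mono (r :: nat \<Rightarrow> nat)"
    and unif: "\<And>\<epsilon>. 0 < \<epsilon> \<Longrightarrow> \<exists>N. \<forall>n s. n \<ge> N \<and> s \<in> {0..1} \<longrightarrow> norm (F (r n) s - g s) < \<epsilon>"
  proof (rule Arzela_Ascoli[of "{0..1::real}" F "\<Sum>e\<in>(UNIV::'e set). sqrt (Cev * c)"])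
    show "norm (F n s) \<le> (\<Sum>e\<in>(UNIV::'e set). sqrt (Cev * c))" if "s \<in> {0..1}" for n s by (rule norm_le[OF that])
    fix s \<epsilon> :: real assume s: "s \<in> {0..1}" and \<epsilon>: "0 < \<epsilon>"
    define d where "d = (\<epsilon> / (K + 1))\<^sup>2"
    have d0: "0 < d" unfolding d_def using \<epsilon> K0 by simp
    have "norm (F n s - F n y) < \<epsilon>" if y: "y \<in> {0..1}" "norm (s - y) < d" for n y
    proof -
      have "sqrt \<bar>s - y\<bar> \<le> \<epsilon> / (K + 1)"
        using y(2) \<epsilon> K0 by (intro real_le_lsqrt) (auto simp: d_def)
      then have "sqrt \<bar>s - y\<bar> * K \<le> \<epsilon> / (K + 1) * K" using K0 by (rule mult_right_mono)
      also have "\<dots> < \<epsilon>" using \<epsilon> K0 by (simp add: field_simps)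
      finally show ?thesis using holder[OF s y(1), of n] by linarith
    qed
    then show "\<exists>d>0. \<forall>n y. y \<in> {0..1} \<and> norm (s - y) < d \<longrightarrow> norm (F n s - F n y) < \<epsilon>"
      using d0 by meson
  qed (auto intro: that)
  have "\<exists>N. \<forall>m\<ge>N. \<forall>n\<ge>N. B (f (r m) - f (r n)) (f (r m) - f (r n)) < \<epsilon>" if \<epsilon>: "\<epsilon> > 0" for \<epsilon>
  proof -
    \<comment> \<open>\<open>T\<close> is the total length. A uniform bound \<epsilon> / (T + 1) on
      the squared difference integrates to at most T \<epsilon> / (T + 1) < \<epsilon>.
      \<open>\<delta>\<close> is half the root of that bound, one half for each of the two distances
      to \<open>g\<close>.\<close>
    define T where "T = (\<Sum>e\<in>UNIV. len e)"
    have T0: "0 \<le> T" unfolding T_def by (intro sum_nonneg) simp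
    define \<delta> where "\<delta> = sqrt (\<epsilon> / (T + 1)) / 2"
    have \<delta>0: "\<delta> > 0" using \<epsilon> T0 by (simp add: \<delta>_def)
    obtain N where N: "\<And>n s. n \<ge> N \<Longrightarrow> s \<in> {0..1} \<Longrightarrow> norm (F (r n) s - g s) < \<delta>" using unif[OF \<delta>0] by meson
    have "B (f (r m) - f (r n)) (f (r m) - f (r n)) < \<epsilon>" if mn: "m \<ge> N" "n \<ge> N" for m n
    proof -
      have pt: "(fst (f (r m)) e t - fst (f (r n)) e t)\<^sup>2 \<le> \<epsilon> / (T + 1)" if t: "t \<in> {0..len e}" for e t
      proof -
        define s where "s = t / len e"
        have s: "s \<in> {0..1}" "s * len e = t" using t len_pos[of e] by (auto simp: s_def)
        have "\<bar>(F (r m) s - F (r n) s) $ e\<bar> \<le> norm (F (r m) s - F (r n) s)" by (rule component_le_norm_cart)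
        also have "\<dots> \<le> norm (F (r m) s - g s) + norm (F (r n) s - g s)"
          using norm_triangle_ineq4[of "F (r m) s - g s" "F (r n) s - g s"] by simp
        also have "\<dots> \<le> sqrt (\<epsilon> / (T + 1))" using N[OF mn(1) s(1)] N[OF mn(2) s(1)] by (simp add: \<delta>_def)
        finally have "\<bar>fst (f (r m)) e t - fst (f (r n)) e t\<bar> \<le> sqrt (\<epsilon> / (T + 1))" using s by (simp add: F_def)
        then have "\<bar>fst (f (r m)) e t - fst (f (r n)) e t\<bar>\<^sup>2 \<le> (sqrt (\<epsilon> / (T + 1)))\<^sup>2" by (intro power_mono) auto
        then show ?thesis using \<epsilon> T0 by simp
      qed
      have dH: "f (r m) - f (r n) \<in> H" using subspace_diff[OF H1_space_subspace fH fH] .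
      have "B (f (r m) - f (r n)) (f (r m) - f (r n)) \<le> (\<Sum>e\<in>UNIV. len e * (\<epsilon> / (T + 1)))"
        unfolding mass_def
      proof (rule sum_mono)
        fix e
        have "(LINT t|Ivl (len e). fst (f (r m) - f (r n)) e t * fst (f (r m) - f (r n)) e t) \<le> (LINT t|Ivl (len e). \<epsilon> / (T + 1))"
        proof (rule integral_mono[OF E_integrable(3)[OF dH dH]])
          show "integrable (Ivl (len e)) (\<lambda>t. \<epsilon> / (T + 1))" by (rule in_L2_integrable[OF in_L2_const])
          show "fst (f (r m) - f (r n)) e t * fst (f (r m) - f (r n)) e t \<le> \<epsilon> / (T + 1)" if "t \<in> space (Ivl (len e))" for t
            using pt[of t e] that by (simp add: power2_eq_square)
        qed
        also have "\<dots> = len e * (\<epsilon> / (T + 1))"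
          using measure_Ivl_subinterval[of 0 "len e" "len e"] by simp
        finally show "(LINT t|Ivl (len e). fst (f (r m) - f (r n)) e t * fst (f (r m) - f (r n)) e t) \<le> len e * (\<epsilon> / (T + 1))" .
      qed
      also have "\<dots> = T * (\<epsilon> / (T + 1))" by (simp only: T_def sum_distrib_right)
      also have "\<dots> < \<epsilon>" using \<epsilon> T0 by (simp add: field_simps)
      finally show ?thesis .
    qed
    then show ?thesis by meson
  qed
  with r show ?thesis by blast
qed

text \<open>Tent functions on one edge over the intervals from l / (n + 2) to l / (n + 1): these
  meet in at most one point, and the tents vanish at both ends of the edge, so the vertex conditions
  hold in every graph.\<close>

lemma V_infinite_dim: "\<exists>b::nat\<Rightarrow>_. (\<forall>n. b n \<in> V) \<and> (\<forall>m n. B (b m) (b n) = (if m = n then 1 else 0))"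
proof -
  define e0 where "e0 = (undefined :: 'e)"
  define l where "l = len e0"
  have l: "0 < l" using len_pos by (simp add: l_def)
  define \<alpha> where "\<alpha> = (\<lambda>n. l / (real n + 2))"
  define \<beta> where "\<beta> = (\<lambda>n. l / (real n + 1))"
  have ab: "0 < \<alpha> n" "\<alpha> n < \<beta> n" "\<beta> n \<le> l" for n using l by (auto simp: \<alpha>_def \<beta>_def field_simps)
  have dis: "\<beta> m \<le> \<alpha> n" if "n < m" for m n
  proof -
    have "real n + 2 \<le> real m + 1" using that by simp
    then show ?thesis unfolding \<alpha>_def \<beta>_def using l by (intro divide_left_mono) auto
  qed
  define h where "h = (\<lambda>n. hat (\<alpha> n) (\<beta> n))"
  have "\<exists>g. weak_deriv l (h n) g" for n
    using lipschitz_weak_deriv[OF less_imp_le[OF l] hat_lipschitz] unfolding h_def by metis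
  then obtain k where k: "\<And>n. weak_deriv l (h n) (k n)" by metis
  define x where "x = (\<lambda>n. ((\<lambda>e t. if e = e0 then h n t else 0), (\<lambda>e t. if e = e0 then k n t else 0)))"
  have xH: "x n \<in> H" for n
    unfolding H1_space_def mem_Collect_eq
  proof
    fix e show "weak_deriv (len e) (fst (x n) e) (snd (x n) e)"
      using k[of n] weak_deriv_const by (cases "e = e0") (simp_all add: x_def l_def)
  qed
  have "at_endpt len (fst (x n)) j = 0" for n j
    using ab[of n] by (auto simp: at_endpt_def endpt_pos_def x_def h_def hat_def l_def)
  then have xV: "x n \<in> V" for n using xH by (intro H1_graphI) simp_all
  have zero: "B (x m) (x n) = 0" if "m \<noteq> n" for m n
  proof -
    have "h m t * h n t = 0" for t
      unfolding h_def using dis[of m n] dis[of n m] that by (intro hat_disjoint) (auto simp: neq_iff)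
    then have z: "fst (x m) e t * fst (x n) e t = 0" for e t by (simp add: x_def)
    show ?thesis unfolding mass_def z by simp
  qed
  have pos: "B (x n) (x n) > 0" for n
  proof (rule ccontr)
    assume "\<not> ?thesis"
    then have "B (x n) (x n) = 0" using B_nonneg[OF xH, of n] by simp
    then have "fst (x n) e0 ((\<alpha> n + \<beta> n) / 2) = 0"
      using ab[of n] by (intro mass_definite(1)[OF xH]) (auto simp: l_def)
    moreover have "0 < hat (\<alpha> n) (\<beta> n) ((\<alpha> n + \<beta> n) / 2)"
      using ab(2)[of n] by (simp add: hat_def less_max_iff_disj field_simps)
    ultimately show False by (simp add: x_def h_def)
  qed
  interpret psd_form V B by (rule B_psd_V)
  define b where "b = (\<lambda>n. (1 / sqrt (B (x n) (x n))) *\<^sub>R x n)"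
  have "b n \<in> V" for n unfolding b_def by (intro V_scale xV)
  moreover have "B (b m) (b n) = (if m = n then 1 else 0)" for m n
    unfolding b_def using pos[of n] zero[of m n] xV by (simp add: scale_left scale_right)
  ultimately show ?thesis by blast
qed

lemma spectral: "spectral_pair V E B (1 / \<kappa>0\<^sup>2)"
proof (intro spectral_pair.intro E_complete_V B_psd_V spectral_pair_axioms.intro)
  show "0 < 1 / \<kappa>0\<^sup>2" using \<kappa>0_pos by simp
  show "B x x \<le> 1 / \<kappa>0\<^sup>2 * E x x" if "x \<in> V" for x using mass_le_energy[OF V_H[OF that]] .
  show "E x x = 0" if "x \<in> V" "B x x = 0" for x using mass_definite(2)[OF V_H[OF that(1)] that(2)] .
  show "\<exists>r::nat\<Rightarrow>nat. strict_mono r \<and> (\<forall>e>0. \<exists>N. \<forall>m\<ge>N. \<forall>n\<ge>N. B (f (r m) - f (r n)) (f (r m) - f (r n)) < e)"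
    if "\<And>n. f n \<in> V" "\<And>n. E (f n) (f n) \<le> c" for f :: "nat \<Rightarrow> _" and c
    by (rule V_compact[OF that])
  show "\<exists>b::nat\<Rightarrow>_. (\<forall>n. b n \<in> V) \<and> (\<forall>m n. B (b m) (b n) = (if m = n then 1 else 0))"
    by (rule V_infinite_dim)
qed

end

section \<open>Laws of random vectors and Gaussian series\<close>

lemma iexp_cos_sin: "iexp x = complex_of_real (cos x) + \<i> * complex_of_real (sin x)"
  by (simp add: exp_Euler cos_of_real sin_of_real)

lemma (in prob_space) char_cos_sin:
  assumes [measurable]: "X \<in> borel_measurable M"
  shows "char (distr M borel X) t = complex_of_real (LINT \<omega>|M. cos (t * X \<omega>)) + \<i> * complex_of_real (LINT \<omega>|M. sin (t * X \<omega>))"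
proof -
  have int: "integrable M (\<lambda>\<omega>. cos (t * X \<omega>))" "integrable M (\<lambda>\<omega>. sin (t * X \<omega>))"
    by (auto intro!: integrable_const_bound[of _ 1])
  have "char (distr M borel X) t = (CLINT \<omega>|M. complex_of_real (cos (t * X \<omega>)) + \<i> * complex_of_real (sin (t * X \<omega>)))"
    by (simp add: char_def integral_distr iexp_cos_sin[symmetric])
  also have "\<dots> = complex_of_real (LINT \<omega>|M. cos (t * X \<omega>)) + \<i> * complex_of_real (LINT \<omega>|M. sin (t * X \<omega>))"
    using int by (subst Bochner_Integration.integral_add) auto
  finally show ?thesis .
qed

text \<open>Dividing the weights by their common mass \<open>m\<close> turns them into probability
  densities, to which the one-dimensional uniqueness theorem applies. The masses agree by the cosine
  hypothesis at \<open>s = 0\<close>; for \<open>m = 0\<close> both sides vanish.\<close>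

lemma weighted_levy:
  fixes x :: "'a \<Rightarrow> real" and y :: "'b \<Rightarrow> real" and u v
  assumes "prob_space M" "prob_space N"
    and [measurable]: "x \<in> borel_measurable M" "y \<in> borel_measurable N" "u \<in> borel_measurable M" "v \<in> borel_measurable N"
    and u: "\<And>\<omega>. 0 \<le> u \<omega> \<and> u \<omega> \<le> C" and v: "\<And>\<omega>. 0 \<le> v \<omega> \<and> v \<omega> \<le> C"
    and cos: "\<And>s. (LINT \<omega>|M. u \<omega> * cos (s * x \<omega>)) = (LINT \<omega>|N. v \<omega> * cos (s * y \<omega>))"
    and sin: "\<And>s. (LINT \<omega>|M. u \<omega> * sin (s * x \<omega>)) = (LINT \<omega>|N. v \<omega> * sin (s * y \<omega>))"
    and A [measurable]: "A \<in> sets borel"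
  shows "(LINT \<omega>|M. u \<omega> * indicator A (x \<omega>)) = (LINT \<omega>|N. v \<omega> * indicator A (y \<omega>))"
proof -
  interpret M: prob_space M by fact
  interpret N: prob_space N by fact
  define m where "m = (LINT \<omega>|M. u \<omega>)"
  have mN: "m = (LINT \<omega>|N. v \<omega>)" using cos[of 0] by (simp add: m_def)
  have uint: "integrable M u" and vint: "integrable N v"
    using u v by (auto intro!: M.integrable_const_bound[of _ C] N.integrable_const_bound[of _ C])
  show ?thesis
  proof (cases "m = 0")
    case True
    have "AE \<omega> in M. u \<omega> = 0"
      using True uint u unfolding m_def by (subst (asm) integral_nonneg_eq_0_iff_AE) auto
    then have "AE \<omega> in M. u \<omega> * indicator A (x \<omega>) = 0" by eventually_elim simp
    moreover have "AE \<omega> in N. v \<omega> = 0"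
      using True vint v unfolding mN by (subst (asm) integral_nonneg_eq_0_iff_AE) auto
    then have "AE \<omega> in N. v \<omega> * indicator A (y \<omega>) = 0" by eventually_elim simp
    ultimately show ?thesis by (simp add: integral_eq_zero_AE)
  next
    case False
    have "0 \<le> m" unfolding m_def using u by (intro Bochner_Integration.integral_nonneg) auto
    with False have m: "0 < m" by simp
    have prob: "prob_space (density Q (\<lambda>\<omega>. ennreal (w \<omega> / m)))"
      if "integrable Q w" "\<And>\<omega>. 0 \<le> w \<omega>" "m = (LINT \<omega>|Q. w \<omega>)" for Q :: "'z measure" and w
    proof (rule prob_spaceI)
      have [measurable]: "w \<in> borel_measurable Q" using that(1) by measurable
      have "emeasure (density Q (\<lambda>\<omega>. ennreal (w \<omega> / m))) (space Q) = (\<integral>\<^sup>+\<omega>. ennreal (w \<omega> / m) \<partial>Q)"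
        by (subst emeasure_density) (auto intro!: nn_integral_cong)
      also have "\<dots> = ennreal (LINT \<omega>|Q. w \<omega> / m)"
        using that m by (intro nn_integral_eq_integral) (auto intro!: AE_I2 divide_nonneg_pos)
      also have "(LINT \<omega>|Q. w \<omega> / m) = 1" using that(3) m by simp
      finally show "emeasure (density Q (\<lambda>\<omega>. ennreal (w \<omega> / m))) (space (density Q (\<lambda>\<omega>. ennreal (w \<omega> / m)))) = 1" by simp
    qed
    define M' where "M' = density M (\<lambda>\<omega>. ennreal (u \<omega> / m))"
    define N' where "N' = density N (\<lambda>\<omega>. ennreal (v \<omega> / m))"
    interpret M': prob_space M' unfolding M'_def using prob[of M u] uint u by (simp add: m_def)
    interpret N': prob_space N' unfolding N'_def using prob[of N v] vint v mN by simp
    have meas [measurable]: "x \<in> borel_measurable M'" "y \<in> borel_measurable N'" by (simp_all add: M'_def N'_def)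
    have intM: "(LINT \<omega>|M'. f (x \<omega>)) = (LINT \<omega>|M. u \<omega> * f (x \<omega>)) / m" if [measurable]: "f \<in> borel_measurable borel" for f :: "real \<Rightarrow> real"
    proof -
      have "(LINT \<omega>|M'. f (x \<omega>)) = (LINT \<omega>|M. (u \<omega> / m) * f (x \<omega>))"
        unfolding M'_def using u m by (subst integral_density) (auto intro!: AE_I2 divide_nonneg_pos)
      then show ?thesis by simp
    qed
    have intN: "(LINT \<omega>|N'. f (y \<omega>)) = (LINT \<omega>|N. v \<omega> * f (y \<omega>)) / m" if [measurable]: "f \<in> borel_measurable borel" for f :: "real \<Rightarrow> real"
    proof -
      have "(LINT \<omega>|N'. f (y \<omega>)) = (LINT \<omega>|N. (v \<omega> / m) * f (y \<omega>))"
        unfolding N'_def using v m by (subst integral_density) (auto intro!: AE_I2 divide_nonneg_pos)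
      then show ?thesis by simp
    qed
    have "distr M' borel x = distr N' borel y"
    proof (rule Levy_uniqueness)
      show "real_distribution (distr M' borel x)" "real_distribution (distr N' borel y)"
        by (auto intro: M'.real_distribution_distr N'.real_distribution_distr)
      show "char (distr M' borel x) = char (distr N' borel y)"
      proof
        fix t show "char (distr M' borel x) t = char (distr N' borel y) t"
          unfolding M'.char_cos_sin[OF meas(1)] N'.char_cos_sin[OF meas(2)]
          using intM[of "\<lambda>r. cos (t * r)"] intN[of "\<lambda>r. cos (t * r)"] intM[of "\<lambda>r. sin (t * r)"] intN[of "\<lambda>r. sin (t * r)"]
          by (simp add: cos sin)
      qed
    qed
    then have "(LINT r|distr M' borel x. indicator A r) = (LINT r|distr N' borel y. (indicator A r :: real))" by simp
    then have "(LINT \<omega>|M'. indicator A (x \<omega>)) = (LINT \<omega>|N'. (indicator A (y \<omega>) :: real))"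
      by (subst (asm) (1 2) integral_distr) simp_all
    then show ?thesis using intM[of "indicator A"] intN[of "indicator A"] m by simp
  qed
qed

text \<open>Replaces the trigonometric test functions by indicators one coordinate at a time; the nonnegative
  weights \<open>1 + cos\<close> and \<open>1 + sin\<close> of the remaining coordinates reduce each step to the one-dimensional
  uniqueness theorem.\<close>

lemma trig_law_indicator:
  fixes X :: "'i \<Rightarrow> 'a \<Rightarrow> real" and Y :: "'i \<Rightarrow> 'b \<Rightarrow> real"
  assumes prob: "prob_space M" "prob_space N" and I: "finite I"
    and X [measurable]: "\<And>i. X i \<in> borel_measurable M" and Y [measurable]: "\<And>i. Y i \<in> borel_measurable N"
    and cos: "\<And>c. (LINT \<omega>|M. cos (\<Sum>i\<in>I. c i * X i \<omega>)) = (LINT \<omega>|N. cos (\<Sum>i\<in>I. c i * Y i \<omega>))"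
    and sin: "\<And>c. (LINT \<omega>|M. sin (\<Sum>i\<in>I. c i * X i \<omega>)) = (LINT \<omega>|N. sin (\<Sum>i\<in>I. c i * Y i \<omega>))"
    and J: "J \<subseteq> I" and A: "\<And>i. A i \<in> sets borel"
  shows "(LINT \<omega>|M. (\<Prod>i\<in>J. indicator (A i) (X i \<omega>)) * cos (\<Sum>i\<in>I - J. c i * X i \<omega>))
       = (LINT \<omega>|N. (\<Prod>i\<in>J. indicator (A i) (Y i \<omega>)) * cos (\<Sum>i\<in>I - J. c i * Y i \<omega>))
     \<and> (LINT \<omega>|M. (\<Prod>i\<in>J. indicator (A i) (X i \<omega>)) * sin (\<Sum>i\<in>I - J. c i * X i \<omega>))
       = (LINT \<omega>|N. (\<Prod>i\<in>J. indicator (A i) (Y i \<omega>)) * sin (\<Sum>i\<in>I - J. c i * Y i \<omega>))"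
  using finite_subset[OF J I] J
proof (induction J arbitrary: c rule: finite_induct)
  case empty
  then show ?case using cos[of c] sin[of c] by simp
next
  case (insert k J)
  interpret M: prob_space M by (rule prob)
  interpret N: prob_space N by (rule prob)
  have [measurable]: "A i \<in> sets borel" for i by (rule A)
  have fin: "finite J" "finite I" using insert.hyps I by auto
  define R where "R = I - insert k J"
  have R: "finite R" "k \<notin> R" "I - J = insert k R" using insert.prems insert.hyps I by (auto simp: R_def)
  define u where "u = (\<lambda>\<omega>. \<Prod>i\<in>J. indicator (A i) (X i \<omega>) :: real)"
  define v where "v = (\<lambda>\<omega>. \<Prod>i\<in>J. indicator (A i) (Y i \<omega>) :: real)"
  define \<theta> where "\<theta> = (\<lambda>\<omega>. \<Sum>i\<in>R. c i * X i \<omega>)"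
  define \<eta> where "\<eta> = (\<lambda>\<omega>. \<Sum>i\<in>R. c i * Y i \<omega>)"
  have [measurable]: "u \<in> borel_measurable M" "\<theta> \<in> borel_measurable M" "v \<in> borel_measurable N" "\<eta> \<in> borel_measurable N"
    unfolding u_def v_def \<theta>_def \<eta>_def by measurable
  have u01: "0 \<le> u \<omega> \<and> u \<omega> \<le> 1" and v01: "0 \<le> v \<omega>' \<and> v \<omega>' \<le> 1" for \<omega> \<omega>'
    unfolding u_def v_def by (auto intro!: prod_nonneg prod_le_1 simp: indicator_def)
  have IH: "(LINT \<omega>|M. u \<omega> * cos (s * X k \<omega> + r * \<theta> \<omega>)) = (LINT \<omega>|N. v \<omega> * cos (s * Y k \<omega> + r * \<eta> \<omega>))"
    "(LINT \<omega>|M. u \<omega> * sin (s * X k \<omega> + r * \<theta> \<omega>)) = (LINT \<omega>|N. v \<omega> * sin (s * Y k \<omega> + r * \<eta> \<omega>))" for s r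
  proof -
    \<comment> \<open>The remaining angle is scaled by \<open>r\<close>: 0 removes it, while 1 and
      -1 give the two terms of the product-to-sum formulas.\<close>
    define d where "d = (\<lambda>i. if i = k then s else r * c i)"
    have eqX: "(\<Sum>i\<in>I - J. d i * X i \<omega>) = s * X k \<omega> + r * \<theta> \<omega>" for \<omega>
    proof -
      have "(\<Sum>i\<in>R. d i * X i \<omega>) = (\<Sum>i\<in>R. r * (c i * X i \<omega>))"
        using R(2) by (intro sum.cong) (auto simp: d_def)
      then show ?thesis unfolding R(3) using R(1,2) by (simp add: d_def \<theta>_def sum_distrib_left)
    qed
    have eqY: "(\<Sum>i\<in>I - J. d i * Y i \<omega>) = s * Y k \<omega> + r * \<eta> \<omega>" for \<omega>
    proof -
      have "(\<Sum>i\<in>R. d i * Y i \<omega>) = (\<Sum>i\<in>R. r * (c i * Y i \<omega>))"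
        using R(2) by (intro sum.cong) (auto simp: d_def)
      then show ?thesis unfolding R(3) using R(1,2) by (simp add: d_def \<eta>_def sum_distrib_left)
    qed
    have "J \<subseteq> I" using insert.prems by simp
    from insert.IH[OF this, of d]
    show "(LINT \<omega>|M. u \<omega> * cos (s * X k \<omega> + r * \<theta> \<omega>)) = (LINT \<omega>|N. v \<omega> * cos (s * Y k \<omega> + r * \<eta> \<omega>))"
      "(LINT \<omega>|M. u \<omega> * sin (s * X k \<omega> + r * \<theta> \<omega>)) = (LINT \<omega>|N. v \<omega> * sin (s * Y k \<omega> + r * \<eta> \<omega>))"
      unfolding eqX eqY u_def v_def by (rule conjunct1, rule conjunct2)
  qed
  have IH0: "(LINT \<omega>|M. u \<omega> * cos (s * X k \<omega>)) = (LINT \<omega>|N. v \<omega> * cos (s * Y k \<omega>))"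
    "(LINT \<omega>|M. u \<omega> * sin (s * X k \<omega>)) = (LINT \<omega>|N. v \<omega> * sin (s * Y k \<omega>))"
    and IH1: "(LINT \<omega>|M. u \<omega> * cos (s * X k \<omega> + \<theta> \<omega>)) = (LINT \<omega>|N. v \<omega> * cos (s * Y k \<omega> + \<eta> \<omega>))"
    "(LINT \<omega>|M. u \<omega> * sin (s * X k \<omega> + \<theta> \<omega>)) = (LINT \<omega>|N. v \<omega> * sin (s * Y k \<omega> + \<eta> \<omega>))"
    and IH2: "(LINT \<omega>|M. u \<omega> * cos (s * X k \<omega> - \<theta> \<omega>)) = (LINT \<omega>|N. v \<omega> * cos (s * Y k \<omega> - \<eta> \<omega>))"
    "(LINT \<omega>|M. u \<omega> * sin (s * X k \<omega> - \<theta> \<omega>)) = (LINT \<omega>|N. v \<omega> * sin (s * Y k \<omega> - \<eta> \<omega>))" for s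
    using IH[of s 0] IH[of s 1] IH[of s "-1"] by simp_all
  have intM: "integrable M (\<lambda>\<omega>. u \<omega> * g \<omega>)" if [measurable]: "g \<in> borel_measurable M" and "\<And>\<omega>. \<bar>g \<omega>\<bar> \<le> 1" for g
    using u01 that(2) by (intro M.integrable_const_bound[of _ 1] AE_I2) (auto simp: abs_mult intro!: mult_le_one)
  have intN: "integrable N (\<lambda>\<omega>. v \<omega> * g \<omega>)" if [measurable]: "g \<in> borel_measurable N" and "\<And>\<omega>. \<bar>g \<omega>\<bar> \<le> 1" for g
    using v01 that(2) by (intro N.integrable_const_bound[of _ 1] AE_I2) (auto simp: abs_mult intro!: mult_le_one)
  have halfM: "(LINT \<omega>|M. u \<omega> * ((f \<omega> + g \<omega>) / 2)) = ((LINT \<omega>|M. u \<omega> * f \<omega>) + (LINT \<omega>|M. u \<omega> * g \<omega>)) / 2"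
    "(LINT \<omega>|M. u \<omega> * ((f \<omega> - g \<omega>) / 2)) = ((LINT \<omega>|M. u \<omega> * f \<omega>) - (LINT \<omega>|M. u \<omega> * g \<omega>)) / 2"
    if "f \<in> borel_measurable M" "g \<in> borel_measurable M" "\<And>\<omega>. \<bar>f \<omega>\<bar> \<le> 1" "\<And>\<omega>. \<bar>g \<omega>\<bar> \<le> 1" for f g
    using intM[OF that(1,3)] intM[OF that(2,4)] by (simp_all add: distrib_left right_diff_distrib)
  have prodM:
    "(LINT \<omega>|M. u \<omega> * (cos (\<theta> \<omega>) * cos (s * X k \<omega>))) = ((LINT \<omega>|M. u \<omega> * cos (s * X k \<omega> + \<theta> \<omega>)) + (LINT \<omega>|M. u \<omega> * cos (s * X k \<omega> - \<theta> \<omega>))) / 2"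
    "(LINT \<omega>|M. u \<omega> * (cos (\<theta> \<omega>) * sin (s * X k \<omega>))) = ((LINT \<omega>|M. u \<omega> * sin (s * X k \<omega> + \<theta> \<omega>)) + (LINT \<omega>|M. u \<omega> * sin (s * X k \<omega> - \<theta> \<omega>))) / 2"
    "(LINT \<omega>|M. u \<omega> * (sin (\<theta> \<omega>) * cos (s * X k \<omega>))) = ((LINT \<omega>|M. u \<omega> * sin (s * X k \<omega> + \<theta> \<omega>)) - (LINT \<omega>|M. u \<omega> * sin (s * X k \<omega> - \<theta> \<omega>))) / 2"
    "(LINT \<omega>|M. u \<omega> * (sin (\<theta> \<omega>) * sin (s * X k \<omega>))) = ((LINT \<omega>|M. u \<omega> * cos (s * X k \<omega> - \<theta> \<omega>)) - (LINT \<omega>|M. u \<omega> * cos (s * X k \<omega> + \<theta> \<omega>))) / 2"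
    for s
  proof -
    have "cos (\<theta> \<omega>) * cos (s * X k \<omega>) = (cos (s * X k \<omega> + \<theta> \<omega>) + cos (s * X k \<omega> - \<theta> \<omega>)) / 2" for \<omega>
      by (simp add: cos_add cos_diff sin_add sin_diff)
    then show "(LINT \<omega>|M. u \<omega> * (cos (\<theta> \<omega>) * cos (s * X k \<omega>))) = ((LINT \<omega>|M. u \<omega> * cos (s * X k \<omega> + \<theta> \<omega>)) + (LINT \<omega>|M. u \<omega> * cos (s * X k \<omega> - \<theta> \<omega>))) / 2"
      by (simp only:) (rule halfM; simp)
    have "cos (\<theta> \<omega>) * sin (s * X k \<omega>) = (sin (s * X k \<omega> + \<theta> \<omega>) + sin (s * X k \<omega> - \<theta> \<omega>)) / 2" for \<omega>
      by (simp add: cos_add cos_diff sin_add sin_diff)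
    then show "(LINT \<omega>|M. u \<omega> * (cos (\<theta> \<omega>) * sin (s * X k \<omega>))) = ((LINT \<omega>|M. u \<omega> * sin (s * X k \<omega> + \<theta> \<omega>)) + (LINT \<omega>|M. u \<omega> * sin (s * X k \<omega> - \<theta> \<omega>))) / 2"
      by (simp only:) (rule halfM; simp)
    have "sin (\<theta> \<omega>) * cos (s * X k \<omega>) = (sin (s * X k \<omega> + \<theta> \<omega>) - sin (s * X k \<omega> - \<theta> \<omega>)) / 2" for \<omega>
      by (simp add: cos_add cos_diff sin_add sin_diff)
    then show "(LINT \<omega>|M. u \<omega> * (sin (\<theta> \<omega>) * cos (s * X k \<omega>))) = ((LINT \<omega>|M. u \<omega> * sin (s * X k \<omega> + \<theta> \<omega>)) - (LINT \<omega>|M. u \<omega> * sin (s * X k \<omega> - \<theta> \<omega>))) / 2"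
      by (simp only:) (rule halfM; simp)
    have "sin (\<theta> \<omega>) * sin (s * X k \<omega>) = (cos (s * X k \<omega> - \<theta> \<omega>) - cos (s * X k \<omega> + \<theta> \<omega>)) / 2" for \<omega>
      by (simp add: cos_add cos_diff sin_add sin_diff)
    then show "(LINT \<omega>|M. u \<omega> * (sin (\<theta> \<omega>) * sin (s * X k \<omega>))) = ((LINT \<omega>|M. u \<omega> * cos (s * X k \<omega> - \<theta> \<omega>)) - (LINT \<omega>|M. u \<omega> * cos (s * X k \<omega> + \<theta> \<omega>))) / 2"
      by (simp only:) (rule halfM; simp)
  qed
  have halfN: "(LINT \<omega>|N. v \<omega> * ((f \<omega> + g \<omega>) / 2)) = ((LINT \<omega>|N. v \<omega> * f \<omega>) + (LINT \<omega>|N. v \<omega> * g \<omega>)) / 2"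
    "(LINT \<omega>|N. v \<omega> * ((f \<omega> - g \<omega>) / 2)) = ((LINT \<omega>|N. v \<omega> * f \<omega>) - (LINT \<omega>|N. v \<omega> * g \<omega>)) / 2"
    if "f \<in> borel_measurable N" "g \<in> borel_measurable N" "\<And>\<omega>. \<bar>f \<omega>\<bar> \<le> 1" "\<And>\<omega>. \<bar>g \<omega>\<bar> \<le> 1" for f g
    using intN[OF that(1,3)] intN[OF that(2,4)] by (simp_all add: distrib_left right_diff_distrib)
  have prodN:
    "(LINT \<omega>|N. v \<omega> * (cos (\<eta> \<omega>) * cos (s * Y k \<omega>))) = ((LINT \<omega>|N. v \<omega> * cos (s * Y k \<omega> + \<eta> \<omega>)) + (LINT \<omega>|N. v \<omega> * cos (s * Y k \<omega> - \<eta> \<omega>))) / 2"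
    "(LINT \<omega>|N. v \<omega> * (cos (\<eta> \<omega>) * sin (s * Y k \<omega>))) = ((LINT \<omega>|N. v \<omega> * sin (s * Y k \<omega> + \<eta> \<omega>)) + (LINT \<omega>|N. v \<omega> * sin (s * Y k \<omega> - \<eta> \<omega>))) / 2"
    "(LINT \<omega>|N. v \<omega> * (sin (\<eta> \<omega>) * cos (s * Y k \<omega>))) = ((LINT \<omega>|N. v \<omega> * sin (s * Y k \<omega> + \<eta> \<omega>)) - (LINT \<omega>|N. v \<omega> * sin (s * Y k \<omega> - \<eta> \<omega>))) / 2"
    "(LINT \<omega>|N. v \<omega> * (sin (\<eta> \<omega>) * sin (s * Y k \<omega>))) = ((LINT \<omega>|N. v \<omega> * cos (s * Y k \<omega> - \<eta> \<omega>)) - (LINT \<omega>|N. v \<omega> * cos (s * Y k \<omega> + \<eta> \<omega>))) / 2"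
    for s
  proof -
    have "cos (\<eta> \<omega>) * cos (s * Y k \<omega>) = (cos (s * Y k \<omega> + \<eta> \<omega>) + cos (s * Y k \<omega> - \<eta> \<omega>)) / 2" for \<omega>
      by (simp add: cos_add cos_diff sin_add sin_diff)
    then show "(LINT \<omega>|N. v \<omega> * (cos (\<eta> \<omega>) * cos (s * Y k \<omega>))) = ((LINT \<omega>|N. v \<omega> * cos (s * Y k \<omega> + \<eta> \<omega>)) + (LINT \<omega>|N. v \<omega> * cos (s * Y k \<omega> - \<eta> \<omega>))) / 2"
      by (simp only:) (rule halfN; simp)
    have "cos (\<eta> \<omega>) * sin (s * Y k \<omega>) = (sin (s * Y k \<omega> + \<eta> \<omega>) + sin (s * Y k \<omega> - \<eta> \<omega>)) / 2" for \<omega>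
      by (simp add: cos_add cos_diff sin_add sin_diff)
    then show "(LINT \<omega>|N. v \<omega> * (cos (\<eta> \<omega>) * sin (s * Y k \<omega>))) = ((LINT \<omega>|N. v \<omega> * sin (s * Y k \<omega> + \<eta> \<omega>)) + (LINT \<omega>|N. v \<omega> * sin (s * Y k \<omega> - \<eta> \<omega>))) / 2"
      by (simp only:) (rule halfN; simp)
    have "sin (\<eta> \<omega>) * cos (s * Y k \<omega>) = (sin (s * Y k \<omega> + \<eta> \<omega>) - sin (s * Y k \<omega> - \<eta> \<omega>)) / 2" for \<omega>
      by (simp add: cos_add cos_diff sin_add sin_diff)
    then show "(LINT \<omega>|N. v \<omega> * (sin (\<eta> \<omega>) * cos (s * Y k \<omega>))) = ((LINT \<omega>|N. v \<omega> * sin (s * Y k \<omega> + \<eta> \<omega>)) - (LINT \<omega>|N. v \<omega> * sin (s * Y k \<omega> - \<eta> \<omega>))) / 2"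
      by (simp only:) (rule halfN; simp)
    have "sin (\<eta> \<omega>) * sin (s * Y k \<omega>) = (cos (s * Y k \<omega> - \<eta> \<omega>) - cos (s * Y k \<omega> + \<eta> \<omega>)) / 2" for \<omega>
      by (simp add: cos_add cos_diff sin_add sin_diff)
    then show "(LINT \<omega>|N. v \<omega> * (sin (\<eta> \<omega>) * sin (s * Y k \<omega>))) = ((LINT \<omega>|N. v \<omega> * cos (s * Y k \<omega> - \<eta> \<omega>)) - (LINT \<omega>|N. v \<omega> * cos (s * Y k \<omega> + \<eta> \<omega>))) / 2"
      by (simp only:) (rule halfN; simp)
  qed
  have splitM: "(LINT \<omega>|M. (u \<omega> * (1 + p \<omega>)) * g \<omega>) = (LINT \<omega>|M. u \<omega> * g \<omega>) + (LINT \<omega>|M. u \<omega> * (p \<omega> * g \<omega>))"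
    if [measurable]: "p \<in> borel_measurable M" "g \<in> borel_measurable M" and pg: "\<And>\<omega>. \<bar>p \<omega>\<bar> \<le> 1" "\<And>\<omega>. \<bar>g \<omega>\<bar> \<le> 1" for p g
  proof -
    have "(LINT \<omega>|M. (u \<omega> * (1 + p \<omega>)) * g \<omega>) = (LINT \<omega>|M. u \<omega> * g \<omega> + u \<omega> * (p \<omega> * g \<omega>))"
      by (intro Bochner_Integration.integral_cong) (simp_all add: algebra_simps)
    also have "\<dots> = (LINT \<omega>|M. u \<omega> * g \<omega>) + (LINT \<omega>|M. u \<omega> * (p \<omega> * g \<omega>))"
      by (intro Bochner_Integration.integral_add intM) (use pg in \<open>auto simp: abs_mult intro!: mult_le_one\<close>)
    finally show ?thesis .
  qed
  have splitN: "(LINT \<omega>|N. (v \<omega> * (1 + p \<omega>)) * g \<omega>) = (LINT \<omega>|N. v \<omega> * g \<omega>) + (LINT \<omega>|N. v \<omega> * (p \<omega> * g \<omega>))"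
    if [measurable]: "p \<in> borel_measurable N" "g \<in> borel_measurable N" and pg: "\<And>\<omega>. \<bar>p \<omega>\<bar> \<le> 1" "\<And>\<omega>. \<bar>g \<omega>\<bar> \<le> 1" for p g
  proof -
    have "(LINT \<omega>|N. (v \<omega> * (1 + p \<omega>)) * g \<omega>) = (LINT \<omega>|N. v \<omega> * g \<omega> + v \<omega> * (p \<omega> * g \<omega>))"
      by (intro Bochner_Integration.integral_cong) (simp_all add: algebra_simps)
    also have "\<dots> = (LINT \<omega>|N. v \<omega> * g \<omega>) + (LINT \<omega>|N. v \<omega> * (p \<omega> * g \<omega>))"
      by (intro Bochner_Integration.integral_add intN) (use pg in \<open>auto simp: abs_mult intro!: mult_le_one\<close>)
    finally show ?thesis .
  qed
  have bound: "0 \<le> w * (1 + p) \<and> w * (1 + p) \<le> 2" if "0 \<le> w \<and> w \<le> 1" "\<bar>p\<bar> \<le> 1" for w p :: real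
  proof -
    have "w * (1 + p) \<le> 1 * 2" using that by (intro mult_mono) auto
    then show ?thesis using that by auto
  qed
  let ?f = "indicator (A k) :: real \<Rightarrow> real"
  \<comment> \<open>The weight \<open>u\<close> alone. Subtracting this from the results for
    \<open>u\<close> times \<open>1 + cos\<close> and \<open>1 + sin\<close> leaves the
    trigonometric factors, which change sign and so cannot serve as weights themselves.\<close>
  have base: "(LINT \<omega>|M. u \<omega> * ?f (X k \<omega>)) = (LINT \<omega>|N. v \<omega> * ?f (Y k \<omega>))"
    by (rule weighted_levy[OF prob, of _ _ _ _ 1]) (use u01 v01 in \<open>simp_all add: IH0\<close>)
  have "(LINT \<omega>|M. (u \<omega> * (1 + cos (\<theta> \<omega>))) * ?f (X k \<omega>)) = (LINT \<omega>|N. (v \<omega> * (1 + cos (\<eta> \<omega>))) * ?f (Y k \<omega>))"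
    by (rule weighted_levy[OF prob, of _ _ _ _ 2])
      (simp_all add: splitM splitN prodM prodN IH0 IH1 IH2 bound[OF u01] bound[OF v01])
  moreover have "(LINT \<omega>|M. (u \<omega> * (1 + sin (\<theta> \<omega>))) * ?f (X k \<omega>)) = (LINT \<omega>|N. (v \<omega> * (1 + sin (\<eta> \<omega>))) * ?f (Y k \<omega>))"
    by (rule weighted_levy[OF prob, of _ _ _ _ 2])
      (simp_all add: splitM splitN prodM prodN IH0 IH1 IH2 bound[OF u01] bound[OF v01])
  ultimately have "(LINT \<omega>|M. u \<omega> * (cos (\<theta> \<omega>) * ?f (X k \<omega>))) = (LINT \<omega>|N. v \<omega> * (cos (\<eta> \<omega>) * ?f (Y k \<omega>)))"
    "(LINT \<omega>|M. u \<omega> * (sin (\<theta> \<omega>) * ?f (X k \<omega>))) = (LINT \<omega>|N. v \<omega> * (sin (\<eta> \<omega>) * ?f (Y k \<omega>)))"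
    using base by (auto simp: splitM splitN indicator_def)
  then show ?case
    using insert.hyps fin unfolding R_def[symmetric] \<theta>_def[symmetric] \<eta>_def[symmetric]
    by (simp add: u_def v_def \<theta>_def \<eta>_def mult.commute mult.left_commute)
qed

text \<open>A law on a finite product is determined by its values on boxes, and these are the case
  \<open>J = I\<close> of \<open>trig_law_indicator\<close>, where every test function has become an
  indicator.\<close>

lemma law_eqI_trig:
  fixes X :: "'i \<Rightarrow> 'a \<Rightarrow> real" and Y :: "'i \<Rightarrow> 'b \<Rightarrow> real"
  assumes prob: "prob_space M" "prob_space N" and I: "finite I"
    and X: "\<And>i. X i \<in> borel_measurable M" and Y: "\<And>i. Y i \<in> borel_measurable N"
    and cos: "\<And>c. (LINT \<omega>|M. cos (\<Sum>i\<in>I. c i * X i \<omega>)) = (LINT \<omega>|N. cos (\<Sum>i\<in>I. c i * Y i \<omega>))"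
    and sin: "\<And>c. (LINT \<omega>|M. sin (\<Sum>i\<in>I. c i * X i \<omega>)) = (LINT \<omega>|N. sin (\<Sum>i\<in>I. c i * Y i \<omega>))"
  shows "distr M (PiM I (\<lambda>_. borel)) (\<lambda>\<omega>. \<lambda>i\<in>I. X i \<omega>) = distr N (PiM I (\<lambda>_. borel)) (\<lambda>\<omega>. \<lambda>i\<in>I. Y i \<omega>)"
    (is "?P = ?Q")
proof (rule measure_eqI_PiM_finite[OF I])
  note X [measurable] note Y [measurable]
  interpret M: prob_space M by (rule prob)
  interpret N: prob_space N by (rule prob)
  have mX [measurable]: "(\<lambda>\<omega>. \<lambda>i\<in>I. X i \<omega>) \<in> M \<rightarrow>\<^sub>M PiM I (\<lambda>_. borel)" by measurable
  have mY [measurable]: "(\<lambda>\<omega>. \<lambda>i\<in>I. Y i \<omega>) \<in> N \<rightarrow>\<^sub>M PiM I (\<lambda>_. borel)" by measurable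
  show "sets ?P = sets (PiM I (\<lambda>_. borel))" "sets ?Q = sets (PiM I (\<lambda>_. borel))" by simp_all
  fix A :: "'i \<Rightarrow> real set" assume A: "\<And>i. i \<in> I \<Longrightarrow> A i \<in> sets borel"
  \<comment> \<open>Totalizes \<open>A\<close>, since \<open>trig_law_indicator\<close> asks for
    measurable sets also at indices outside \<open>I\<close>.\<close>
  define A' where "A' = (\<lambda>i. if i \<in> I then A i else {})"
  have A' [measurable]: "A' i \<in> sets borel" for i using A by (simp add: A'_def)
  have PiE: "PiE I A = PiE I A'" by (auto simp: A'_def intro!: PiE_cong)
  have [measurable]: "PiE I A \<in> sets (PiM I (\<lambda>_. borel))" using A I by (intro sets_PiM_I_finite) auto
  have "emeasure ?P (PiE I A) = ennreal (LINT \<omega>|M. (\<Prod>i\<in>I. indicator (A' i) (X i \<omega>)))"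
  proof -
    have "emeasure ?P (PiE I A) = emeasure M ((\<lambda>\<omega>. \<lambda>i\<in>I. X i \<omega>) -` PiE I A \<inter> space M)" by (simp add: emeasure_distr)
    also have "\<dots> = ennreal (LINT \<omega>|M. indicator ((\<lambda>\<omega>. \<lambda>i\<in>I. X i \<omega>) -` PiE I A \<inter> space M) \<omega>)"
      by (simp add: M.emeasure_eq_measure)
    also have "(LINT \<omega>|M. indicator ((\<lambda>\<omega>. \<lambda>i\<in>I. X i \<omega>) -` PiE I A \<inter> space M) \<omega>) = (LINT \<omega>|M. (\<Prod>i\<in>I. indicator (A' i) (X i \<omega>) :: real))"
    proof (rule Bochner_Integration.integral_cong)
      fix \<omega> assume "\<omega> \<in> space M"
      then show "indicator ((\<lambda>\<omega>. \<lambda>i\<in>I. X i \<omega>) -` PiE I A \<inter> space M) \<omega> = (\<Prod>i\<in>I. indicator (A' i) (X i \<omega>) :: real)"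
        using I by (auto simp: indicator_def PiE prod_zero_iff A'_def PiE_iff split: if_splits)
    qed simp
    finally show ?thesis .
  qed
  moreover have "emeasure ?Q (PiE I A) = ennreal (LINT \<omega>|N. (\<Prod>i\<in>I. indicator (A' i) (Y i \<omega>)))"
  proof -
    have "emeasure ?Q (PiE I A) = emeasure N ((\<lambda>\<omega>. \<lambda>i\<in>I. Y i \<omega>) -` PiE I A \<inter> space N)" by (simp add: emeasure_distr)
    also have "\<dots> = ennreal (LINT \<omega>|N. indicator ((\<lambda>\<omega>. \<lambda>i\<in>I. Y i \<omega>) -` PiE I A \<inter> space N) \<omega>)"
      by (simp add: N.emeasure_eq_measure)
    also have "(LINT \<omega>|N. indicator ((\<lambda>\<omega>. \<lambda>i\<in>I. Y i \<omega>) -` PiE I A \<inter> space N) \<omega>) = (LINT \<omega>|N. (\<Prod>i\<in>I. indicator (A' i) (Y i \<omega>) :: real))"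
    proof (rule Bochner_Integration.integral_cong)
      fix \<omega> assume "\<omega> \<in> space N"
      then show "indicator ((\<lambda>\<omega>. \<lambda>i\<in>I. Y i \<omega>) -` PiE I A \<inter> space N) \<omega> = (\<Prod>i\<in>I. indicator (A' i) (Y i \<omega>) :: real)"
        using I by (auto simp: indicator_def PiE prod_zero_iff A'_def PiE_iff split: if_splits)
    qed simp
    finally show ?thesis .
  qed
  moreover have "(LINT \<omega>|M. (\<Prod>i\<in>I. indicator (A' i) (X i \<omega>) :: real)) = (LINT \<omega>|N. (\<Prod>i\<in>I. indicator (A' i) (Y i \<omega>)))"
    using conjunct1[OF trig_law_indicator[where A=A' and c="\<lambda>_. 0", OF prob I X Y cos sin order_refl A']] by simp
  ultimately show "emeasure ?P (PiE I A) = emeasure ?Q (PiE I A)" by simp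
next
  interpret M: prob_space M by (rule prob)
  note X [measurable]
  have "(\<lambda>\<omega>. \<lambda>i\<in>I. X i \<omega>) \<in> M \<rightarrow>\<^sub>M PiM I (\<lambda>_. borel)" by measurable
  then interpret P: prob_space ?P by (rule M.prob_space_distr)
  show "range (\<lambda>_::nat. PiE I (\<lambda>_. UNIV)) \<subseteq> prod_algebra I (\<lambda>_. borel :: real measure)"
    using prod_algebraI_finite[OF I, of "\<lambda>_. UNIV" "\<lambda>_. borel :: real measure"] by auto
  show "(\<Union>_::nat. PiE I (\<lambda>_. UNIV)) = space (PiM I (\<lambda>_. borel :: real measure))"
    by (simp add: space_PiM)
  show "emeasure ?P (PiE I (\<lambda>_. UNIV)) \<noteq> \<infinity>" for i :: nat using P.emeasure_finite by simp
qed

section \<open>Characteristic functions and almost sure convergence of Gaussian series\<close>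

locale gauss_seq = prob_space +
  fixes \<xi> :: "nat \<Rightarrow> 'a \<Rightarrow> real"
  assumes indep: "indep_vars (\<lambda>_. borel) \<xi> UNIV"
    and std: "distr M borel (\<xi> k) = std_normal_distribution"
begin

lemma rv [measurable]: "\<xi> k \<in> borel_measurable M"
  using indep by (auto simp: indep_vars_def)

lemma \<xi>_moments: "integrable M (\<lambda>\<omega>. \<xi> k \<omega> ^ n)" "expectation (\<xi> k) = 0" "(LINT \<omega>|M. (\<xi> k \<omega>)\<^sup>2) = 1"
proof -
  have tr: "(LINT \<omega>|M. f (\<xi> k \<omega>)) = (LINT x|std_normal_distribution. f x)" if "f \<in> borel_measurable borel" for f :: "real \<Rightarrow> real"
    unfolding std[of k, symmetric] using that by (subst integral_distr) auto
  have "integrable (distr M borel (\<xi> k)) (\<lambda>x. x ^ n)"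
    unfolding std by (rule integrable_std_normal_distribution_moment)
  then show "integrable M (\<lambda>\<omega>. \<xi> k \<omega> ^ n)" by (subst (asm) integrable_distr_eq) auto
  show "expectation (\<xi> k) = 0"
    using tr[of "\<lambda>x. x"] integral_std_normal_distribution_moment_odd[of 1] by simp
  show "(LINT \<omega>|M. (\<xi> k \<omega>)\<^sup>2) = 1"
    using tr[of "\<lambda>x. x\<^sup>2"] std_normal_distribution_even_moments[of 1] by (simp add: fact_numeral)
qed

lemma char_partial_sum:
  "char (distr M borel (\<lambda>\<omega>. \<Sum>k<n. b k * \<xi> k \<omega>)) 1 = complex_of_real (exp (- (\<Sum>k<n. (b k)\<^sup>2) / 2))"
proof -
  have ind: "indep_vars (\<lambda>_. borel) (\<lambda>k \<omega>. b k * \<xi> k \<omega>) {..<n}"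
    by (rule indep_vars_compose2[OF indep_vars_subset[OF indep subset_UNIV], of "{..<n}" "\<lambda>k x. b k * x" "\<lambda>_. borel"]) simp
  have "char (distr M borel (\<lambda>\<omega>. b k * \<xi> k \<omega>)) 1 = complex_of_real (exp (- (b k)\<^sup>2 / 2))" for k
  proof -
    have "char (distr M borel (\<lambda>\<omega>. b k * \<xi> k \<omega>)) 1 = char (distr M borel (\<xi> k)) (b k)"
      by (simp add: char_def integral_distr)
    then show ?thesis by (simp add: std char_std_normal_distribution)
  qed
  then have "char (distr M borel (\<lambda>\<omega>. \<Sum>k<n. b k * \<xi> k \<omega>)) 1 = (\<Prod>k<n. complex_of_real (exp (- (b k)\<^sup>2 / 2)))"
    unfolding char_distr_sum[OF ind] by simp
  also have "\<dots> = complex_of_real (exp (\<Sum>k<n. - (b k)\<^sup>2 / 2))"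
    by (simp only: exp_sum[OF finite_lessThan] of_real_prod)
  finally show ?thesis by (simp only: sum_negf sum_divide_distrib[symmetric])
qed

text \<open>Almost sure convergence passes to characteristic functions by dominated convergence. The
  argument 1 suffices, since any other factor can be absorbed into \<open>b\<close>.\<close>

lemma char_series:
  assumes [measurable]: "Z \<in> borel_measurable M" and lim: "AE \<omega> in M. (\<lambda>n. \<Sum>k<n. b k * \<xi> k \<omega>) \<longlonglongrightarrow> Z \<omega>"
    and sums: "(\<lambda>k. (b k)\<^sup>2) sums q"
  shows "char (distr M borel Z) 1 = complex_of_real (exp (- q / 2))"
proof (rule LIMSEQ_unique)
  let ?S = "\<lambda>n \<omega>. \<Sum>k<n. b k * \<xi> k \<omega>"
  have "(\<lambda>n. CLINT \<omega>|M. iexp (?S n \<omega>)) \<longlonglongrightarrow> (CLINT \<omega>|M. iexp (Z \<omega>))"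
  proof (rule integral_dominated_convergence[where w="\<lambda>_. 1"])
    show "AE \<omega> in M. (\<lambda>n. iexp (?S n \<omega>)) \<longlonglongrightarrow> iexp (Z \<omega>)"
      using lim by eventually_elim (intro tendsto_intros)
  qed auto
  then show "(\<lambda>n. char (distr M borel (?S n)) 1) \<longlonglongrightarrow> char (distr M borel Z) 1"
    by (simp add: char_def integral_distr)
  have "(\<lambda>n. complex_of_real (exp (- (\<Sum>k<n. (b k)\<^sup>2) / 2))) \<longlonglongrightarrow> complex_of_real (exp (- q / 2))"
    using sums unfolding sums_def by (intro tendsto_intros) simp_all
  then show "(\<lambda>n. char (distr M borel (?S n)) 1) \<longlonglongrightarrow> complex_of_real (exp (- q / 2))"
    by (simp only: char_partial_sum)
qed

definition T :: "(nat \<Rightarrow> real) \<Rightarrow> nat \<Rightarrow> nat \<Rightarrow> 'a \<Rightarrow> real" where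
  "T b m k \<omega> = (\<Sum>j=m..<k. b j * \<xi> j \<omega>)"

lemma T_meas [measurable]: "T b m k \<in> borel_measurable M"
  unfolding T_def by measurable

lemma indep_product:
  assumes [measurable]: "f \<in> borel_measurable (PiM A (\<lambda>_. borel))" "g \<in> borel_measurable (PiM B (\<lambda>_. borel))"
    and AB: "A \<inter> B = {}"
    and int: "integrable M (\<lambda>\<omega>. f (\<lambda>i\<in>A. \<xi> i \<omega>))" "integrable M (\<lambda>\<omega>. g (\<lambda>i\<in>B. \<xi> i \<omega>))"
  shows "integrable M (\<lambda>\<omega>. f (\<lambda>i\<in>A. \<xi> i \<omega>) * g (\<lambda>i\<in>B. \<xi> i \<omega>))"
    "(LINT \<omega>|M. f (\<lambda>i\<in>A. \<xi> i \<omega>) * g (\<lambda>i\<in>B. \<xi> i \<omega>)) = (LINT \<omega>|M. f (\<lambda>i\<in>A. \<xi> i \<omega>)) * (LINT \<omega>|M. g (\<lambda>i\<in>B. \<xi> i \<omega>) :: real)"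
proof -
  have ind: "indep_var borel (\<lambda>\<omega>. f (\<lambda>i\<in>A. \<xi> i \<omega>)) borel (\<lambda>\<omega>. g (\<lambda>i\<in>B. \<xi> i \<omega>))"
    using indep_var_compose[OF indep_var_restrict[OF indep AB subset_UNIV subset_UNIV], of f borel g borel] assms(1,2)
    by (simp add: comp_def)
  show "integrable M (\<lambda>\<omega>. f (\<lambda>i\<in>A. \<xi> i \<omega>) * g (\<lambda>i\<in>B. \<xi> i \<omega>))"
    by (rule indep_var_integrable[OF ind int])
  show "(LINT \<omega>|M. f (\<lambda>i\<in>A. \<xi> i \<omega>) * g (\<lambda>i\<in>B. \<xi> i \<omega>)) = (LINT \<omega>|M. f (\<lambda>i\<in>A. \<xi> i \<omega>)) * (LINT \<omega>|M. g (\<lambda>i\<in>B. \<xi> i \<omega>))"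
    by (rule indep_var_lebesgue_integral[OF ind int])
qed

lemma T_integrable: "integrable M (T b m k)"
  unfolding T_def using \<xi>_moments(1)[of _ 1] by (intro Bochner_Integration.integrable_sum integrable_mult_right) simp

lemma T_mean: "(LINT \<omega>|M. T b m k \<omega>) = 0"
  unfolding T_def using \<xi>_moments(1)[of _ 1] by (subst Bochner_Integration.integral_sum) (simp_all add: \<xi>_moments(2))

lemma \<xi>_cross: "i \<noteq> j \<Longrightarrow> integrable M (\<lambda>\<omega>. \<xi> i \<omega> * \<xi> j \<omega>) \<and> (LINT \<omega>|M. \<xi> i \<omega> * \<xi> j \<omega>) = 0"
  using indep_product[of "\<lambda>x. x i" "{i}" "\<lambda>x. x j" "{j}"] \<xi>_moments(1)[of _ 1] \<xi>_moments(2) by simp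

lemma T_square: "integrable M (\<lambda>\<omega>. (T b m k \<omega>)\<^sup>2)" "(LINT \<omega>|M. (T b m k \<omega>)\<^sup>2) = (\<Sum>j=m..<k. (b j)\<^sup>2)"
proof -
  have eq: "(T b m k \<omega>)\<^sup>2 = (\<Sum>i=m..<k. \<Sum>j=m..<k. (b i * b j) * (\<xi> i \<omega> * \<xi> j \<omega>))" for \<omega>
    unfolding T_def power2_eq_square sum_product by (intro sum.cong refl) simp
  have int: "integrable M (\<lambda>\<omega>. \<xi> i \<omega> * \<xi> j \<omega>)" for i j
    using \<xi>_cross[of i j] \<xi>_moments(1)[of i 2] by (cases "i = j") (simp_all add: power2_eq_square)
  show "integrable M (\<lambda>\<omega>. (T b m k \<omega>)\<^sup>2)"
    unfolding eq by (intro Bochner_Integration.integrable_sum integrable_mult_right int)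
  have "(LINT \<omega>|M. (T b m k \<omega>)\<^sup>2) = (\<Sum>i=m..<k. \<Sum>j=m..<k. (b i * b j) * (LINT \<omega>|M. \<xi> i \<omega> * \<xi> j \<omega>))"
    unfolding eq using int by (simp add: Bochner_Integration.integral_sum)
  also have "\<dots> = (\<Sum>i=m..<k. \<Sum>j=m..<k. if j = i then (b i)\<^sup>2 else 0)"
    using \<xi>_cross \<xi>_moments(3) by (intro sum.cong refl) (auto simp: power2_eq_square)
  finally show "(LINT \<omega>|M. (T b m k \<omega>)\<^sup>2) = (\<Sum>j=m..<k. (b j)\<^sup>2)" by simp
qed

text \<open>Kolmogorov's inequality, by the first index \<open>k\<close> at which the block sum
  reaches \<epsilon>. The later increment has mean 0 and is independent of the past up to
  \<open>k\<close>, which decides the event \<open>A k\<close>; so replacing \<open>T b m k\<close>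
  by the final \<open>T b m n\<close> can only increase the second moment on
  \<open>A k\<close>.\<close>

lemma kolmogorov_maximal:
  assumes \<epsilon>: "0 < \<epsilon>"
  shows "prob {\<omega>\<in>space M. \<exists>k\<in>{m..n}. \<epsilon> \<le> \<bar>T b m k \<omega>\<bar>} \<le> (\<Sum>j=m..<n. (b j)\<^sup>2) / \<epsilon>\<^sup>2"
proof -
  define A where "A = (\<lambda>k. {\<omega>\<in>space M. \<epsilon> \<le> \<bar>T b m k \<omega>\<bar> \<and> (\<forall>i\<in>{m..<k}. \<bar>T b m i \<omega>\<bar> < \<epsilon>)})"
  have A_meas [measurable]: "A k \<in> sets M" for k unfolding A_def by measurable
  define I where "I = (\<lambda>k \<omega>. indicator (A k) \<omega> :: real)"
  have I_meas [measurable]: "I k \<in> borel_measurable M" for k unfolding I_def by measurable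
  have eq: "{\<omega>\<in>space M. \<exists>k\<in>{m..n}. \<epsilon> \<le> \<bar>T b m k \<omega>\<bar>} = (\<Union>k\<in>{m..n}. A k)"
  proof (intro set_eqI iffI)
    fix \<omega> assume "\<omega> \<in> {\<omega>\<in>space M. \<exists>k\<in>{m..n}. \<epsilon> \<le> \<bar>T b m k \<omega>\<bar>}"
    then have \<omega>: "\<omega> \<in> space M" and "\<exists>k. k \<in> {m..n} \<and> \<epsilon> \<le> \<bar>T b m k \<omega>\<bar>" by blast+
    from LeastI_ex[OF this(2)] not_less_Least
    obtain k where k: "k \<in> {m..n}" "\<epsilon> \<le> \<bar>T b m k \<omega>\<bar>" "\<And>i. i < k \<Longrightarrow> \<not> (i \<in> {m..n} \<and> \<epsilon> \<le> \<bar>T b m i \<omega>\<bar>)" by blast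
    have "\<bar>T b m i \<omega>\<bar> < \<epsilon>" if "i \<in> {m..<k}" for i using k(3)[of i] k(1) that by auto
    then have "\<omega> \<in> A k" using k \<omega> by (simp add: A_def)
    then show "\<omega> \<in> (\<Union>k\<in>{m..n}. A k)" using k(1) by blast
  qed (auto simp: A_def)
  have "disjoint_family_on A {m..n}"
    unfolding disjoint_family_on_def
  proof (intro ballI impI)
    fix i k assume ik: "i \<in> {m..n}" "k \<in> {m..n}" "i \<noteq> k"
    show "A i \<inter> A k = {}"
    proof (rule ccontr)
      assume "A i \<inter> A k \<noteq> {}"
      then obtain \<omega> where \<omega>: "\<omega> \<in> A i" "\<omega> \<in> A k" by blast
      from \<omega>(1) have a: "\<epsilon> \<le> \<bar>T b m i \<omega>\<bar>" "k \<in> {m..<i} \<Longrightarrow> \<bar>T b m k \<omega>\<bar> < \<epsilon>" by (simp_all add: A_def)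
      from \<omega>(2) have b: "\<epsilon> \<le> \<bar>T b m k \<omega>\<bar>" "i \<in> {m..<k} \<Longrightarrow> \<bar>T b m i \<omega>\<bar> < \<epsilon>" by (simp_all add: A_def)
      show False using ik a b by (cases "i < k") auto
    qed
  qed
  then have sum_prob: "prob (\<Union>k\<in>{m..n}. A k) = (\<Sum>k=m..n. prob (A k))"
    by (intro finite_measure_finite_Union) auto
  have I_le: "(\<Sum>k=m..n. I k \<omega>) \<le> 1" for \<omega>
  proof -
    have "(\<Sum>k=m..n. I k \<omega>) = indicator (\<Union>k\<in>{m..n}. A k) \<omega>"
      unfolding I_def using \<open>disjoint_family_on A {m..n}\<close> by (intro indicator_UN_disjoint[symmetric]) auto
    then show ?thesis by (simp add: indicator_def)
  qed
  have cut: "integrable M (\<lambda>\<omega>. I k \<omega> * f \<omega>)" if "integrable M f" for k and f :: "'a \<Rightarrow> real"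
    unfolding I_def using integrable_real_mult_indicator[OF A_meas that, of k] by (simp only: mult.commute)
  have step: "\<epsilon>\<^sup>2 * prob (A k) \<le> (LINT \<omega>|M. I k \<omega> * (T b m n \<omega>)\<^sup>2)" if k: "k \<in> {m..n}" for k
  proof -
    have Tn: "T b m n \<omega> = T b m k \<omega> + T b k n \<omega>" for \<omega>
      using k by (simp add: T_def sum.atLeastLessThan_concat)
    \<comment> \<open>The block sum on the event \<open>A k\<close>, rewritten as a function of the
      coordinates from \<open>m\<close> to \<open>k - 1\<close> alone, so that independence of
      disjoint blocks applies.\<close>
    define f where "f = (\<lambda>x::nat \<Rightarrow> real. (\<Sum>j=m..<k. b j * x j) *
       (if \<epsilon> \<le> \<bar>\<Sum>j=m..<k. b j * x j\<bar> \<and> (\<forall>i\<in>{m..<k}. \<bar>\<Sum>j=m..<i. b j * x j\<bar> < \<epsilon>) then 1 else 0))"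
    define g where "g = (\<lambda>x::nat \<Rightarrow> real. \<Sum>j=k..<n. b j * x j)"
    have part: "(\<lambda>x. \<Sum>j=p..<q. b j * x j) \<in> borel_measurable (PiM {p'..<q'} (\<lambda>_. borel))" if "p' \<le> p" "q \<le> q'" for p q p' q'
      using that by (intro borel_measurable_sum borel_measurable_times measurable_component_singleton) auto
    have [measurable]: "(\<lambda>x. \<Sum>j=m..<k. b j * x j) \<in> borel_measurable (PiM {m..<k} (\<lambda>_. borel))" by (rule part) auto
    have "(\<lambda>x. \<bar>\<Sum>j=m..<i. b j * x j\<bar> < \<epsilon>) \<in> measurable (PiM {m..<k} (\<lambda>_. borel)) (count_space UNIV)" if "i \<in> {m..<k}" for i
    proof -
      have [measurable]: "(\<lambda>x. \<Sum>j=m..<i. b j * x j) \<in> borel_measurable (PiM {m..<k} (\<lambda>_. borel))" using that by (intro part) auto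
      show ?thesis by measurable
    qed
    then have [measurable]: "(\<lambda>x. \<forall>i\<in>{m..<k}. \<bar>\<Sum>j=m..<i. b j * x j\<bar> < \<epsilon>) \<in> measurable (PiM {m..<k} (\<lambda>_. borel)) (count_space UNIV)"
      by (intro pred_intros_finite) auto
    have f [measurable]: "f \<in> borel_measurable (PiM {m..<k} (\<lambda>_. borel))" unfolding f_def by measurable
    have g [measurable]: "g \<in> borel_measurable (PiM {k..<n} (\<lambda>_. borel))" unfolding g_def by (rule part) auto
    have fr: "(\<Sum>j=m..<i. b j * (\<lambda>i\<in>{m..<k}. \<xi> i \<omega>) j) = T b m i \<omega>" if "i \<le> k" for i \<omega>
      unfolding T_def using that by (intro sum.cong) auto
    have f_eq: "f (\<lambda>i\<in>{m..<k}. \<xi> i \<omega>) = I k \<omega> * T b m k \<omega>" if "\<omega> \<in> space M" for \<omega>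
    proof -
      have "(\<forall>i\<in>{m..<k}. \<bar>\<Sum>j=m..<i. b j * (\<lambda>i\<in>{m..<k}. \<xi> i \<omega>) j\<bar> < \<epsilon>) \<longleftrightarrow> (\<forall>i\<in>{m..<k}. \<bar>T b m i \<omega>\<bar> < \<epsilon>)"
        by (intro ball_cong refl) (simp add: fr del: restrict_apply)
      then show ?thesis
        unfolding f_def fr[OF order_refl] using that by (simp add: I_def A_def indicator_def)
    qed
    have g_eq: "g (\<lambda>i\<in>{k..<n}. \<xi> i \<omega>) = T b k n \<omega>" for \<omega>
      unfolding g_def T_def by (intro sum.cong) auto
    have intf: "integrable M (\<lambda>\<omega>. f (\<lambda>i\<in>{m..<k}. \<xi> i \<omega>))"
      using cut[OF T_integrable, of k b m k] by (subst Bochner_Integration.integrable_cong[OF refl f_eq]) auto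
    have intg: "integrable M (\<lambda>\<omega>. g (\<lambda>i\<in>{k..<n}. \<xi> i \<omega>))" unfolding g_eq by (rule T_integrable)
    have disj: "{m..<k} \<inter> {k..<n} = {}" by auto
    have cross_int: "integrable M (\<lambda>\<omega>. I k \<omega> * T b m k \<omega> * T b k n \<omega>)"
      using indep_product(1)[OF f g disj intf intg] unfolding g_eq
      by (subst (asm) Bochner_Integration.integrable_cong[OF refl, of M _ "\<lambda>\<omega>. I k \<omega> * T b m k \<omega> * T b k n \<omega>"]) (simp_all add: f_eq)
    have "(LINT \<omega>|M. I k \<omega> * T b m k \<omega> * T b k n \<omega>) = (LINT \<omega>|M. f (\<lambda>i\<in>{m..<k}. \<xi> i \<omega>) * g (\<lambda>i\<in>{k..<n}. \<xi> i \<omega>))"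
      by (intro Bochner_Integration.integral_cong) (simp_all add: f_eq g_eq)
    also have "\<dots> = 0" unfolding indep_product(2)[OF f g disj intf intg] unfolding g_eq by (simp add: T_mean)
    finally have cross: "(LINT \<omega>|M. I k \<omega> * T b m k \<omega> * T b k n \<omega>) = 0" .
    have "\<epsilon>\<^sup>2 * prob (A k) = (LINT \<omega>|M. I k \<omega> * \<epsilon>\<^sup>2)" by (simp add: I_def Int_absorb1 sets.sets_into_space)
    also have "\<dots> \<le> (LINT \<omega>|M. I k \<omega> * (T b m k \<omega>)\<^sup>2)"
    proof (rule integral_mono)
      show "integrable M (\<lambda>\<omega>. I k \<omega> * \<epsilon>\<^sup>2)" by (rule cut) simp
      show "integrable M (\<lambda>\<omega>. I k \<omega> * (T b m k \<omega>)\<^sup>2)" by (rule cut[OF T_square(1)])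
      fix \<omega>
      show "I k \<omega> * \<epsilon>\<^sup>2 \<le> I k \<omega> * (T b m k \<omega>)\<^sup>2"
      proof (cases "\<omega> \<in> A k")
        case True
        then have "\<bar>\<epsilon>\<bar> \<le> \<bar>T b m k \<omega>\<bar>" using \<epsilon> by (simp add: A_def)
        then show ?thesis by (simp add: I_def abs_le_square_iff indicator_def)
      qed (simp add: I_def)
    qed
    \<comment> \<open>The cross term has integral 0 and is added in order to complete the
      square.\<close>
    also have "\<dots> = (LINT \<omega>|M. I k \<omega> * (T b m k \<omega>)\<^sup>2 + 2 * (I k \<omega> * T b m k \<omega> * T b k n \<omega>))"
      using cross cross_int cut[OF T_square(1), of k b m k] by simp
    also have "\<dots> \<le> (LINT \<omega>|M. I k \<omega> * (T b m n \<omega>)\<^sup>2)"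
    proof (rule integral_mono)
      show "integrable M (\<lambda>\<omega>. I k \<omega> * (T b m k \<omega>)\<^sup>2 + 2 * (I k \<omega> * T b m k \<omega> * T b k n \<omega>))"
        using cross_int cut[OF T_square(1), of k b m k] by simp
      show "integrable M (\<lambda>\<omega>. I k \<omega> * (T b m n \<omega>)\<^sup>2)" by (rule cut[OF T_square(1)])
      fix \<omega>
      have "0 \<le> I k \<omega> * (T b k n \<omega>)\<^sup>2" by (simp add: I_def)
      then show "I k \<omega> * (T b m k \<omega>)\<^sup>2 + 2 * (I k \<omega> * T b m k \<omega> * T b k n \<omega>) \<le> I k \<omega> * (T b m n \<omega>)\<^sup>2"
        unfolding Tn by (simp add: power2_eq_square algebra_simps)
    qed
    finally show ?thesis .
  qed
  have "\<epsilon>\<^sup>2 * prob (\<Union>k\<in>{m..n}. A k) = (\<Sum>k=m..n. \<epsilon>\<^sup>2 * prob (A k))" by (simp only: sum_prob sum_distrib_left)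
  also have "\<dots> \<le> (\<Sum>k=m..n. LINT \<omega>|M. I k \<omega> * (T b m n \<omega>)\<^sup>2)" by (intro sum_mono step)
  also have "\<dots> = (LINT \<omega>|M. (\<Sum>k=m..n. I k \<omega>) * (T b m n \<omega>)\<^sup>2)"
    unfolding sum_distrib_right by (intro Bochner_Integration.integral_sum[symmetric] cut T_square(1))
  also have "\<dots> \<le> (LINT \<omega>|M. (T b m n \<omega>)\<^sup>2)"
  proof (rule integral_mono)
    show "integrable M (\<lambda>\<omega>. (\<Sum>k=m..n. I k \<omega>) * (T b m n \<omega>)\<^sup>2)"
      unfolding sum_distrib_right by (intro Bochner_Integration.integrable_sum cut T_square(1))
    show "(\<Sum>k=m..n. I k \<omega>) * (T b m n \<omega>)\<^sup>2 \<le> (T b m n \<omega>)\<^sup>2" for \<omega>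
      using mult_right_mono[OF I_le, of "(T b m n \<omega>)\<^sup>2" \<omega>] by simp
  qed (rule T_square(1))
  finally have "\<epsilon>\<^sup>2 * prob (\<Union>k\<in>{m..n}. A k) \<le> (\<Sum>j=m..<n. (b j)\<^sup>2)" by (simp only: T_square(2))
  then show ?thesis unfolding eq using \<epsilon> by (simp add: pos_le_divide_eq mult.commute)
qed

text \<open>The maximal inequality and continuity from below bound the probability that some block
  sum starting at \<open>m\<close> reaches \<epsilon> by \<open>V m / \<epsilon>\<^sup>2\<close>,
  where \<open>V m\<close> is the tail of the square sum. This tends to 0 as \<open>m\<close> grows,
  so the partial sums are almost surely Cauchy.\<close>

lemma series_AE_convergent:
  assumes sum: "summable (\<lambda>k. (b k)\<^sup>2)"
  shows "AE \<omega> in M. convergent (\<lambda>n. \<Sum>k<n. b k * \<xi> k \<omega>)"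
proof -
  define V where "V = (\<lambda>m. \<Sum>j. (b (j + m))\<^sup>2)"
  have V: "V \<longlonglongrightarrow> 0" unfolding V_def using suminf_exist_split2[OF sum] by simp
  have Vle: "(\<Sum>j=m..<n. (b j)\<^sup>2) \<le> V m" for m n
  proof -
    have "(\<Sum>j=m..<n. (b j)\<^sup>2) = (\<Sum>j<n - m. (b (j + m))\<^sup>2)"
      using sum.shift_bounds_nat_ivl[of "\<lambda>j. (b j)\<^sup>2" 0 m "n - m"] by (cases "m \<le> n") (simp_all add: atLeast0LessThan)
    also have "\<dots> \<le> V m"
      unfolding V_def using summable_ignore_initial_segment[OF sum] by (intro sum_le_suminf) auto
    finally show ?thesis .
  qed
  define D where "D = (\<lambda>\<epsilon> m n. {\<omega>\<in>space M. \<exists>k\<in>{m..n}. \<epsilon> \<le> \<bar>T b m k \<omega>\<bar>})"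
  have D_meas [measurable]: "D \<epsilon> m n \<in> sets M" for \<epsilon> m n unfolding D_def by measurable
  have small: "prob (\<Union>n. D \<epsilon> m n) \<le> V m / \<epsilon>\<^sup>2" if \<epsilon>: "\<epsilon> > 0" for \<epsilon> m
  proof (rule LIMSEQ_le_const2)
    show "(\<lambda>n. prob (D \<epsilon> m n)) \<longlonglongrightarrow> prob (\<Union>n. D \<epsilon> m n)"
      by (rule finite_Lim_measure_incseq) (auto simp: incseq_def D_def)
    have "prob (D \<epsilon> m n) \<le> V m / \<epsilon>\<^sup>2" for n
      unfolding D_def using kolmogorov_maximal[OF \<epsilon>, of m n b] Vle[of m n] \<epsilon> by (meson divide_right_mono order_trans zero_le_power2)
    then show "\<exists>N. \<forall>n\<ge>N. prob (D \<epsilon> m n) \<le> V m / \<epsilon>\<^sup>2" by blast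
  qed
  have null: "AE \<omega> in M. \<exists>m. \<forall>k\<ge>m. \<bar>T b m k \<omega>\<bar> < \<epsilon>" if \<epsilon>: "\<epsilon> > 0" for \<epsilon>
  proof -
    define Z where "Z = (\<Inter>m. \<Union>n. D \<epsilon> m n)"
    have Z [measurable]: "Z \<in> sets M" unfolding Z_def by measurable
    have "prob Z \<le> V m / \<epsilon>\<^sup>2" for m
      using finite_measure_mono[of Z "\<Union>n. D \<epsilon> m n"] small[OF \<epsilon>, of m] unfolding Z_def by fastforce
    moreover have "(\<lambda>m. V m / \<epsilon>\<^sup>2) \<longlonglongrightarrow> 0" using tendsto_divide[OF V tendsto_const, of "\<epsilon>\<^sup>2"] \<epsilon> by simp
    ultimately have "prob Z \<le> 0" by (intro LIMSEQ_le_const) auto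
    then have "prob Z = 0" by (simp add: measure_le_0_iff)
    then have "emeasure M Z = 0" by (simp add: emeasure_eq_measure)
    then have "AE \<omega> in M. \<omega> \<notin> Z" using Z by (intro AE_not_in) (simp add: null_sets_def)
    then show ?thesis
      using AE_space
    proof eventually_elim
      case (elim \<omega>)
      then obtain m where m: "\<And>n. \<omega> \<notin> D \<epsilon> m n" unfolding Z_def by blast
      have "\<bar>T b m k \<omega>\<bar> < \<epsilon>" if "k \<ge> m" for k
      proof (rule ccontr)
        assume "\<not> \<bar>T b m k \<omega>\<bar> < \<epsilon>"
        then have "\<exists>k'\<in>{m..k}. \<epsilon> \<le> \<bar>T b m k' \<omega>\<bar>" using that by (intro bexI[of _ k]) auto
        then have "\<omega> \<in> D \<epsilon> m k" using elim(2) by (simp add: D_def)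
        then show False using m by blast
      qed
      then show ?case by blast
    qed
  qed
  have "AE \<omega> in M. \<forall>i::nat. \<exists>m. \<forall>k\<ge>m. \<bar>T b m k \<omega>\<bar> < 1 / real (Suc i)"
    unfolding AE_all_countable using null by simp
  then show ?thesis
  proof eventually_elim
    case (elim \<omega>)
    let ?S = "\<lambda>n. \<Sum>k<n. b k * \<xi> k \<omega>"
    have T_S: "T b m k \<omega> = ?S k - ?S m" if "m \<le> k" for m k
      unfolding T_def using that by (subst sum_diff_nat_ivl[of 0 m k, unfolded atLeast0LessThan, symmetric]) auto
    have "Cauchy ?S"
    proof (rule metric_CauchyI)
      fix e :: real assume "e > 0"
      then obtain i where i: "1 / real (Suc i) < e / 2" using nat_approx_posE[of "e / 2"] by auto
      obtain m where m: "\<And>k. k \<ge> m \<Longrightarrow> \<bar>T b m k \<omega>\<bar> < 1 / real (Suc i)" using elim by blast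
      have "dist (?S j) (?S k) < e" if "j \<ge> m" "k \<ge> m" for j k
      proof -
        have "\<bar>?S j - ?S m\<bar> < 1 / real (Suc i)" "\<bar>?S k - ?S m\<bar> < 1 / real (Suc i)"
          using m[OF that(1)] m[OF that(2)] T_S[OF that(1)] T_S[OF that(2)] by simp_all
        then show ?thesis using i unfolding dist_real_def by linarith
      qed
      then show "\<exists>N. \<forall>m\<ge>N. \<forall>n\<ge>N. dist (?S m) (?S n) < e" by blast
    qed
    then show ?case by (simp add: Cauchy_convergent_iff)
  qed
qed

end

section \<open>Eigenfunctions\<close>

lemma integration_by_parts:
  assumes fg: "weak_deriv l f g" and hk: "weak_deriv l h k" and l: "0 \<le> l"
  shows "(LINT t|Ivl l. g t * h t) + (LINT t|Ivl l. f t * k t) = f l * h l - f 0 * h 0"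
proof -
  have W: "weak_deriv l (\<lambda>t. f t * h t) (\<lambda>t. g t * h t + f t * k t)" by (rule weak_deriv_mult[OF fg hk])
  then have "prim l (\<lambda>t. g t * h t + f t * k t) l = f l * h l - f 0 * h 0"
    using l by (simp add: weak_deriv_def)
  moreover have "(LINT t|Ivl l. g t * h t + f t * k t) = (LINT t|Ivl l. g t * h t) + (LINT t|Ivl l. f t * k t)"
    using fg hk by (intro Bochner_Integration.integral_add in_L2_mult_integrable weak_deriv_in_L2 weak_deriv_in_L2')
  ultimately show ?thesis by (simp add: prim_full)
qed

lemma weak_deriv_cong:
  assumes "weak_deriv l f g" and "0 \<le> l" and eq: "\<And>t. t \<in> {0..l} \<Longrightarrow> f t = f' t"
  shows "weak_deriv l f' g"
proof -
  have 0: "0 \<in> {0..l}" using assms(2) by simp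
  show ?thesis
    using assms(1) eq[OF 0] unfolding weak_deriv_def by (simp add: eq)
qed

lemma weak_deriv_affine: "0 \<le> l \<Longrightarrow> weak_deriv l (\<lambda>t. p + q * t) (\<lambda>t. q)"
proof -
  assume l: "0 \<le> l"
  have "prim l (\<lambda>t. q) t = q * t" if t: "t \<in> {0..l}" for t
    using t measure_Ivl_Ioc[of 0 t l] prim_increment[OF in_L2_integrable[OF in_L2_const], of 0 t l q]
    by (simp add: prim_0 mult.commute)
  then show ?thesis using l by (simp add: weak_deriv_def)
qed

text \<open>The deviation of \<open>F\<close> from its mean is itself an admissible test function;
  testing with it shows that its square has integral 0.\<close>

lemma du_Bois_Reymond:
  assumes l: "0 < l" and F: "in_L2 l F"
    and orth: "\<And>q. in_L2 l q \<Longrightarrow> (LINT t|Ivl l. q t) = 0 \<Longrightarrow> (LINT t|Ivl l. F t * q t) = 0"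
  shows "AE t in Ivl l. F t = (LINT t|Ivl l. F t) / l"
proof -
  define c where "c = (LINT t|Ivl l. F t) / l"
  define q where "q = (\<lambda>t. F t - c)"
  have q: "in_L2 l q" unfolding q_def by (rule in_L2_diff[OF F in_L2_const])
  have int: "(LINT t|Ivl l. q t) = 0"
  proof -
    have "(LINT t|Ivl l. q t) = (LINT t|Ivl l. F t) - (LINT t|Ivl l. c)"
      unfolding q_def by (rule Bochner_Integration.integral_diff[OF in_L2_integrable[OF F] in_L2_integrable[OF in_L2_const]])
    also have "(LINT t|Ivl l. c) = l * c" using measure_Ivl_subinterval[of 0 l l] l by simp
    finally show ?thesis using l by (simp add: c_def)
  qed
  have "(LINT t|Ivl l. q t * q t) = (LINT t|Ivl l. F t * q t - c * q t)"
    unfolding q_def by (simp only: left_diff_distrib)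
  also have "\<dots> = (LINT t|Ivl l. F t * q t) - (LINT t|Ivl l. c * q t)"
    by (intro Bochner_Integration.integral_diff in_L2_mult_integrable F q in_L2_const)
  also have "\<dots> = 0" using orth[OF q int] int by simp
  finally have "(LINT t|Ivl l. q t * q t) = 0" .
  then have "AE t in Ivl l. q t * q t = 0"
    using in_L2_mult_integrable[OF q q] by (subst (asm) integral_nonneg_eq_0_iff_AE) auto
  then have "AE t in Ivl l. F t = c" by eventually_elim (simp add: q_def)
  then show ?thesis by (simp only: c_def)
qed

text \<open>Test functions living on one edge: if \<open>q\<close> has integral 0, its primitive
  vanishes at both endpoints, so the extension by 0 respects every vertex condition.\<close>

definition bump :: "('e \<Rightarrow> real) \<Rightarrow> 'e \<Rightarrow> (real \<Rightarrow> real) \<Rightarrow> 'e graph_fun \<times> 'e graph_fun" where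
  "bump len e q = ((\<lambda>e' t. if e' = e then prim (len e) q t else 0), (\<lambda>e' t. if e' = e then q t else 0))"

lemma bump_simps [simp]: "fst (bump len e q) e = prim (len e) q" "snd (bump len e q) e = q"
  "e' \<noteq> e \<Longrightarrow> fst (bump len e q) e' = (\<lambda>t. 0)" "e' \<noteq> e \<Longrightarrow> snd (bump len e q) e' = (\<lambda>t. 0)"
  by (simp_all add: bump_def)

lemma bump_in_H1:
  assumes "in_L2 (len e) q" and "(LINT t|Ivl (len e). q t) = 0"
  shows "bump len e q \<in> H1_graph src tgt len"
proof (rule H1_graphI)
  show "bump len e q \<in> H1_space len"
    unfolding H1_space_def mem_Collect_eq
  proof
    fix e' show "weak_deriv (len e') (fst (bump len e q) e') (snd (bump len e q) e')"
      using weak_deriv_prim[OF assms(1), of 0] weak_deriv_const by (cases "e' = e") simp_all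
  qed
  have "at_endpt len (fst (bump len e q)) j = 0" for j
    using assms(2) by (auto simp: at_endpt_def endpt_pos_def bump_def prim_0 prim_full)
  then show "at_endpt len (fst (bump len e q)) j = at_endpt len (fst (bump len e q)) j'" for j j' by simp
qed

context graph_form
begin

lemma bump_V: "in_L2 (len e) q \<Longrightarrow> (LINT t|Ivl (len e). q t) = 0 \<Longrightarrow> bump len e q \<in> V"
  by (rule bump_in_H1)

lemma E_bump:
  assumes x: "x \<in> H" and q: "in_L2 (len e) q" "(LINT t|Ivl (len e). q t) = 0"
  shows "E x (bump len e q) = (LINT t|Ivl (len e). a e t * (snd x e t * q t)) + (LINT t|Ivl (len e). (\<kappa> e t)\<^sup>2 * (fst x e t * prim (len e) q t))"
    and "B x (bump len e q) = (LINT t|Ivl (len e). fst x e t * prim (len e) q t)"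
proof -
  have b: "bump len e q \<in> H" by (rule V_H[OF bump_V[OF q]])
  have "E x (bump len e q) = (\<Sum>e'\<in>UNIV. if e' = e then (LINT t|Ivl (len e). a e t * (snd x e t * q t)) +
     (LINT t|Ivl (len e). (\<kappa> e t)\<^sup>2 * (fst x e t * prim (len e) q t)) else 0)"
    unfolding energy_split[OF x b] by (intro sum.cong refl) simp
  then show "E x (bump len e q) = (LINT t|Ivl (len e). a e t * (snd x e t * q t)) + (LINT t|Ivl (len e). (\<kappa> e t)\<^sup>2 * (fst x e t * prim (len e) q t))"
    by simp
  have "B x (bump len e q) = (\<Sum>e'\<in>UNIV. if e' = e then (LINT t|Ivl (len e). fst x e t * prim (len e) q t) else 0)"
    unfolding mass_def by (intro sum.cong refl) simp
  then show "B x (bump len e q) = (LINT t|Ivl (len e). fst x e t * prim (len e) q t)" by simp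
qed

text \<open>With \<open>W\<close> a primitive of \<open>w\<close>, the weak equation against bumps
  says that a \<phi>' - W is orthogonal to all functions of mean 0, hence constant. So \<phi>' has
  the continuous version \<open>G\<close> = (c + W) / a, and the product rule with the Lipschitz
  function 1 / a gives \<open>G\<close> a derivative in L2, which is the H2 regularity.\<close>

lemma weak_eigen_regular:
  assumes \<phi>: "\<phi> \<in> V" and eig: "\<And>h. h \<in> V \<Longrightarrow> E \<phi> h = \<mu> * B \<phi> h"
  defines "w \<equiv> (\<lambda>e t. (\<kappa> e t)\<^sup>2 * fst \<phi> e t - \<mu> * fst \<phi> e t)"
  obtains G where "\<And>e. weak_deriv (len e) (fst \<phi> e) (G e)" "\<And>e. weak_deriv (len e) (\<lambda>t. a e t * G e t) (w e)"
    "\<And>e. H2_on (len e) (fst \<phi> e)" "\<And>e. AE t in Ivl (len e). snd \<phi> e t = G e t"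
proof -
  have \<phi>H: "\<phi> \<in> H" using V_H[OF \<phi>] .
  have w: "in_L2 (len e) (w e)" for e
    unfolding w_def by (intro in_L2_diff \<kappa>_mult_L2 in_L2_scale H_in_L2 \<phi>H)
  define W where "W = (\<lambda>e. prim (len e) (w e))"
  have Wd: "weak_deriv (len e) (W e) (w e)" for e using weak_deriv_prim[OF w, of e 0] by (simp add: W_def)
  define F where "F = (\<lambda>e t. a e t * snd \<phi> e t - W e t)"
  have F: "in_L2 (len e) (F e)" for e
    unfolding F_def by (intro in_L2_diff a_mult_L2 H_in_L2 \<phi>H weak_deriv_in_L2'[OF Wd])
  define c where "c = (\<lambda>e. (LINT t|Ivl (len e). F e t) / len e)"
  have Fc: "AE t in Ivl (len e). F e t = c e" for e
    unfolding c_def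
  proof (rule du_Bois_Reymond[OF len_pos F])
    fix q assume q: "in_L2 (len e) q" "(LINT t|Ivl (len e). q t) = 0"
    define Q where "Q = prim (len e) q"
    have Qd: "weak_deriv (len e) Q q" using weak_deriv_prim[OF q(1), of 0] by (simp add: Q_def)
    have Q0: "Q 0 = 0" "Q (len e) = 0" using q(2) by (simp_all add: Q_def prim_0 prim_full)
    have fQ: "integrable (Ivl (len e)) (\<lambda>t. fst \<phi> e t * Q t)" "integrable (Ivl (len e)) (\<lambda>t. (\<kappa> e t)\<^sup>2 * (fst \<phi> e t * Q t))"
      using in_L2_mult_integrable[OF H_in_L2(1)[OF \<phi>H] weak_deriv_in_L2'[OF Qd]]
        in_L2_mult_integrable[OF \<kappa>_mult_L2[OF H_in_L2(1)[OF \<phi>H]] weak_deriv_in_L2'[OF Qd]] by (simp_all add: mult.assoc)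
    have "(LINT t|Ivl (len e). a e t * (snd \<phi> e t * q t)) + (LINT t|Ivl (len e). (\<kappa> e t)\<^sup>2 * (fst \<phi> e t * Q t)) = \<mu> * (LINT t|Ivl (len e). fst \<phi> e t * Q t)"
      using eig[OF bump_V[OF q]] E_bump[OF \<phi>H q] by (simp only: Q_def)
    moreover have "(LINT t|Ivl (len e). w e t * Q t) = (LINT t|Ivl (len e). (\<kappa> e t)\<^sup>2 * (fst \<phi> e t * Q t)) - \<mu> * (LINT t|Ivl (len e). fst \<phi> e t * Q t)"
      using fQ by (simp add: w_def left_diff_distrib mult.assoc)
    moreover have "(LINT t|Ivl (len e). w e t * Q t) + (LINT t|Ivl (len e). W e t * q t) = 0"
      using integration_by_parts[OF Wd Qd len_nonneg] Q0 by simp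
    moreover have "(LINT t|Ivl (len e). F e t * q t) = (LINT t|Ivl (len e). a e t * (snd \<phi> e t * q t)) - (LINT t|Ivl (len e). W e t * q t)"
    proof -
      have "(LINT t|Ivl (len e). F e t * q t) = (LINT t|Ivl (len e). a e t * snd \<phi> e t * q t - W e t * q t)"
        unfolding F_def by (simp only: left_diff_distrib)
      also have "\<dots> = (LINT t|Ivl (len e). a e t * snd \<phi> e t * q t) - (LINT t|Ivl (len e). W e t * q t)"
        by (intro Bochner_Integration.integral_diff in_L2_mult_integrable a_mult_L2 H_in_L2 \<phi>H weak_deriv_in_L2'[OF Wd] q)
      finally show ?thesis by (simp only: mult.assoc)
    qed
    ultimately show "(LINT t|Ivl (len e). F e t * q t) = 0" by linarith
  qed
  define G where "G = (\<lambda>e t. (c e + W e t) * inverse (a e t))"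
  have ane: "a e t \<noteq> 0" if "t \<in> {0..len e}" for e t using a_bounds[OF that] a0_pos by auto
  have cW: "weak_deriv (len e) (\<lambda>t. c e + W e t) (w e)" for e
    unfolding W_def by (rule weak_deriv_prim[OF w])
  have "\<exists>\<beta>. weak_deriv (len e) (\<lambda>t. inverse (a e t)) \<beta>" for e
  proof -
    \<comment> \<open>From 1/x - 1/y = (y - x) / (x y) with the lower bound \<open>a0\<close> for
      both factors of the denominator.\<close>
    have lip: "(La / a0\<^sup>2)-lipschitz_on {0..len e} (\<lambda>t. inverse (a e t))"
    proof (rule lipschitz_onI)
      show "0 \<le> La / a0\<^sup>2" using lipschitz_on_nonneg[OF a_lipschitz] by simp
      fix s t assume st: "s \<in> {0..len e}" "t \<in> {0..len e}"
      have pos: "0 < a e s" "0 < a e t" "a0 * a0 \<le> a e s * a e t"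
        using a_bounds[OF st(1)] a_bounds[OF st(2)] a0_pos by (auto intro!: mult_mono)
      have "dist (inverse (a e s)) (inverse (a e t)) = \<bar>a e t - a e s\<bar> / (a e s * a e t)"
        using pos by (simp add: dist_real_def inverse_eq_divide diff_frac_eq abs_divide abs_mult)
      also have "\<dots> \<le> (La * dist s t) / (a0 * a0)"
        using lipschitz_onD[OF a_lipschitz st] pos a0_pos by (intro frac_le) (auto simp: dist_real_def abs_minus_commute)
      finally show "dist (inverse (a e s)) (inverse (a e t)) \<le> La / a0\<^sup>2 * dist s t" by (simp add: power2_eq_square)
    qed
    show ?thesis by (rule lipschitz_weak_deriv[OF len_nonneg lip]) (rule exI)
  qed
  from choice[OF allI[OF this]]
  obtain \<beta> where \<beta>': "\<forall>e. weak_deriv (len e) (\<lambda>t. inverse (a e t)) (\<beta> e)" ..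
  have \<beta>: "weak_deriv (len e) (\<lambda>t. inverse (a e t)) (\<beta> e)" for e using \<beta>' ..
  have Gd: "weak_deriv (len e) (G e) (\<lambda>t. w e t * inverse (a e t) + (c e + W e t) * \<beta> e t)" for e
    unfolding G_def by (rule weak_deriv_mult[OF cW[of e] \<beta>[of e]])
  have GAE: "AE t in Ivl (len e). snd \<phi> e t = G e t" for e
    using Fc[of e] AE_space
  proof eventually_elim
    case (elim t)
    then have "a e t * snd \<phi> e t = c e + W e t" "a e t \<noteq> 0" using ane[of t e] by (simp_all add: F_def)
    then show ?case by (simp add: G_def field_simps)
  qed
  have fG: "weak_deriv (len e) (fst \<phi> e) (G e)" for e
    by (rule weak_deriv_cong_AE[OF H_weak_deriv[OF \<phi>H] _ GAE]) (rule in_L2_measurable[OF weak_deriv_in_L2'[OF Gd]])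
  have aG: "weak_deriv (len e) (\<lambda>t. a e t * G e t) (w e)" for e
    by (rule weak_deriv_cong[OF cW len_nonneg]) (use ane in \<open>simp add: G_def\<close>)
  have "H2_on (len e) (fst \<phi> e)" for e
    unfolding H2_on_def
    using weak_deriv_iff[THEN iffD2, OF fG, of e] weak_deriv_iff[THEN iffD2, OF Gd, of e] H_in_L2(1)[OF \<phi>H, of e]
    unfolding L2_on_iff by meson
  then show thesis using that[of G] fG aG GAE by blast
qed

text \<open>Variational counterpart of \<open>eigenbasis\<close>: the derivative conditions at the
  vertices are absorbed into the test space \<open>V\<close>, and completeness is asked only for
  vectors of \<open>V\<close>.\<close>

definition weak_eigenbasis :: "(nat \<Rightarrow> real) \<Rightarrow> (nat \<Rightarrow> 'e graph_fun \<times> 'e graph_fun) \<Rightarrow> bool" where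
  "weak_eigenbasis lam \<Phi> \<longleftrightarrow> (\<forall>k. \<Phi> k \<in> V) \<and> (\<forall>j k. B (\<Phi> j) (\<Phi> k) = (if j = k then 1 else 0)) \<and>
     (\<forall>k. \<forall>h\<in>V. E (\<Phi> k) h = lam k * B (\<Phi> k) h) \<and> (\<forall>x\<in>V. (\<forall>k. B x (\<Phi> k) = 0) \<longrightarrow> B x x = 0)"

lemma weak_eigenbasis_exists: obtains lam \<Phi> where "weak_eigenbasis lam \<Phi>"
proof (rule spectral_pair.spectral_basis[OF spectral])
  fix \<phi> :: "nat \<Rightarrow> 'e graph_fun \<times> 'e graph_fun" and \<mu>
  assume s: "\<And>k. \<phi> k \<in> V" "\<And>j k. B (\<phi> j) (\<phi> k) = (if j = k then 1 else 0)"
    "\<And>k h. h \<in> V \<Longrightarrow> E (\<phi> k) h = \<mu> k * B (\<phi> k) h" "\<And>h. \<lbrakk>h \<in> V; \<And>k. B h (\<phi> k) = 0\<rbrakk> \<Longrightarrow> B h h = 0"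
  have "weak_eigenbasis \<mu> \<phi>"
    unfolding weak_eigenbasis_def
    by (intro conjI allI ballI impI; (rule s(1) | rule s(2) | rule s(3) | rule s(4)); simp)
  then show thesis by (rule that)
qed

context
  fixes lam \<Phi> assumes basis: "weak_eigenbasis lam \<Phi>"
begin

lemma \<Phi>_V: "\<Phi> k \<in> V"
  using basis unfolding weak_eigenbasis_def by blast

lemma \<Phi>_orthonormal: "B (\<Phi> j) (\<Phi> k) = (if j = k then 1 else 0)"
  using basis unfolding weak_eigenbasis_def by blast

lemma \<Phi>_eigen: "h \<in> V \<Longrightarrow> E (\<Phi> k) h = lam k * B (\<Phi> k) h"
  using basis unfolding weak_eigenbasis_def by blast

lemma \<Phi>_complete: "x \<in> V \<Longrightarrow> (\<And>k. B x (\<Phi> k) = 0) \<Longrightarrow> B x x = 0"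
  using basis unfolding weak_eigenbasis_def by blast

lemma lam_pos: "0 < lam k"
proof -
  have "E (\<Phi> k) (\<Phi> k) = lam k" using \<Phi>_eigen[OF \<Phi>_V, of k k] \<Phi>_orthonormal[of k k] by simp
  then have "1 \<le> (1 / \<kappa>0\<^sup>2) * lam k" using mass_le_energy[OF V_H[OF \<Phi>_V], of k] \<Phi>_orthonormal[of k k] by simp
  then have "0 < (1 / \<kappa>0\<^sup>2) * lam k" by linarith
  then show ?thesis using \<kappa>0_pos by (simp add: zero_less_divide_iff)
qed

text \<open>Normalized in energy instead of mass, as \<open>E (\<Phi> k) (\<Phi> k) = lam k\<close>.
  The factor is the power lam^(-\<alpha>/2) of the field series for \<alpha> = 1.\<close>

definition \<psi> where "\<psi> k = (1 / sqrt (lam k)) *\<^sub>R \<Phi> k"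

lemma \<psi>_basis: "orthonormal_basis V E \<psi>"
proof (intro orthonormal_basis.intro E_complete_V orthonormal_basis_axioms.intro)
  interpret V: psd_form V E by (rule psd_form_subspace[OF E_psd H1_graph_subset H1_graph_subspace])
  interpret VB: psd_form V B by (rule B_psd_V)
  show V: "\<psi> k \<in> V" for k unfolding \<psi>_def by (intro V.V_scale \<Phi>_V)
  have left: "E (\<psi> k) h = sqrt (lam k) * B (\<Phi> k) h" if "h \<in> V" for k h
  proof -
    have "E (\<psi> k) h = (lam k / sqrt (lam k)) * B (\<Phi> k) h"
      using V.scale_left[OF \<Phi>_V that, of "1 / sqrt (lam k)" k] \<Phi>_eigen[OF that, of k] by (simp add: \<psi>_def)
    then show ?thesis by (simp only: real_div_sqrt[OF less_imp_le[OF lam_pos]])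
  qed
  show "E (\<psi> j) (\<psi> k) = (if j = k then 1 else 0)" for j k
    unfolding left[OF V] using VB.scale_right[OF \<Phi>_V \<Phi>_V, of j "1 / sqrt (lam k)" k] lam_pos[of k]
    by (simp add: \<psi>_def \<Phi>_orthonormal)
  show "E x x = 0" if x: "x \<in> V" and 0: "\<And>k. E x (\<psi> k) = 0" for x
  proof (rule mass_definite(2)[OF V_H[OF x] \<Phi>_complete[OF x]])
    fix k show "B x (\<Phi> k) = 0"
      using left[OF x, of k] 0[of k] V.sym[OF x V] VB.sym[OF x \<Phi>_V] lam_pos[of k] by simp
  qed
qed

lemma representer:
  assumes t: "t \<in> {0..len e}"
  obtains r where "r \<in> V" "\<And>x. x \<in> V \<Longrightarrow> E r x = fst x e t"
proof -
  interpret orthonormal_basis V E \<psi> by (rule \<psi>_basis)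
  show thesis
  proof (rule riesz[of "\<lambda>x. fst x e t" Cev])
    show "(fst x e t)\<^sup>2 \<le> Cev * E x x" if "x \<in> V" for x using evaluation[OF V_H[OF that] t] .
  qed (auto intro: that)
qed

end

end

lemma graph_inner_eq: "graph_inner len f h = (\<Sum>e\<in>UNIV. LINT t|Ivl (len e). f e t * h e t)"
  unfolding graph_inner_def integral_Ivl by (rule refl)

lemma graph_inner_mass: "graph_inner len (fst x) (fst y) = mass len x y"
  unfolding graph_inner_eq mass_def by (rule refl)

text \<open>Integration by parts produces a balance of the fluxes a G at a vertex. A value of
  \<open>a\<close> common to all edges there can be factored out, which leaves the balance of
  derivatives that the Kirchhoff condition asks for.\<close>

locale metric_graph = graph_form len \<kappa> a \<kappa>0 C\<kappa> a0 Ca La src tgt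
  for len :: "'e::finite \<Rightarrow> real" and \<kappa> a :: "'e graph_fun" and \<kappa>0 C\<kappa> a0 Ca La :: real
    and src tgt :: "'e \<Rightarrow> 'v" +
  assumes a_vertex: "endpt src tgt j = endpt src tgt j' \<Longrightarrow> at_endpt len a j = at_endpt len a j'"
begin

text \<open>Affine on each edge, 1 at the vertex \<open>v\<close> and 0 at all others; on a loop at
  \<open>v\<close> it is constantly 1. Testing with it isolates the boundary terms at
  \<open>v\<close>.\<close>

lemma vertex_function:
  fixes v :: 'v
  defines "p \<equiv> (\<lambda>e. if src e = v then 1 else 0)" and "q \<equiv> (\<lambda>e. if tgt e = v then 1 else (0::real))"
  defines "x \<equiv> ((\<lambda>e t. p e + (q e - p e) / len e * t), (\<lambda>e (t::real). (q e - p e) / len e))"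
  shows "x \<in> V" and "fst x e 0 = p e" and "fst x e (len e) = q e"
proof -
  show x0: "fst x e 0 = p e" and xl: "fst x e (len e) = q e" for e
    using len_pos[of e] by (simp_all add: x_def)
  have end_eq: "at_endpt len (fst x) j = (if endpt src tgt j = v then 1 else 0)" for j
    by (cases "snd j") (simp_all add: at_endpt_def endpt_pos_def endpt_def x0 xl p_def q_def)
  show "x \<in> V"
  proof (rule H1_graphI)
    show "x \<in> H" unfolding H1_space_def mem_Collect_eq x_def fst_conv snd_conv
      by (rule allI) (rule weak_deriv_affine[OF len_nonneg])
    show "at_endpt len (fst x) j = at_endpt len (fst x) j'" if "endpt src tgt j = endpt src tgt j'" for j j'
      unfolding end_eq that by (rule refl)
  qed
qed

text \<open>Integrating the strong equation by parts against a test function and comparing with the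
  weak equation leaves only boundary terms. Their sum thus vanishes for every test function in
  \<open>V\<close>, and \<open>vertex_function\<close> turns this into the Kirchhoff
  condition.\<close>

lemma eigenpair_of_weak:
  assumes \<phi>: "\<phi> \<in> V" and eig: "\<And>h. h \<in> V \<Longrightarrow> E \<phi> h = \<mu> * B \<phi> h"
  shows "kirchhoff_eigenpair src tgt len \<kappa> a \<mu> (fst \<phi>)"
proof -
  obtain G where G0: "\<And>e. weak_deriv (len e) (fst \<phi> e) (G e)"
    "\<And>e. weak_deriv (len e) (\<lambda>t. a e t * G e t) (\<lambda>t. (\<kappa> e t)\<^sup>2 * fst \<phi> e t - \<mu> * fst \<phi> e t)"
    "\<And>e. H2_on (len e) (fst \<phi> e)" "\<And>e. AE t in Ivl (len e). snd \<phi> e t = G e t"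
    by (rule weak_eigen_regular[OF \<phi> eig]) (assumption, rule that)
  define w where "w = (\<lambda>e t. (\<kappa> e t)\<^sup>2 * fst \<phi> e t - \<mu> * fst \<phi> e t)"
  have wd: "weak_deriv (len e) (\<lambda>t. a e t * G e t) (w e)" for e unfolding w_def by (rule G0(2))
  note G = G0(1) wd G0(3,4)
  have \<phi>H: "\<phi> \<in> H" using V_H[OF \<phi>] .
  have bdry: "(\<Sum>e\<in>UNIV. a e (len e) * G e (len e) * fst h e (len e) - a e 0 * G e 0 * fst h e 0) = 0" if h: "h \<in> V" for h
  proof -
    have hH: "h \<in> H" using V_H[OF h] .
    have "a e (len e) * G e (len e) * fst h e (len e) - a e 0 * G e 0 * fst h e 0 =
      (LINT t|Ivl (len e). a e t * (snd \<phi> e t * snd h e t)) + (LINT t|Ivl (len e). (\<kappa> e t)\<^sup>2 * (fst \<phi> e t * fst h e t))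
       - \<mu> * (LINT t|Ivl (len e). fst \<phi> e t * fst h e t)" for e
    proof -
      have "(LINT t|Ivl (len e). w e t * fst h e t) + (LINT t|Ivl (len e). a e t * G e t * snd h e t) =
          a e (len e) * G e (len e) * fst h e (len e) - a e 0 * G e 0 * fst h e 0"
        by (rule integration_by_parts[OF G(2) H_weak_deriv[OF hH] len_nonneg])
      moreover have "(LINT t|Ivl (len e). a e t * G e t * snd h e t) = (LINT t|Ivl (len e). a e t * (snd \<phi> e t * snd h e t))"
      proof (rule integral_cong_AE)
        show "AE t in Ivl (len e). a e t * G e t * snd h e t = a e t * (snd \<phi> e t * snd h e t)"
          using G(4)[of e] by eventually_elim simp
        have [measurable]: "G e \<in> borel_measurable (Ivl (len e))" "snd h e \<in> borel_measurable (Ivl (len e))"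
          "snd \<phi> e \<in> borel_measurable (Ivl (len e))"
          using weak_deriv_in_L2[OF G(1)] H_in_L2(2)[OF hH] H_in_L2(2)[OF \<phi>H] by (simp_all add: in_L2_measurable)
        show "(\<lambda>t. a e t * G e t * snd h e t) \<in> borel_measurable (Ivl (len e))" by measurable
        show "(\<lambda>t. a e t * (snd \<phi> e t * snd h e t)) \<in> borel_measurable (Ivl (len e))" by measurable
      qed
      moreover have "(LINT t|Ivl (len e). w e t * fst h e t) = (LINT t|Ivl (len e). (\<kappa> e t)\<^sup>2 * (fst \<phi> e t * fst h e t)) - \<mu> * (LINT t|Ivl (len e). fst \<phi> e t * fst h e t)"
        using E_integrable[OF \<phi>H hH, of e] by (simp add: w_def left_diff_distrib mult.assoc)
      ultimately show ?thesis by linarith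
    qed
    then have "(\<Sum>e\<in>UNIV. a e (len e) * G e (len e) * fst h e (len e) - a e 0 * G e 0 * fst h e 0) = E \<phi> h - \<mu> * B \<phi> h"
      unfolding energy_split[OF \<phi>H hH] mass_def by (simp only: sum_subtractf sum_distrib_left)
    then show ?thesis using eig[OF h] by simp
  qed
  have kirch: "(\<Sum>e\<in>{e. src e = v}. G e 0) + (\<Sum>e\<in>{e. tgt e = v}. - G e (len e)) = 0" for v
  proof (cases "\<exists>j. endpt src tgt j = v")
    \<comment> \<open>The condition ranges over all of \<open>'v\<close>; at elements that are no
      vertices both sums are empty.\<close>
    case False
    have "src e \<noteq> v" "tgt e \<noteq> v" for e
      using False[unfolded not_ex, rule_format, of "(e, False)"] False[unfolded not_ex, rule_format, of "(e, True)"]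
      by (simp_all add: endpt_def)
    then show ?thesis by simp
  next
    case True
    then obtain j where j: "endpt src tgt j = v" by blast
    define A where "A = at_endpt len a j"
    have "0 < A"
      using a_bounds[of "endpt_pos len j" "fst j"] a0_pos by (auto simp: A_def at_endpt_def endpt_pos_def)
    have a_src: "a e 0 = A" if "src e = v" for e
      using a_vertex[of "(e, False)" j] j that by (simp add: endpt_def at_endpt_def endpt_pos_def A_def)
    have a_tgt: "a e (len e) = A" if "tgt e = v" for e
      using a_vertex[of "(e, True)" j] j that by (simp add: endpt_def at_endpt_def endpt_pos_def A_def)
    have "(\<Sum>e\<in>UNIV. a e (len e) * G e (len e) * (if tgt e = v then 1 else 0) - a e 0 * G e 0 * (if src e = v then 1 else 0)) = 0"
      using bdry[OF vertex_function(1)[of v]] unfolding vertex_function(2,3) .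
    moreover have "a e (len e) * G e (len e) * (if tgt e = v then 1 else 0) = (if tgt e = v then A * G e (len e) else 0)"
      "a e 0 * G e 0 * (if src e = v then 1 else 0) = (if src e = v then A * G e 0 else 0)" for e
      using a_src a_tgt by auto
    ultimately have "(\<Sum>e\<in>UNIV. if tgt e = v then A * G e (len e) else 0) - (\<Sum>e\<in>UNIV. if src e = v then A * G e 0 else 0) = 0"
      by (simp only: sum_subtractf)
    then have "A * ((\<Sum>e\<in>{e. src e = v}. G e 0) + (\<Sum>e\<in>{e. tgt e = v}. - G e (len e))) = 0"
      by (auto simp: sum.inter_filter[symmetric] sum_distrib_left[symmetric] sum_negf)
    then show ?thesis using \<open>0 < A\<close> by simp
  qed
  show ?thesis
    unfolding kirchhoff_eigenpair_def
  proof (intro conjI, goal_cases)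
    case 1 show ?case using G(3) by blast
  next
    case 2 show ?case using H1_graphD[OF \<phi>] by blast
  next
    case 3 show ?case
    proof (rule exI[of _ G], rule exI[of _ w], intro conjI allI)
    show "has_weak_deriv (len e) (fst \<phi> e) (G e)" "L2_on (len e) (G e)" for e
      using G(1)[of e, folded weak_deriv_iff] by simp_all
    show "has_weak_deriv (len e) (\<lambda>t. a e t * G e t) (w e)" "L2_on (len e) (w e)" for e
      using G(2)[of e, folded weak_deriv_iff] by simp_all
    show "AE t in lborel. t \<in> {0..len e} \<longrightarrow> - w e t + (\<kappa> e t)\<^sup>2 * fst \<phi> e t = \<mu> * fst \<phi> e t" for e
      by (simp add: w_def)
    show "(\<Sum>e | src e = v. G e 0) + (\<Sum>e | tgt e = v. - G e (len e)) = 0" for v by (rule kirch)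
    qed
  qed
qed

text \<open>Completeness must be lifted from \<open>V\<close> to L2. An \<open>f\<close> orthogonal
  to all eigenfunctions defines a bounded functional on \<open>V\<close> whose representer is
  orthogonal to the basis, so the functional is 0. Testing with bumps makes the primitive of
  \<open>f\<close> constant on each edge, and it starts at 0.\<close>

lemma eigenbasis_of_weak:
  assumes basis: "weak_eigenbasis lam \<Phi>"
  shows "eigenbasis src tgt len \<kappa> a lam (\<lambda>k. fst (\<Phi> k))"
  unfolding eigenbasis_def
proof (intro conjI allI impI)
  show "kirchhoff_eigenpair src tgt len \<kappa> a (lam k) (fst (\<Phi> k))" for k
    by (rule eigenpair_of_weak[OF \<Phi>_V[OF basis] \<Phi>_eigen[OF basis]])
  show "graph_inner len (fst (\<Phi> j)) (fst (\<Phi> k)) = (if j = k then 1 else 0)" for j k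
    unfolding graph_inner_mass by (rule \<Phi>_orthonormal[OF basis])
  fix f assume fL: "graph_L2 len f" and orth: "\<forall>k. graph_inner len f (fst (\<Phi> k)) = 0"
  have f: "in_L2 (len e) (f e)" for e using fL by (simp add: graph_L2_def L2_on_iff)
  interpret orthonormal_basis V E "\<psi> lam \<Phi>" by (rule \<psi>_basis[OF basis])
  define l where "l = (\<lambda>x::'e graph_fun \<times> 'e graph_fun. \<Sum>e\<in>UNIV. LINT t|Ivl (len e). f e t * fst x e t)"
  have l_add: "l (x + y) = l x + l y" if "x \<in> V" "y \<in> V" for x y
  proof -
    have int: "integrable (Ivl (len e)) (\<lambda>t. f e t * fst z e t)" if "z \<in> V" for z e
      by (rule in_L2_mult_integrable[OF f H_in_L2(1)[OF V_H[OF that]]])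
    show ?thesis
      unfolding l_def sum.distrib[symmetric]
      by (intro sum.cong refl) (simp add: distrib_left int that)
  qed
  have l_scale: "l (c *\<^sub>R x) = c * l x" for c x
    unfolding l_def by (simp add: sum_distrib_left mult.left_commute)
  have l_bound: "(l x)\<^sup>2 \<le> (real CARD('e) * (\<Sum>e\<in>UNIV. LINT t|Ivl (len e). (f e t)\<^sup>2) * (1 / \<kappa>0\<^sup>2)) * E x x" if x: "x \<in> V" for x
  proof -
    let ?F = "\<Sum>e\<in>UNIV. LINT t|Ivl (len e). (f e t)\<^sup>2"
    have edge: "(LINT t|Ivl (len e). f e t * fst x e t)\<^sup>2 \<le> ?F * (LINT t|Ivl (len e). (fst x e t)\<^sup>2)" for e
    proof -
      have "(LINT t|Ivl (len e). f e t * fst x e t)\<^sup>2 \<le> (LINT t|Ivl (len e). (f e t)\<^sup>2) * (LINT t|Ivl (len e). (fst x e t)\<^sup>2)"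
        by (rule L2_cauchy_schwarz[OF f H_in_L2(1)[OF V_H[OF x]]])
      also have "\<dots> \<le> ?F * (LINT t|Ivl (len e). (fst x e t)\<^sup>2)"
        by (intro mult_right_mono member_le_sum) auto
      finally show ?thesis .
    qed
    have "(l x)\<^sup>2 \<le> real CARD('e) * (\<Sum>e\<in>UNIV. (LINT t|Ivl (len e). f e t * fst x e t)\<^sup>2)"
      unfolding l_def using sum_squared_le_sum_of_squares[of "\<lambda>e. LINT t|Ivl (len e). f e t * fst x e t" "UNIV :: 'e set"] by (simp add: mult.commute)
    also have "\<dots> \<le> real CARD('e) * (\<Sum>e\<in>UNIV. ?F * (LINT t|Ivl (len e). (fst x e t)\<^sup>2))"
      by (intro mult_left_mono sum_mono edge) simp
    also have "\<dots> = (real CARD('e) * ?F) * B x x"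
      unfolding mass_def sum_distrib_left[of ?F, symmetric] by (simp only: power2_eq_square mult.assoc)
    also have "\<dots> \<le> (real CARD('e) * ?F) * ((1 / \<kappa>0\<^sup>2) * E x x)"
      by (intro mult_left_mono mass_le_energy V_H x mult_nonneg_nonneg sum_nonneg) auto
    finally show ?thesis by (simp only: mult.assoc)
  qed
  have l_basis: "l (\<Phi> k) = 0" for k using orth unfolding l_def graph_inner_eq by blast
  obtain r where r: "r \<in> V" "\<And>x. x \<in> V \<Longrightarrow> E r x = l x"
    by (rule riesz[of l, OF l_add l_scale l_bound]) (assumption+, rule that)
  have "E r r = 0"
  proof (rule maximal[OF r(1)])
    fix k
    have "E r (\<psi> lam \<Phi> k) = l (\<psi> lam \<Phi> k)" by (rule r(2)) (rule basis_in)
    then show "E r (\<psi> lam \<Phi> k) = 0" by (simp add: \<psi>_def[OF basis] l_scale l_basis)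
  qed
  then have l0: "l x = 0" if "x \<in> V" for x
    using null_left[OF r(1) that] r(2)[OF that] by simp
  have "AE t in Ivl (len e). f e t = 0" for e
  proof -
    have Fd: "weak_deriv (len e) (prim (len e) (f e)) (f e)" using weak_deriv_prim[OF f, of e 0] by simp
    have "AE t in Ivl (len e). prim (len e) (f e) t = (LINT t|Ivl (len e). prim (len e) (f e) t) / len e" (is "AE t in _. _ = ?c")
    proof (rule du_Bois_Reymond[OF len_pos weak_deriv_in_L2'[OF Fd]])
      fix q assume q: "in_L2 (len e) q" "(LINT t|Ivl (len e). q t) = 0"
      have Qd: "weak_deriv (len e) (prim (len e) q) q" using weak_deriv_prim[OF q(1), of 0] by simp
      have "l (bump len e q) = (\<Sum>e'\<in>UNIV. if e' = e then (LINT t|Ivl (len e). f e t * prim (len e) q t) else 0)"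
        unfolding l_def by (intro sum.cong refl) simp
      then have "(LINT t|Ivl (len e). f e t * prim (len e) q t) = 0"
        using l0[OF bump_V[OF q]] by simp
      then show "(LINT t|Ivl (len e). prim (len e) (f e) t * q t) = 0"
        using integration_by_parts[OF Fd Qd len_nonneg] q(2) by (simp add: prim_0 prim_full)
    qed
    then have "AE t in Ivl (len e). prim (len e) (f e) t - ?c = 0" by eventually_elim simp
    moreover have "continuous_on {0..len e} (\<lambda>t. prim (len e) (f e) t - ?c)"
      by (intro continuous_intros weak_deriv_continuous[OF Fd])
    ultimately have const: "prim (len e) (f e) t - ?c = 0" if "t \<in> {0..len e}" for t
      using continuous_AE_zero[OF _ len_pos _ that, of "\<lambda>t. prim (len e) (f e) t - ?c"] by simp
    have "?c = 0" using const[of 0] by (simp add: prim_0)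
    then show ?thesis using const by (intro weak_deriv_zero[OF Fd]) simp
  qed
  then show "graph_inner len f f = 0"
    unfolding graph_inner_eq by (intro sum.neutral ballI integral_eq_zero_AE) (auto elim: eventually_mono)
qed

end

text \<open>The eigenbasis hidden in a given edge field is arbitrary and in strong form. Neumann
  conditions remove the boundary terms of the integration by parts, which gives the weak
  form.\<close>

lemma weak_eigenbasis_of_interval:
  fixes l :: real and \<kappa> a :: "real \<Rightarrow> real"
  assumes coeffs: "graph_coeffs (\<lambda>_::unit. l) (\<lambda>_. \<kappa>) (\<lambda>_. a) \<kappa>0 C\<kappa> a0 Ca La"
    and eb: "eigenbasis (\<lambda>_::unit. False) (\<lambda>_. True) (\<lambda>_. l) (\<lambda>_. \<kappa>) (\<lambda>_. a) lam \<phi>"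
  obtains \<Phi> where "graph_form.weak_eigenbasis (\<lambda>_::unit. l) (\<lambda>_. \<kappa>) (\<lambda>_. a) (\<lambda>_. False) (\<lambda>_. True) lam \<Phi>"
    "\<And>k. fst (\<Phi> k) = \<phi> k"
proof -
  interpret graph_coeffs "\<lambda>_::unit. l" "\<lambda>_. \<kappa>" "\<lambda>_. a" \<kappa>0 C\<kappa> a0 Ca La by (rule coeffs)
  interpret graph_form "\<lambda>_::unit. l" "\<lambda>_. \<kappa>" "\<lambda>_. a" \<kappa>0 C\<kappa> a0 Ca La "\<lambda>_. False" "\<lambda>_. True" by unfold_locales
  have pair: "\<exists>g. (\<phi> k, g) \<in> V \<and> (\<forall>h\<in>V. E (\<phi> k, g) h = lam k * B (\<phi> k, g) h)" for k
  proof -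
    have "kirchhoff_eigenpair (\<lambda>_::unit. False) (\<lambda>_. True) (\<lambda>_. l) (\<lambda>_. \<kappa>) (\<lambda>_. a) (lam k) (\<phi> k)"
      using eb unfolding eigenbasis_def by blast
    then obtain g w where g: "\<And>e::unit. has_weak_deriv l (\<phi> k e) (g e)" "\<And>e. L2_on l (g e)"
      and w: "\<And>e. has_weak_deriv l (\<lambda>t. a t * g e t) (w e)" "\<And>e. L2_on l (w e)"
      and eq: "\<And>e. AE t in lborel. t \<in> {0..l} \<longrightarrow> - w e t + (\<kappa> t)\<^sup>2 * \<phi> k e t = lam k * \<phi> k e t"
      and K: "\<And>v. (\<Sum>e\<in>{e::unit. False = v}. g e 0) + (\<Sum>e\<in>{e::unit. True = v}. - g e l) = 0"
      unfolding kirchhoff_eigenpair_def by blast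
    have gd: "weak_deriv l (\<phi> k e) (g e)" and wd: "weak_deriv l (\<lambda>t. a t * g e t) (w e)" for e
      using g w unfolding weak_deriv_iff[symmetric] by blast+
    \<comment> \<open>Each vertex of the single edge meets exactly one endpoint, so one of the two
      sums is empty and the other has one term.\<close>
    have g0: "g e 0 = 0" "g e l = 0" for e
      using K[of False] K[of True] by (simp_all add: UNIV_unit)
    have V: "(\<phi> k, g) \<in> V"
    proof (rule H1_graphI)
      show "(\<phi> k, g) \<in> H" using gd by (simp add: H1_space_def)
      show "at_endpt (\<lambda>_. l) (fst (\<phi> k, g)) j = at_endpt (\<lambda>_. l) (fst (\<phi> k, g)) j'"
        if "endpt (\<lambda>_. False) (\<lambda>_. True) j = endpt (\<lambda>_. False) (\<lambda>_. True) j'" for j j' :: "unit \<times> bool"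
      proof -
        have "snd j = snd j'" using that by (simp add: endpt_def split: if_splits)
        then have "j = j'" by (simp add: prod_eq_iff)
        then show ?thesis by simp
      qed
    qed
    have "E (\<phi> k, g) h = lam k * B (\<phi> k, g) h" if h: "h \<in> V" for h
    proof -
      have hd: "weak_deriv l (fst h ()) (snd h ())" using H_weak_deriv[OF V_H[OF h]] .
      have int: "integrable (Ivl l) (\<lambda>t. (\<kappa> t)\<^sup>2 * (\<phi> k () t * fst h () t))" "integrable (Ivl l) (\<lambda>t. w () t * fst h () t)"
        using E_integrable(2)[OF V_H[OF V] V_H[OF h]] in_L2_mult_integrable[OF weak_deriv_in_L2[OF wd] weak_deriv_in_L2'[OF hd]] by simp_all
      have "(LINT t|Ivl l. w () t * fst h () t) + (LINT t|Ivl l. a t * g () t * snd h () t) = 0"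
        using integration_by_parts[OF wd hd len_nonneg] g0 by simp
      moreover have "E (\<phi> k, g) h = (LINT t|Ivl l. a t * g () t * snd h () t) + (LINT t|Ivl l. (\<kappa> t)\<^sup>2 * (\<phi> k () t * fst h () t))"
        unfolding energy_split[OF V_H[OF V] V_H[OF h]] by (simp add: UNIV_unit mult.assoc)
      moreover have "(LINT t|Ivl l. (\<kappa> t)\<^sup>2 * (\<phi> k () t * fst h () t)) - (LINT t|Ivl l. w () t * fst h () t) = lam k * (LINT t|Ivl l. \<phi> k () t * fst h () t)"
      proof -
        have "(LINT t|Ivl l. (\<kappa> t)\<^sup>2 * (\<phi> k () t * fst h () t)) - (LINT t|Ivl l. w () t * fst h () t)
          = (LINT t|Ivl l. (\<kappa> t)\<^sup>2 * (\<phi> k () t * fst h () t) - w () t * fst h () t)"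
          using int by simp
        also have "\<dots> = (LINT t|Ivl l. lam k * (\<phi> k () t * fst h () t))"
        proof (rule integral_cong_AE)
          show "AE t in Ivl l. (\<kappa> t)\<^sup>2 * (\<phi> k () t * fst h () t) - w () t * fst h () t = lam k * (\<phi> k () t * fst h () t)"
            using eq[of "()", folded AE_Ivl]
          proof eventually_elim
            case (elim t)
            have "(\<kappa> t)\<^sup>2 * (\<phi> k () t * fst h () t) - w () t * fst h () t = (- w () t + (\<kappa> t)\<^sup>2 * \<phi> k () t) * fst h () t"
              by (simp add: algebra_simps)
            then show ?case unfolding elim by (simp only: mult.assoc)
          qed
          show "(\<lambda>t. (\<kappa> t)\<^sup>2 * (\<phi> k () t * fst h () t) - w () t * fst h () t) \<in> borel_measurable (Ivl l)"
            using int by measurable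
          show "(\<lambda>t. lam k * (\<phi> k () t * fst h () t)) \<in> borel_measurable (Ivl l)"
            using E_integrable(3)[OF V_H[OF V] V_H[OF h], of "()"] by simp
        qed
        finally show ?thesis by simp
      qed
      moreover have "B (\<phi> k, g) h = (LINT t|Ivl l. \<phi> k () t * fst h () t)"
        by (simp add: mass_def UNIV_unit)
      ultimately show ?thesis by simp
    qed
    with V show ?thesis by blast
  qed
  from choice[OF allI[OF this]] obtain g where g: "\<forall>k. (\<phi> k, g k) \<in> V \<and> (\<forall>h\<in>V. E (\<phi> k, g k) h = lam k * B (\<phi> k, g k) h)" ..
  define \<Phi> where "\<Phi> = (\<lambda>k. (\<phi> k, g k))"
  have fst_eq: "fst (\<Phi> k) = \<phi> k" for k by (simp add: \<Phi>_def)
  have "weak_eigenbasis lam \<Phi>"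
    unfolding weak_eigenbasis_def
  proof (intro conjI allI ballI impI)
    show "\<Phi> k \<in> V" for k using g unfolding \<Phi>_def by blast
    show "E (\<Phi> k) h = lam k * B (\<Phi> k) h" if "h \<in> V" for k h using g that unfolding \<Phi>_def by blast
    show "B (\<Phi> j) (\<Phi> k) = (if j = k then 1 else 0)" for j k
      unfolding graph_inner_mass[symmetric] fst_eq using eb unfolding eigenbasis_def by blast
    fix x assume x: "x \<in> V" and "\<forall>k. B x (\<Phi> k) = 0"
    from this(2) have "\<forall>k. graph_inner (\<lambda>_. l) (fst x) (\<phi> k) = 0" unfolding graph_inner_mass[symmetric] fst_eq .
    moreover have "graph_L2 (\<lambda>_. l) (fst x)" using H_in_L2(1)[OF V_H[OF x]] by (simp add: graph_L2_def L2_on_iff)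
    ultimately have "graph_inner (\<lambda>_. l) (fst x) (fst x) = 0" using eb unfolding eigenbasis_def by blast
    then show "B x x = 0" by (simp add: graph_inner_mass)
  qed
  then show thesis using fst_eq by (rule that)
qed

section \<open>The law of a field in terms of representers\<close>

context graph_form
begin

context
  fixes lam \<Phi> assumes basis: "weak_eigenbasis lam \<Phi>"
begin

lemma \<psi>_eval: "fst (\<psi> lam \<Phi> k) e t = lam k powr (-1/2) * fst (\<Phi> k) e t"
proof -
  have "lam k powr (-1/2) = 1 / sqrt (lam k)"
    using lam_pos[OF basis, of k] by (simp add: powr_minus powr_half_sqrt inverse_eq_divide)
  then show ?thesis by (simp add: \<psi>_def[OF basis])
qed

text \<open>The k-th coefficient of the combined series is
  \<open>E x (\<psi> lam \<Phi> k) / \<tau>\<close>, so this is Parseval. The value no longer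
  mentions the eigenbasis, which makes fields over different bases comparable.\<close>

lemma field_coefficients:
  fixes c :: "'i \<Rightarrow> real"
  assumes "finite I" and r: "\<And>i. i \<in> I \<Longrightarrow> r i \<in> V \<and> (\<forall>x\<in>V. E (r i) x = fst x (pe i) (pt i))"
  defines "x \<equiv> \<Sum>i\<in>I. c i *\<^sub>R r i"
  shows "(\<lambda>k. (\<Sum>i\<in>I. c i * (lam k powr (-1/2) * fst (\<Phi> k) (pe i) (pt i) / \<tau>))\<^sup>2) sums (E x x / \<tau>\<^sup>2)"
proof -
  interpret orthonormal_basis V E "\<psi> lam \<Phi>" by (rule \<psi>_basis[OF basis])
  have x: "x \<in> V" unfolding x_def using r by (intro V_sum V_scale) blast
  have "E x (\<psi> lam \<Phi> k) = (\<Sum>i\<in>I. c i * (lam k powr (-1/2) * fst (\<Phi> k) (pe i) (pt i)))" for k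
  proof -
    have "E x (\<psi> lam \<Phi> k) = (\<Sum>i\<in>I. E (c i *\<^sub>R r i) (\<psi> lam \<Phi> k))"
      unfolding x_def using r by (intro sum_left V_scale) auto
    also have "\<dots> = (\<Sum>i\<in>I. c i * (lam k powr (-1/2) * fst (\<Phi> k) (pe i) (pt i)))"
    proof (rule sum.cong[OF refl])
      fix i assume i: "i \<in> I"
      have "E (c i *\<^sub>R r i) (\<psi> lam \<Phi> k) = c i * E (r i) (\<psi> lam \<Phi> k)" using r[OF i] by (intro scale_left) auto
      also have "E (r i) (\<psi> lam \<Phi> k) = fst (\<psi> lam \<Phi> k) (pe i) (pt i)" using r[OF i] basis_in[of k] by blast
      finally show "E (c i *\<^sub>R r i) (\<psi> lam \<Phi> k) = c i * (lam k powr (-1/2) * fst (\<Phi> k) (pe i) (pt i))"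
        by (simp only: \<psi>_eval)
    qed
    finally show ?thesis .
  qed
  then have "(\<Sum>i\<in>I. c i * (lam k powr (-1/2) * fst (\<Phi> k) (pe i) (pt i) / \<tau>))\<^sup>2 = (E x (\<psi> lam \<Phi> k))\<^sup>2 / \<tau>\<^sup>2" for k
    by (simp only: times_divide_eq_right sum_divide_distrib[symmetric] power_divide)
  then show ?thesis using sums_divide[OF parseval[OF x x], of "\<tau>\<^sup>2"] by (simp add: power2_eq_square)
qed

lemma field_char:
  fixes c :: "'i \<Rightarrow> real"
  assumes \<xi>: "gauss_seq M \<xi>" and I: "finite I"
    and r: "\<And>i. i \<in> I \<Longrightarrow> r i \<in> V \<and> (\<forall>x\<in>V. E (r i) x = fst x (pe i) (pt i))"
    and X: "\<And>i. i \<in> I \<Longrightarrow> X i \<in> borel_measurable M"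
    and lim: "\<And>i. i \<in> I \<Longrightarrow> AE \<omega> in M. (\<lambda>n. \<Sum>k<n. lam k powr (-1/2) * \<xi> k \<omega> * fst (\<Phi> k) (pe i) (pt i) / \<tau>) \<longlonglongrightarrow> X i \<omega>"
  defines "x \<equiv> \<Sum>i\<in>I. c i *\<^sub>R r i"
  shows "char (distr M borel (\<lambda>\<omega>. \<Sum>i\<in>I. c i * X i \<omega>)) 1 = complex_of_real (exp (- (E x x / \<tau>\<^sup>2) / 2))"
proof (rule gauss_seq.char_series[OF \<xi>])
  show "(\<lambda>\<omega>. \<Sum>i\<in>I. c i * X i \<omega>) \<in> borel_measurable M"
    using X by (intro borel_measurable_sum borel_measurable_times) auto
  let ?b = "\<lambda>k. \<Sum>i\<in>I. c i * (lam k powr (-1/2) * fst (\<Phi> k) (pe i) (pt i) / \<tau>)"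
  show "(\<lambda>k. (?b k)\<^sup>2) sums (E x x / \<tau>\<^sup>2)" unfolding x_def by (rule field_coefficients[OF I r])
  have "AE \<omega> in M. \<forall>i\<in>I. (\<lambda>n. \<Sum>k<n. lam k powr (-1/2) * \<xi> k \<omega> * fst (\<Phi> k) (pe i) (pt i) / \<tau>) \<longlonglongrightarrow> X i \<omega>"
    using I lim by (intro AE_finite_allI) auto
  then show "AE \<omega> in M. (\<lambda>n. \<Sum>k<n. ?b k * \<xi> k \<omega>) \<longlonglongrightarrow> (\<Sum>i\<in>I. c i * X i \<omega>)"
  proof eventually_elim
    case (elim \<omega>)
    have "(\<lambda>n. \<Sum>i\<in>I. c i * (\<Sum>k<n. lam k powr (-1/2) * \<xi> k \<omega> * fst (\<Phi> k) (pe i) (pt i) / \<tau>)) \<longlonglongrightarrow> (\<Sum>i\<in>I. c i * X i \<omega>)"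
      using elim by (intro tendsto_sum tendsto_mult tendsto_const) blast
    moreover have "(\<Sum>k<n. ?b k * \<xi> k \<omega>) = (\<Sum>i\<in>I. c i * (\<Sum>k<n. lam k powr (-1/2) * \<xi> k \<omega> * fst (\<Phi> k) (pe i) (pt i) / \<tau>))" for n
      unfolding sum_distrib_right sum_distrib_left
      by (subst sum.swap) (intro sum.cong refl, simp add: mult.assoc mult.left_commute mult.commute)
    ultimately show ?case by (simp only:)
  qed
qed

end

end

section \<open>Isonormal families and conditioning\<close>

lemma sum_UNIV_option: "(\<Sum>i\<in>UNIV. f (i :: 'r::finite option)) = f None + (\<Sum>r\<in>UNIV. f (Some r))"
  by (simp add: UNIV_option_conv sum.reindex)

text \<open>Writing the law as an image of the standard normal law covers the degenerate case
  \<open>q = 0\<close>, where there is no density.\<close>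

lemma (in prob_space) normal_of_char:
  assumes X [measurable]: "X \<in> borel_measurable M" and q: "0 \<le> q"
    and char: "\<And>t. char (distr M borel X) t = complex_of_real (exp (- (t\<^sup>2 * q) / 2))"
  shows "distr M borel X = distr std_normal_distribution borel (\<lambda>x. sqrt q * x)"
proof (rule Levy_uniqueness)
  interpret S: prob_space std_normal_distribution by (rule prob_space_normal_density) simp
  show "real_distribution (distr M borel X)" by (rule real_distribution_distr) simp
  show "real_distribution (distr std_normal_distribution borel (\<lambda>x. sqrt q * x))"
    by (rule S.real_distribution_distr) simp
  show "char (distr M borel X) = char (distr std_normal_distribution borel (\<lambda>x. sqrt q * x))"
  proof
    fix t
    have "char (distr std_normal_distribution borel (\<lambda>x. sqrt q * x)) t = char std_normal_distribution (t * sqrt q)"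
      unfolding char_def by (subst integral_distr) (simp_all add: mult.assoc)
    also have "\<dots> = complex_of_real (exp (- (t\<^sup>2 * q) / 2))"
      using q by (simp add: char_std_normal_distribution power_mult_distrib)
    finally show "char (distr M borel X) t = char (distr std_normal_distribution borel (\<lambda>x. sqrt q * x)) t"
      using char by simp
  qed
qed

lemma (in prob_space) trig_of_char:
  assumes [measurable]: "X \<in> borel_measurable M" and char: "char (distr M borel X) 1 = complex_of_real c"
  shows "(LINT \<omega>|M. cos (X \<omega>)) = c" "(LINT \<omega>|M. sin (X \<omega>)) = 0"
proof -
  have "complex_of_real (LINT \<omega>|M. cos (X \<omega>)) + \<i> * complex_of_real (LINT \<omega>|M. sin (X \<omega>)) = complex_of_real c"
    using char_cos_sin[of X 1] char by simp
  from arg_cong[OF this, of Re] arg_cong[OF this, of Im]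
  show "(LINT \<omega>|M. cos (X \<omega>)) = c" "(LINT \<omega>|M. sin (X \<omega>)) = 0" by simp_all
qed

text \<open>\<open>L\<close> is a linear relation and not a map, so vectors that differ by a null
  vector and variables that are almost surely equal need not be identified. The argument 1 in
  \<open>L_char\<close> suffices because \<open>L\<close> is closed under scaling.\<close>

locale isonormal = prob_space M + psd_form H E
  for M :: "'w measure" and H :: "'h::real_vector set" and E +
  fixes L :: "(('w \<Rightarrow> real) \<times> 'h) set" and \<sigma> :: real
  assumes L_subspace: "subspace L" and \<sigma>_nonneg: "0 \<le> \<sigma>"
    and L_meas: "(X, x) \<in> L \<Longrightarrow> X \<in> borel_measurable M"
    and L_H: "(X, x) \<in> L \<Longrightarrow> x \<in> H"
    and L_char: "(X, x) \<in> L \<Longrightarrow> char (distr M borel X) 1 = complex_of_real (exp (- (\<sigma> * E x x) / 2))"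
begin

lemma L_scale: "(X, x) \<in> L \<Longrightarrow> (\<lambda>\<omega>. c * X \<omega>, c *\<^sub>R x) \<in> L"
  using subspace_scale[OF L_subspace, of "(X, x)" c] by (simp add: scaleR_fun_def)

lemma L_add: "(X, x) \<in> L \<Longrightarrow> (Y, y) \<in> L \<Longrightarrow> (\<lambda>\<omega>. X \<omega> + Y \<omega>, x + y) \<in> L"
  using subspace_add[OF L_subspace, of "(X, x)" "(Y, y)"] by (simp add: plus_fun_def)

lemma L_diff: "(X, x) \<in> L \<Longrightarrow> (Y, y) \<in> L \<Longrightarrow> (\<lambda>\<omega>. X \<omega> - Y \<omega>, x - y) \<in> L"
  using L_add[OF _ L_scale[of Y y "-1"]] by simp

lemma L_zero: "(\<lambda>\<omega>. 0, 0) \<in> L"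
  using subspace_0[OF L_subspace] by (simp add: zero_prod_def zero_fun_def)

lemma L_sum:
  assumes "\<And>i. i \<in> I \<Longrightarrow> (X i, x i) \<in> L"
  shows "(\<lambda>\<omega>. \<Sum>i\<in>I. c i * X i \<omega>, \<Sum>i\<in>I. c i *\<^sub>R x i) \<in> L"
  using assms
proof (induction I rule: infinite_finite_induct)
  case (insert i I)
  have "(\<lambda>\<omega>. c i * X i \<omega> + (\<Sum>i\<in>I. c i * X i \<omega>), c i *\<^sub>R x i + (\<Sum>i\<in>I. c i *\<^sub>R x i)) \<in> L"
    by (intro L_add L_scale insert.IH insert.prems) auto
  then show ?case using insert.hyps by simp
qed (simp_all add: L_zero)

lemma L_normal:
  assumes X: "(X, x) \<in> L"
  shows "distr M borel X = distr std_normal_distribution borel (\<lambda>r. sqrt (\<sigma> * E x x) * r)"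
proof (rule normal_of_char[OF L_meas[OF X]])
  note [measurable] = L_meas[OF X]
  show "0 \<le> \<sigma> * E x x" using \<sigma>_nonneg nonneg[OF L_H[OF X]] by simp
  fix t
  have "char (distr M borel X) t = char (distr M borel (\<lambda>\<omega>. t * X \<omega>)) 1"
    unfolding char_def by (subst (1 2) integral_distr) simp_all
  also have "\<dots> = complex_of_real (exp (- (\<sigma> * E (t *\<^sub>R x) (t *\<^sub>R x)) / 2))" by (rule L_char[OF L_scale[OF X]])
  also have "\<sigma> * E (t *\<^sub>R x) (t *\<^sub>R x) = t\<^sup>2 * (\<sigma> * E x x)"
    using L_H[OF X] by (simp add: scale_left scale_right power2_eq_square)
  finally show "char (distr M borel X) t = complex_of_real (exp (- (t\<^sup>2 * (\<sigma> * E x x)) / 2))" .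
qed

lemma L_integrable: assumes X: "(X, x) \<in> L" shows "integrable M X"
proof -
  note [measurable] = L_meas[OF X]
  have "integrable std_normal_distribution (\<lambda>r. sqrt (\<sigma> * E x x) * r)"
    using integrable_std_normal_distribution_moment[of 1] by simp
  then have "integrable (distr std_normal_distribution borel (\<lambda>r. sqrt (\<sigma> * E x x) * r)) (\<lambda>r. r)"
    by (subst integrable_distr_eq) simp_all
  then show ?thesis unfolding L_normal[OF X, symmetric] by (subst (asm) integrable_distr_eq) simp_all
qed

lemma L_null: assumes X: "(X, x) \<in> L" and 0: "E x x = 0" shows "AE \<omega> in M. X \<omega> = 0"
proof -
  note [measurable] = L_meas[OF X]
  have "AE r in distr std_normal_distribution borel (\<lambda>r. sqrt (\<sigma> * E x x) * r). r = 0"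
    by (subst AE_distr_iff) (simp_all add: 0)
  then show ?thesis unfolding L_normal[OF X, symmetric] by (subst (asm) AE_distr_iff) simp_all
qed

lemma L_trig:
  assumes X: "(X, x) \<in> L"
  shows "(LINT \<omega>|M. cos (X \<omega>)) = exp (- (\<sigma> * E x x) / 2)" "(LINT \<omega>|M. sin (X \<omega>)) = 0"
  using trig_of_char[OF L_meas[OF X] L_char[OF X]] by simp_all

text \<open>The residual \<open>R\<close> is orthogonal to all \<open>m r\<close>, so \<open>(R, Z)\<close> and \<open>(- R, Z)\<close> have the same law;
  hence \<open>R\<close> integrates to zero over every event determined by \<open>Z\<close>.\<close>

lemma residual_integral:
  fixes Z :: "'r::finite \<Rightarrow> 'w \<Rightarrow> real"
  assumes Z: "\<And>r. (Z r, m r) \<in> L" and R: "(R, \<pi>) \<in> L" and orth: "\<And>r. E \<pi> (m r) = 0"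
    and A [measurable]: "A \<in> sets (PiM UNIV (\<lambda>_::'r. borel))"
  shows "(LINT \<omega>|M. R \<omega> * indicator A (\<lambda>r. Z r \<omega>)) = 0"
proof -
  note [measurable] = L_meas[OF R] L_meas[OF Z]
  \<comment> \<open>\<open>None\<close> carries the residual with the sign \<open>s\<close>, the
    other indices carry the conditioning variables; the families for \<open>s\<close> = 1 and
    \<open>s\<close> = -1 are to be compared.\<close>
  define X where "X = (\<lambda>s i. case i of None \<Rightarrow> (\<lambda>\<omega>. s * R \<omega>) | Some r \<Rightarrow> Z r)"
  have X_meas [measurable]: "X s i \<in> borel_measurable M" for s i by (cases i) (simp_all add: X_def)
  have \<pi>: "\<pi> \<in> H" and m: "m r \<in> H" for r using L_H R Z by blast+
  have comb: "(\<lambda>\<omega>. \<Sum>i\<in>UNIV. c i * X s i \<omega>, (c None * s) *\<^sub>R \<pi> + (\<Sum>r\<in>UNIV. c (Some r) *\<^sub>R m r)) \<in> L" for c s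
  proof -
    have "(\<lambda>\<omega>. (c None * s) * R \<omega> + (\<Sum>r\<in>UNIV. c (Some r) * Z r \<omega>), (c None * s) *\<^sub>R \<pi> + (\<Sum>r\<in>UNIV. c (Some r) *\<^sub>R m r)) \<in> L"
      by (intro L_add L_scale R L_sum Z)
    then show ?thesis by (simp add: sum_UNIV_option X_def mult.assoc)
  qed
  \<comment> \<open>The sign enters only through its square, since \<open>\<pi>\<close> is
    orthogonal to every combination of the \<open>m r\<close>.\<close>
  have energy: "E ((c * s) *\<^sub>R \<pi> + y) ((c * s) *\<^sub>R \<pi> + y) = c\<^sup>2 * E \<pi> \<pi> + E y y"
    if s: "s * s = 1" and y: "y = (\<Sum>r\<in>UNIV. d r *\<^sub>R m r)" for c s y d
  proof -
    have yH: "y \<in> H" unfolding y using m by (intro V_sum V_scale)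
    have "E \<pi> y = (\<Sum>r\<in>UNIV. E \<pi> (d r *\<^sub>R m r))" unfolding y using m \<pi> by (intro sum_right V_scale) auto
    also have "\<dots> = 0" using orth m \<pi> by (simp add: scale_right)
    finally have 0: "E \<pi> y = 0" .
    have "c * s * (c * s) = c\<^sup>2" using s by (simp add: power2_eq_square mult.assoc mult.left_commute)
    then show ?thesis using \<pi> yH 0 by (simp add: square_add scale_left scale_right mult.assoc[symmetric])
  qed
  have law: "distr M (PiM UNIV (\<lambda>_. borel)) (\<lambda>\<omega>. \<lambda>i\<in>UNIV. X 1 i \<omega>) = distr M (PiM UNIV (\<lambda>_. borel)) (\<lambda>\<omega>. \<lambda>i\<in>UNIV. X (-1) i \<omega>)"
  proof (rule law_eqI_trig)
    fix c :: "'r option \<Rightarrow> real"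
    show "(LINT \<omega>|M. cos (\<Sum>i\<in>UNIV. c i * X 1 i \<omega>)) = (LINT \<omega>|M. cos (\<Sum>i\<in>UNIV. c i * X (-1) i \<omega>))"
      unfolding L_trig(1)[OF comb] by (subst (1 2) energy) simp_all
    show "(LINT \<omega>|M. sin (\<Sum>i\<in>UNIV. c i * X 1 i \<omega>)) = (LINT \<omega>|M. sin (\<Sum>i\<in>UNIV. c i * X (-1) i \<omega>))"
      unfolding L_trig(2)[OF comb] by (rule refl)
  qed (simp_all add: prob_space_axioms)
  define h where "h = (\<lambda>v :: 'r option \<Rightarrow> real. v None * indicator A (\<lambda>r. v (Some r)))"
  have [measurable]: "(\<lambda>v r. v (Some r)) \<in> PiM UNIV (\<lambda>_::'r option. borel :: real measure) \<rightarrow>\<^sub>M PiM UNIV (\<lambda>_::'r. borel)"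
    by (rule measurable_abs_UNIV) simp
  have h [measurable]: "h \<in> borel_measurable (PiM UNIV (\<lambda>_. borel))" unfolding h_def by measurable
  have "(LINT v|distr M (PiM UNIV (\<lambda>_. borel)) (\<lambda>\<omega>. \<lambda>i\<in>UNIV. X s i \<omega>). h v) = (LINT \<omega>|M. s * R \<omega> * indicator A (\<lambda>r. Z r \<omega>))" for s
  proof -
    have [measurable]: "(\<lambda>\<omega>. \<lambda>i\<in>UNIV. X s i \<omega>) \<in> M \<rightarrow>\<^sub>M PiM UNIV (\<lambda>_. borel)" by (rule measurable_restrict) simp
    show ?thesis by (subst integral_distr) (simp, rule h, simp add: h_def X_def)
  qed
  from this[of 1] this[of "-1"] law
  have "(LINT \<omega>|M. R \<omega> * indicator A (\<lambda>r. Z r \<omega>)) = (LINT \<omega>|M. - (R \<omega> * indicator A (\<lambda>r. Z r \<omega>)))" by simp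
  then show ?thesis by simp
qed

text \<open>The combination of the \<open>Z r\<close> is measurable for the algebra that they
  generate, and by \<open>residual_integral\<close> it has the same integrals as \<open>X\<close>
  over all sets of that algebra. Any solution \<open>\<gamma>\<close> of the normal equations will
  do, unique or not.\<close>

theorem conditional_expectation:
  fixes Z :: "'r::finite \<Rightarrow> 'w \<Rightarrow> real"
  assumes Z: "\<And>r. (Z r, m r) \<in> L" and X: "(X, x) \<in> L"
    and orth: "\<And>r. E (x - (\<Sum>s\<in>UNIV. \<gamma> s *\<^sub>R m s)) (m r) = 0"
  shows "AE \<omega> in M. real_cond_exp M (vimage_algebra (space M) (\<lambda>\<omega> r. Z r \<omega>) (PiM UNIV (\<lambda>_. borel))) X \<omega> = (\<Sum>r\<in>UNIV. \<gamma> r * Z r \<omega>)"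
proof -
  note [measurable] = L_meas[OF X] L_meas[OF Z]
  let ?P = "PiM UNIV (\<lambda>_::'r. borel :: real measure)"
  let ?Z = "\<lambda>\<omega> r. Z r \<omega>"
  define F where "F = vimage_algebra (space M) ?Z ?P"
  have Z_meas [measurable]: "?Z \<in> M \<rightarrow>\<^sub>M ?P" by (rule measurable_abs_UNIV) simp
  have sp: "?Z \<in> space M \<rightarrow> space ?P" using Z_meas by (rule measurable_space[THEN Pi_I])
  have sets_F: "sets F = {?Z -` A \<inter> space M |A. A \<in> sets ?P}"
    unfolding F_def by (rule sets_vimage_algebra2[OF sp])
  have "subalgebra M F"
    unfolding subalgebra_def
  proof
    show "space F = space M" by (simp add: F_def)
    show "sets F \<subseteq> sets M" unfolding sets_F using measurable_sets[OF Z_meas] by blast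
  qed
  then interpret S: finite_measure_subalgebra M F by unfold_locales
  define g where "g = (\<lambda>\<omega>. \<Sum>r\<in>UNIV. \<gamma> r * Z r \<omega>)"
  have g_L: "(g, \<Sum>r\<in>UNIV. \<gamma> r *\<^sub>R m r) \<in> L" unfolding g_def by (intro L_sum Z)
  have "?Z \<in> F \<rightarrow>\<^sub>M ?P" unfolding F_def by (rule measurable_vimage_algebra1[OF sp])
  from measurable_compose[OF this measurable_component_singleton[of _ UNIV "\<lambda>_. borel"]]
  have [measurable]: "Z r \<in> borel_measurable F" for r by simp
  have "AE \<omega> in M. real_cond_exp M F X \<omega> = g \<omega>"
  proof (rule S.real_cond_exp_charact)
    show "integrable M X" by (rule L_integrable[OF X])
    show "integrable M g" by (rule L_integrable[OF g_L])
    show "g \<in> borel_measurable F" unfolding g_def by measurable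
    fix A assume "A \<in> sets F"
    then obtain C where C: "C \<in> sets ?P" and A: "A = ?Z -` C \<inter> space M" unfolding sets_F by blast
    have "(LINT \<omega>|M. (X \<omega> - g \<omega>) * indicator C (?Z \<omega>)) = 0"
      by (rule residual_integral[OF Z L_diff[OF X g_L] orth C])
    moreover have "(LINT \<omega>|M. (X \<omega> - g \<omega>) * indicator C (?Z \<omega>)) = (LINT \<omega>|M. indicator A \<omega> *\<^sub>R X \<omega> - indicator A \<omega> *\<^sub>R g \<omega>)"
      by (intro Bochner_Integration.integral_cong) (auto simp: A indicator_def)
    moreover have "(LINT \<omega>|M. indicator A \<omega> *\<^sub>R X \<omega> - indicator A \<omega> *\<^sub>R g \<omega>) = (LINT \<omega>:A|M. X \<omega>) - (LINT \<omega>:A|M. g \<omega>)"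
      unfolding set_lebesgue_integral_def A using measurable_sets[OF Z_meas C]
      by (intro Bochner_Integration.integral_diff integrable_mult_indicator L_integrable[OF X] L_integrable[OF g_L])
    ultimately show "(LINT \<omega>:A|M. X \<omega>) = (LINT \<omega>:A|M. g \<omega>)" by simp
  qed
  then show ?thesis by (simp only: F_def g_def)
qed

end

lemma gauss_seq_space: "gauss_seq gauss_seq_space (\<lambda>k \<omega>. \<omega> k)"
proof -
  interpret S: prob_space std_normal_distribution by (rule prob_space_normal_density) simp
  interpret P: product_prob_space "\<lambda>_::nat. std_normal_distribution" UNIV ..
  have sets: "sets gauss_seq_space = sets (PiM UNIV (\<lambda>_::nat. borel))"
    unfolding gauss_seq_space_def by (intro sets_PiM_cong) simp_all
  have prob: "prob_space gauss_seq_space" unfolding gauss_seq_space_def by (rule P.prob_space_axioms)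
  interpret G: prob_space gauss_seq_space by (rule prob)
  have [measurable]: "(\<lambda>\<omega>. \<omega> k) \<in> borel_measurable gauss_seq_space" for k :: nat
    unfolding measurable_cong_sets[OF sets refl] by measurable
  have std: "distr gauss_seq_space borel (\<lambda>\<omega>. \<omega> k) = std_normal_distribution" for k
  proof -
    have "distr gauss_seq_space borel (\<lambda>\<omega>. \<omega> k) = distr gauss_seq_space std_normal_distribution (\<lambda>\<omega>. \<omega> k)"
      by (intro distr_cong) simp_all
    then show ?thesis unfolding gauss_seq_space_def by (simp add: P.PiM_component)
  qed
  have "G.indep_vars (\<lambda>_. borel) (\<lambda>k \<omega>. \<omega> k) (UNIV :: nat set)"
  proof (subst G.indep_vars_iff_distr_eq_PiM)
    have "distr gauss_seq_space (PiM UNIV (\<lambda>_. borel)) (\<lambda>x. \<lambda>i\<in>UNIV. x i) = distr gauss_seq_space gauss_seq_space (\<lambda>x. x)"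
      by (intro distr_cong) (simp_all add: sets restrict_def)
    also have "\<dots> = gauss_seq_space" by (rule distr_id)
    also have "\<dots> = PiM UNIV (\<lambda>i. distr gauss_seq_space borel (\<lambda>\<omega>. \<omega> i))"
      unfolding std by (simp only: gauss_seq_space_def)
    finally show "distr gauss_seq_space (PiM UNIV (\<lambda>_. borel)) (\<lambda>x. \<lambda>i\<in>UNIV. x i) = PiM UNIV (\<lambda>i. distr gauss_seq_space borel (\<lambda>\<omega>. \<omega> i))" .
  qed simp_all
  then show ?thesis using std by (intro gauss_seq.intro gauss_seq_axioms.intro prob)
qed

section \<open>Independent fields on the edges\<close>

definition edge_part :: "'e \<Rightarrow> 'e graph_fun \<times> 'e graph_fun \<Rightarrow> unit graph_fun \<times> unit graph_fun" where
  "edge_part e x = ((\<lambda>_. fst x e), (\<lambda>_. snd x e))"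

definition extend :: "'e \<Rightarrow> unit graph_fun \<times> unit graph_fun \<Rightarrow> 'e graph_fun \<times> 'e graph_fun" where
  "extend e y = ((\<lambda>e' t. if e' = e then fst y () t else 0), (\<lambda>e' t. if e' = e then snd y () t else 0))"

lemma edge_part_extend: "edge_part e' (extend e y) = (if e' = e then y else 0)"
  by (cases "e' = e") (simp_all add: edge_part_def extend_def prod_eq_iff fun_eq_iff)

lemma edge_part_sum: "edge_part e (\<Sum>i\<in>I. x i) = (\<Sum>i\<in>I. edge_part e (x i))"
  by (simp add: edge_part_def prod_eq_iff fun_eq_iff fst_sum snd_sum sum_fun_apply)

lemma edge_part_scale: "edge_part e (c *\<^sub>R x) = c *\<^sub>R edge_part e x"
  by (simp add: edge_part_def prod_eq_iff fun_eq_iff)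

lemma edge_part_H1: "x \<in> H1_space len \<Longrightarrow> edge_part e x \<in> H1_space (\<lambda>_. len e)"
  by (simp add: H1_space_def edge_part_def)

lemma extend_H1: assumes "y \<in> H1_space (\<lambda>_. len e)" shows "extend e y \<in> H1_space len"
  unfolding H1_space_def mem_Collect_eq
proof
  fix e' show "weak_deriv (len e') (fst (extend e y) e') (snd (extend e y) e')"
    using assms weak_deriv_const by (cases "e' = e") (simp_all add: extend_def H1_space_def)
qed

lemma energy_edges:
  "energy len \<kappa> a x y = (\<Sum>e\<in>UNIV. energy (\<lambda>_. len e) (\<lambda>_. \<kappa> e) (\<lambda>_. a e) (edge_part e x) (edge_part e y))"
  by (simp add: energy_def edge_part_def UNIV_unit)

text \<open>Extension by 0 and restriction to an edge are adjoint for the energy. A representer on a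
  single edge, extended by 0, therefore represents the same point evaluation on
  \<open>H1_space len\<close>.\<close>

lemma energy_extend: "energy len \<kappa> a (extend e y) x = energy (\<lambda>_. len e) (\<lambda>_. \<kappa> e) (\<lambda>_. a e) y (edge_part e x)"
proof -
  have 0: "energy l k b 0 z = 0" for l k b and z :: "unit graph_fun \<times> unit graph_fun"
    by (simp add: energy_def)
  have "energy len \<kappa> a (extend e y) x =
    (\<Sum>e'\<in>UNIV. if e' = e then energy (\<lambda>_. len e) (\<lambda>_. \<kappa> e) (\<lambda>_. a e) y (edge_part e x) else 0)"
    unfolding energy_edges[of len] edge_part_extend by (intro sum.cong refl) (simp add: 0)
  then show ?thesis by simp
qed

lemma sum_by_fst:
  fixes I :: "('e::finite \<times> 't) set"
  assumes "finite I"
  shows "(\<Sum>p\<in>I. g p) = (\<Sum>e\<in>UNIV. \<Sum>t\<in>{t. (e, t) \<in> I}. g (e, t))"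
proof -
  have fin: "finite {t. (e, t) \<in> I}" for e
    by (rule finite_subset[OF _ finite_imageI[OF assms, of snd]]) force
  have "I = Sigma UNIV (\<lambda>e. {t. (e, t) \<in> I})" by auto
  then have "(\<Sum>p\<in>I. g p) = (\<Sum>p\<in>Sigma UNIV (\<lambda>e. {t. (e, t) \<in> I}). g p)" by (rule arg_cong)
  also have "\<dots> = (\<Sum>e\<in>UNIV. \<Sum>t\<in>{t. (e, t) \<in> I}. g (e, t))"
    using sum.Sigma[of UNIV "\<lambda>e. {t. (e, t) \<in> I}" "\<lambda>e t. g (e, t)"] fin by simp
  finally show ?thesis .
qed

text \<open>The two endpoints of the single edge are different vertices, so continuity imposes no
  condition.\<close>

lemma interval_H1: "H1_graph (\<lambda>_::unit. False) (\<lambda>_. True) len = H1_space len"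
proof (intro equalityI subsetI)
  fix x assume x: "x \<in> H1_space len"
  have "j = j'" if "endpt (\<lambda>_::unit. False) (\<lambda>_. True) j = endpt (\<lambda>_. False) (\<lambda>_. True) j'" for j j'
    using that by (simp add: endpt_def prod_eq_iff split: if_splits)
  then show "x \<in> H1_graph (\<lambda>_::unit. False) (\<lambda>_. True) len"
    using x by (intro H1_graphI) auto
qed (rule H1_graph_space)

text \<open>All that is kept of an edge field: representers of its points and the Gaussian law that
  they determine. Eigenbasis and noise are hidden, so only \<open>r\<close> has to be chosen for
  every edge.\<close>

definition interval_representation ::
  "real \<Rightarrow> (real \<Rightarrow> real) \<Rightarrow> (real \<Rightarrow> real) \<Rightarrow> real \<Rightarrow> 'w measure \<Rightarrow> (real \<Rightarrow> 'w \<Rightarrow> real) \<Rightarrow>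
   (real \<Rightarrow> unit graph_fun \<times> unit graph_fun) \<Rightarrow> bool" where
  "interval_representation l \<kappa> a \<tau> M X r \<longleftrightarrow>
     (\<forall>t\<in>{0..l}. r t \<in> H1_space (\<lambda>_. l) \<and>
        (\<forall>x\<in>H1_space (\<lambda>_. l). energy (\<lambda>_. l) (\<lambda>_. \<kappa>) (\<lambda>_. a) (r t) x = fst x () t)) \<and>
     (\<forall>I c. finite I \<longrightarrow> I \<subseteq> {0..l} \<longrightarrow> char (distr M borel (\<lambda>\<omega>. \<Sum>t\<in>I. c t * X t \<omega>)) 1 = complex_of_real
        (exp (- (energy (\<lambda>_. l) (\<lambda>_. \<kappa>) (\<lambda>_. a) (\<Sum>t\<in>I. c t *\<^sub>R r t) (\<Sum>t\<in>I. c t *\<^sub>R r t) / \<tau>\<^sup>2) / 2)))"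

lemma interval_representation_exists:
  assumes coeffs: "graph_coeffs (\<lambda>_::unit. l) (\<lambda>_. \<kappa>) (\<lambda>_. a) \<kappa>0 C\<kappa> a0 Ca La"
    and prob: "prob_space M" and field: "edge_WM_field l \<kappa> a 1 \<tau> M X" and meas: "\<And>t. X t \<in> borel_measurable M"
  shows "\<exists>r. interval_representation l \<kappa> a \<tau> M X r"
proof -
  interpret graph_coeffs "\<lambda>_::unit. l" "\<lambda>_. \<kappa>" "\<lambda>_. a" \<kappa>0 C\<kappa> a0 Ca La by (rule coeffs)
  interpret graph_form "\<lambda>_::unit. l" "\<lambda>_. \<kappa>" "\<lambda>_. a" \<kappa>0 C\<kappa> a0 Ca La "\<lambda>_. False" "\<lambda>_. True" by unfold_locales
  from field obtain lam \<phi> \<xi> where eb: "eigenbasis (\<lambda>_::unit. False) (\<lambda>_. True) (\<lambda>_. l) (\<lambda>_. \<kappa>) (\<lambda>_. a) lam \<phi>"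
    and \<xi>: "prob_space.indep_vars M (\<lambda>_. borel) \<xi> UNIV" "\<forall>k. distr M borel (\<xi> k) = std_normal_distribution"
    and lim: "\<forall>e. \<forall>t\<in>{0..l}. AE \<omega> in M. (\<lambda>n. \<Sum>k<n. lam k powr (-1/2) * \<xi> k \<omega> * \<phi> k e t / \<tau>) \<longlonglongrightarrow> X t \<omega>"
    unfolding edge_WM_field_def WM_field_def by (elim exE conjE) (rule that)
  have gs: "gauss_seq M \<xi>" using \<xi> by (intro gauss_seq.intro gauss_seq_axioms.intro prob) auto
  obtain \<Phi> where wb: "weak_eigenbasis lam \<Phi>" and fst_\<Phi>: "\<And>k. fst (\<Phi> k) = \<phi> k"
    by (rule weak_eigenbasis_of_interval[OF coeffs eb]) (rule that)
  have "\<forall>t\<in>{0..l}. \<exists>r. r \<in> V \<and> (\<forall>x\<in>V. E r x = fst x () t)"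
  proof
    fix t assume t: "t \<in> {0..l}"
    obtain r where r: "r \<in> V" "\<And>x. x \<in> V \<Longrightarrow> E r x = fst x () t"
      by (rule representer[OF wb, of t "()"]) (rule t, rule that)
    show "\<exists>r. r \<in> V \<and> (\<forall>x\<in>V. E r x = fst x () t)"
      by (rule exI[of _ r]) (use r in simp)
  qed
  from bchoice[OF this] obtain r where r: "\<forall>t\<in>{0..l}. r t \<in> V \<and> (\<forall>x\<in>V. E (r t) x = fst x () t)" ..
  have "char (distr M borel (\<lambda>\<omega>. \<Sum>t\<in>I. c t * X t \<omega>)) 1 = complex_of_real
      (exp (- (E (\<Sum>t\<in>I. c t *\<^sub>R r t) (\<Sum>t\<in>I. c t *\<^sub>R r t) / \<tau>\<^sup>2) / 2))" if I: "finite I" "I \<subseteq> {0..l}" for I c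
  proof (rule field_char[OF wb gs I(1), where pe="\<lambda>_. ()" and pt="\<lambda>t. t"])
    show "r t \<in> V \<and> (\<forall>x\<in>V. E (r t) x = fst x () t)" if "t \<in> I" for t using r that I(2) by blast
    show "AE \<omega> in M. (\<lambda>n. \<Sum>k<n. lam k powr (-1/2) * \<xi> k \<omega> * fst (\<Phi> k) () t / \<tau>) \<longlonglongrightarrow> X t \<omega>" if "t \<in> I" for t
      unfolding fst_\<Phi> using lim that I(2) by blast
  qed (rule meas)
  then have "interval_representation l \<kappa> a \<tau> M X r"
    unfolding interval_representation_def using r unfolding interval_H1 by simp
  then show ?thesis by (rule exI[of _ r])
qed

text \<open>Independence factorizes the characteristic function over the edges and the energy is a
  sum over the edges, so the exponents add up to the energy of the combined vector. \<open>L\<close>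
  is the span of the pairs of a field value and its extended representer.\<close>

lemma (in graph_coeffs) independent_edges:
  fixes M :: "'w measure" and ut :: "'e \<Rightarrow> real \<Rightarrow> 'w \<Rightarrow> real"
  assumes prob: "prob_space M" and fields: "\<And>e. edge_WM_field (len e) (\<kappa> e) (a e) 1 \<tau> M (ut e)"
    and meas: "\<And>e t. ut e t \<in> borel_measurable M"
    and indep: "prob_space.indep_vars M (\<lambda>e. PiM {0..len e} (\<lambda>_. borel)) (\<lambda>e \<omega>. restrict (\<lambda>t. ut e t \<omega>) {0..len e}) UNIV"
  obtains \<rho> L where "isonormal M H E L (1 / \<tau>\<^sup>2)" "\<And>e t. t \<in> {0..len e} \<Longrightarrow> (ut e t, \<rho> e t) \<in> L"
    "\<And>e t x. t \<in> {0..len e} \<Longrightarrow> x \<in> H \<Longrightarrow> E (\<rho> e t) x = fst x e t"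
proof -
  interpret prob_space M by (rule prob)
  interpret H: psd_form H E by (rule E_psd)
  note [measurable] = meas
  have "graph_coeffs (\<lambda>_::unit. len e) (\<lambda>_. \<kappa> e) (\<lambda>_. a e) \<kappa>0 C\<kappa> a0 Ca La" for e
    by (intro graph_coeffs.intro len_pos \<kappa>_meas \<kappa>_bounds \<kappa>0_pos a0_pos a_lipschitz a_bounds)
  from choice[OF allI[OF interval_representation_exists[OF this prob fields meas]]]
  obtain r where r: "\<forall>e. interval_representation (len e) (\<kappa> e) (a e) \<tau> M (ut e) (r e)" ..
  define \<rho> where "\<rho> = (\<lambda>e t. extend e (r e t))"
  define P where "P = {p. snd p \<in> {0..len (fst p)}}"
  define g where "g = (\<lambda>p. (ut (fst p) (snd p), \<rho> (fst p) (snd p)))"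
  have rH: "r e t \<in> H1_space (\<lambda>_. len e)" and r_eval: "\<And>x. x \<in> H1_space (\<lambda>_. len e) \<Longrightarrow>
      energy (\<lambda>_. len e) (\<lambda>_. \<kappa> e) (\<lambda>_. a e) (r e t) x = fst x () t" if "t \<in> {0..len e}" for e t
    using r that unfolding interval_representation_def by blast+
  have r_char: "char (distr M borel (\<lambda>\<omega>. \<Sum>t\<in>I. c t * ut e t \<omega>)) 1 = complex_of_real (exp (- (energy (\<lambda>_. len e) (\<lambda>_. \<kappa> e) (\<lambda>_. a e)
      (\<Sum>t\<in>I. c t *\<^sub>R r e t) (\<Sum>t\<in>I. c t *\<^sub>R r e t) / \<tau>\<^sup>2) / 2))" if "finite I" "I \<subseteq> {0..len e}" for e I c
    using r[rule_format, of e, unfolded interval_representation_def, THEN conjunct2, rule_format, OF that] .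
  have \<rho>H: "\<rho> e t \<in> H" if "t \<in> {0..len e}" for e t unfolding \<rho>_def by (rule extend_H1[of "r e t" len e, OF rH[OF that]])
  have \<rho>_eval: "E (\<rho> e t) x = fst x e t" if "t \<in> {0..len e}" "x \<in> H" for e t x
    using r_eval[OF that(1) edge_part_H1[OF that(2)]] by (simp only: \<rho>_def energy_extend) (simp add: edge_part_def)
  have joint: "char (distr M borel (\<lambda>\<omega>. \<Sum>p\<in>I. c p * ut (fst p) (snd p) \<omega>)) 1 = complex_of_real
      (exp (- (1 / \<tau>\<^sup>2 * E (\<Sum>p\<in>I. c p *\<^sub>R \<rho> (fst p) (snd p)) (\<Sum>p\<in>I. c p *\<^sub>R \<rho> (fst p) (snd p))) / 2))"
    if I: "finite I" "I \<subseteq> P" for I c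
  proof -
    define J where "J = (\<lambda>e. {t. (e, t) \<in> I})"
    have J_sub: "J e \<subseteq> {0..len e}" for e using I(2) unfolding J_def P_def by auto
    have J_fin: "finite (J e)" for e
      unfolding J_def by (rule finite_subset[OF _ finite_imageI[OF I(1), of snd]]) force
    define y where "y = (\<Sum>p\<in>I. c p *\<^sub>R \<rho> (fst p) (snd p))"
    have part: "edge_part e y = (\<Sum>t\<in>J e. c (e, t) *\<^sub>R r e t)" for e
    proof -
      have "edge_part e y = (\<Sum>e'\<in>UNIV. \<Sum>t\<in>J e'. c (e', t) *\<^sub>R edge_part e (\<rho> e' t))"
        unfolding y_def edge_part_sum edge_part_scale sum_by_fst[OF I(1)] J_def by simp
      also have "\<dots> = (\<Sum>e'\<in>UNIV. if e' = e then \<Sum>t\<in>J e. c (e, t) *\<^sub>R r e t else 0)"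
        by (intro sum.cong refl) (simp add: \<rho>_def edge_part_extend)
      finally show ?thesis by simp
    qed
    define S where "S = (\<lambda>e \<omega>. \<Sum>t\<in>J e. c (e, t) * ut e t \<omega>)"
    \<comment> \<open>Independence is given for whole restricted paths, and a finite combination of
      values on one edge is a measurable function of the path on that edge.\<close>
    have "indep_vars (\<lambda>_. borel) (\<lambda>e \<omega>. \<Sum>t\<in>J e. c (e, t) * restrict (\<lambda>t. ut e t \<omega>) {0..len e} t) UNIV"
    proof (rule indep_vars_compose2[OF indep])
      show "(\<lambda>f. \<Sum>t\<in>J e. c (e, t) * f t) \<in> borel_measurable (PiM {0..len e} (\<lambda>_. borel))" for e
        using J_sub[of e] by (intro borel_measurable_sum borel_measurable_times measurable_const measurable_component_singleton) auto
    qed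
    moreover have "(\<Sum>t\<in>J e. c (e, t) * restrict (\<lambda>t. ut e t \<omega>) {0..len e} t) = S e \<omega>" for e \<omega>
      unfolding S_def using J_sub[of e] by (intro sum.cong refl) (simp add: subset_eq)
    ultimately have S: "indep_vars (\<lambda>_. borel) S UNIV" by simp
    have "(\<Sum>p\<in>I. c p * ut (fst p) (snd p) \<omega>) = (\<Sum>e\<in>UNIV. S e \<omega>)" for \<omega>
      unfolding sum_by_fst[OF I(1)] S_def J_def by simp
    then have "char (distr M borel (\<lambda>\<omega>. \<Sum>p\<in>I. c p * ut (fst p) (snd p) \<omega>)) 1 = (\<Prod>e\<in>UNIV. char (distr M borel (S e)) 1)"
      using char_distr_sum[OF S, of 1] by simp
    also have "\<dots> = (\<Prod>e\<in>UNIV. complex_of_real (exp (- (energy (\<lambda>_. len e) (\<lambda>_. \<kappa> e) (\<lambda>_. a e) (edge_part e y) (edge_part e y) / \<tau>\<^sup>2) / 2)))"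
    proof (rule prod.cong[OF refl])
      fix e
      show "char (distr M borel (S e)) 1 = complex_of_real (exp (- (energy (\<lambda>_. len e) (\<lambda>_. \<kappa> e) (\<lambda>_. a e) (edge_part e y) (edge_part e y) / \<tau>\<^sup>2) / 2))"
        unfolding part S_def by (rule r_char[OF J_fin J_sub])
    qed
    also have "\<dots> = complex_of_real (exp (\<Sum>e\<in>UNIV. - (energy (\<lambda>_. len e) (\<lambda>_. \<kappa> e) (\<lambda>_. a e) (edge_part e y) (edge_part e y) / \<tau>\<^sup>2) / 2))"
      by (simp only: of_real_prod exp_sum[OF finite])
    also have "(\<Sum>e\<in>UNIV. - (energy (\<lambda>_. len e) (\<lambda>_. \<kappa> e) (\<lambda>_. a e) (edge_part e y) (edge_part e y) / \<tau>\<^sup>2) / 2) = - (1 / \<tau>\<^sup>2 * E y y) / 2"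
      unfolding energy_edges[of len \<kappa> a] by (simp add: sum_divide_distrib sum_negf)
    finally show ?thesis by (simp only: y_def)
  qed
  have L: "isonormal M H E (span (g ` P)) (1 / \<tau>\<^sup>2)"
  proof (intro isonormal.intro isonormal_axioms.intro prob E_psd)
    show "subspace (span (g ` P))" "0 \<le> 1 / \<tau>\<^sup>2" by simp_all
    fix X x assume "(X, x) \<in> span (g ` P)"
    then obtain T c where T: "finite T" "T \<subseteq> g ` P" and Xx: "(X, x) = (\<Sum>v\<in>T. c v *\<^sub>R v)"
      unfolding span_explicit by blast
    \<comment> \<open>\<open>g\<close> may send different points to the same pair, so an index set
      on which it is injective is selected before reindexing.\<close>
    obtain I where I: "I \<subseteq> P" "inj_on g I" "T = g ` I" using T(2) unfolding subset_image_inj by blast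
    have fin: "finite I" using T(1) I finite_imageD by blast
    have eq: "(X, x) = (\<Sum>p\<in>I. c (g p) *\<^sub>R g p)" unfolding Xx I(3) sum.reindex[OF I(2)] by simp
    have X: "X = (\<lambda>\<omega>. \<Sum>p\<in>I. c (g p) * ut (fst p) (snd p) \<omega>)"
      using arg_cong[OF eq, of fst] by (simp add: g_def fst_sum fun_eq_iff sum_fun_apply)
    have x: "x = (\<Sum>p\<in>I. c (g p) *\<^sub>R \<rho> (fst p) (snd p))"
      using arg_cong[OF eq, of snd] by (simp add: g_def snd_sum)
    show "X \<in> borel_measurable M" unfolding X by measurable
    show "x \<in> H" unfolding x using I(1) by (intro H.V_sum H.V_scale \<rho>H) (auto simp: P_def)
    show "char (distr M borel X) 1 = complex_of_real (exp (- (1 / \<tau>\<^sup>2 * E x x) / 2))"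
      unfolding X x by (rule joint[OF fin I(1)])
  qed
  show thesis
  proof (rule that[OF L])
    show "(ut e t, \<rho> e t) \<in> span (g ` P)" if "t \<in> {0..len e}" for e t
      using that by (intro span_base image_eqI[of _ _ "(e, t)"]) (simp_all add: g_def P_def)
  qed (rule \<rho>_eval)
qed

section \<open>The conditioned field\<close>

context metric_graph
begin

text \<open>The projection of \<open>\<rho> e t\<close> onto the orthogonal complement of the vectors that represent the
  constraints lies in \<open>V\<close>, where it represents the evaluation at \<open>t\<close>.\<close>

lemma conditioned_representation:
  fixes K :: "'r::finite \<Rightarrow> 'e \<times> bool \<Rightarrow> real"
  assumes iso: "isonormal M H E L \<sigma>" and rep: "\<And>e t. t \<in> {0..len e} \<Longrightarrow> (ut e t, \<rho> e t) \<in> L"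
    and eval: "\<And>e t x. t \<in> {0..len e} \<Longrightarrow> x \<in> H \<Longrightarrow> E (\<rho> e t) x = fst x e t"
    and K: "\<And>x. (\<forall>r. (\<Sum>j\<in>UNIV. K r j * x j) = 0) \<longleftrightarrow> (\<forall>j j'. endpt src tgt j = endpt src tgt j' \<longrightarrow> x j = x j')"
    and t: "t \<in> {0..len e}"
  shows "\<exists>R \<pi>. (R, \<pi>) \<in> L \<and> \<pi> \<in> V \<and> (\<forall>x\<in>V. E \<pi> x = fst x e t) \<and>
    (AE \<omega> in M. ut e t \<omega> - real_cond_exp M (vimage_algebra (space M)
       (\<lambda>\<omega>. \<lambda>r. \<Sum>j\<in>UNIV. K r j * at_endpt len ut j \<omega>) (PiM UNIV (\<lambda>_. borel))) (ut e t) \<omega> = R \<omega>)"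
proof -
  interpret iso: isonormal M H E L \<sigma> by (rule iso)
  have pos: "endpt_pos len j \<in> {0..len (fst j)}" for j by (simp add: endpt_pos_def)
  \<comment> \<open>The vector of the r-th constraint: by \<open>eval\<close>,
    \<open>E (m r) x\<close> is the r-th row of \<open>K\<close> applied to the endpoint values of
    \<open>x\<close>, as \<open>Em\<close> states.\<close>
  define m where "m = (\<lambda>r. \<Sum>j\<in>UNIV. K r j *\<^sub>R \<rho> (fst j) (endpt_pos len j))"
  define Z where "Z = (\<lambda>r \<omega>. \<Sum>j\<in>UNIV. K r j * at_endpt len ut j \<omega>)"
  have Z: "(Z r, m r) \<in> L" for r
    unfolding Z_def m_def at_endpt_def by (rule iso.L_sum[OF rep[OF pos]])
  have mH: "m r \<in> H" for r by (rule iso.L_H[OF Z])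
  have \<rho>H: "\<rho> e t \<in> H" if "t \<in> {0..len e}" for e t by (rule iso.L_H[OF rep[OF that]])
  have Em: "E (m r) x = (\<Sum>j\<in>UNIV. K r j * at_endpt len (fst x) j)" if x: "x \<in> H" for r x
  proof -
    have "E (m r) x = (\<Sum>j\<in>UNIV. E (K r j *\<^sub>R \<rho> (fst j) (endpt_pos len j)) x)"
      unfolding m_def by (rule iso.sum_left[OF iso.V_scale[OF \<rho>H[OF pos]] x])
    then show ?thesis by (simp only: iso.scale_left[OF \<rho>H[OF pos] x] eval[OF pos x] at_endpt_def)
  qed
  obtain \<gamma> where \<gamma>: "\<forall>r\<in>UNIV. E (\<rho> e t - (\<Sum>s\<in>UNIV. \<gamma> s *\<^sub>R m s)) (m r) = 0"
    using iso.projection_exists[OF finite mH \<rho>H[OF t], of UNIV] by (rule exE)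
  define \<pi> where "\<pi> = \<rho> e t - (\<Sum>s\<in>UNIV. \<gamma> s *\<^sub>R m s)"
  define R where "R = (\<lambda>\<omega>. ut e t \<omega> - (\<Sum>r\<in>UNIV. \<gamma> r * Z r \<omega>))"
  have RL: "(R, \<pi>) \<in> L" unfolding R_def \<pi>_def by (rule iso.L_diff[OF rep[OF t] iso.L_sum[OF Z]])
  have \<pi>H: "\<pi> \<in> H" by (rule iso.L_H[OF RL])
  \<comment> \<open>Orthogonality to all \<open>m r\<close> places the endpoint values of
    \<open>\<pi>\<close> in the kernel of \<open>K\<close>, which by hypothesis means that they
    agree at common vertices.\<close>
  have "E (m r) \<pi> = 0" for r using \<gamma> iso.sym[OF mH \<pi>H] by (simp add: \<pi>_def)
  then have "\<forall>r. (\<Sum>j\<in>UNIV. K r j * at_endpt len (fst \<pi>) j) = 0" using Em[OF \<pi>H] by simp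
  then have \<pi>V: "\<pi> \<in> V" unfolding K by (intro H1_graphI[OF \<pi>H]) blast
  have \<pi>_eval: "E \<pi> x = fst x e t" if x: "x \<in> V" for x
  proof -
    have xH: "x \<in> H" using V_H[OF x] .
    \<comment> \<open>Conversely, the endpoint values of an \<open>x\<close> in \<open>V\<close> lie
      in the kernel of \<open>K\<close>, so the correction term of \<open>\<pi>\<close> does not
      change the product with \<open>x\<close>.\<close>
    have "\<forall>r. (\<Sum>j\<in>UNIV. K r j * at_endpt len (fst x) j) = 0" unfolding K using H1_graphD[OF x] by blast
    then have 0: "E (m r) x = 0" for r using Em[OF xH] by simp
    have "E (\<Sum>s\<in>UNIV. \<gamma> s *\<^sub>R m s) x = (\<Sum>s\<in>UNIV. E (\<gamma> s *\<^sub>R m s) x)"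
      by (rule iso.sum_left[OF iso.V_scale[OF mH] xH])
    also have "\<dots> = 0" by (simp add: iso.scale_left[OF mH xH] 0)
    finally show ?thesis
      unfolding \<pi>_def using iso.diff_left[OF \<rho>H[OF t] _ xH, of "\<Sum>s\<in>UNIV. \<gamma> s *\<^sub>R m s"] mH eval[OF t xH]
      by (simp add: iso.V_sum)
  qed
  have "AE \<omega> in M. real_cond_exp M (vimage_algebra (space M) (\<lambda>\<omega> r. Z r \<omega>) (PiM UNIV (\<lambda>_. borel))) (ut e t) \<omega> = (\<Sum>r\<in>UNIV. \<gamma> r * Z r \<omega>)"
    by (rule iso.conditional_expectation[OF Z rep[OF t]]) (use \<gamma> in blast)
  then have "AE \<omega> in M. ut e t \<omega> - real_cond_exp M (vimage_algebra (space M) (\<lambda>\<omega> r. Z r \<omega>) (PiM UNIV (\<lambda>_. borel))) (ut e t) \<omega> = R \<omega>"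
    by eventually_elim (simp add: R_def)
  then show ?thesis unfolding Z_def using RL \<pi>V \<pi>_eval by blast
qed

text \<open>At each point the squared coefficients sum to the energy of the representer divided by
  \<tau>^2, so the series converges almost surely. The last conclusion describes the
  finite-dimensional laws for any choice of representers.\<close>

lemma WM_field_exists:
  obtains Y where "WM_field src tgt len \<kappa> a 1 \<tau> gauss_seq_space Y"
    "\<And>e t. Y e t \<in> borel_measurable gauss_seq_space"
    "\<forall>(I :: nat set) pe pt r c. finite I \<longrightarrow> (\<forall>i\<in>I. pt i \<in> {0..len (pe i)}) \<longrightarrow>
        (\<forall>i\<in>I. r i \<in> V \<and> (\<forall>x\<in>V. E (r i) x = fst x (pe i) (pt i))) \<longrightarrow>
      char (distr gauss_seq_space borel (\<lambda>\<omega>. \<Sum>i\<in>I. c i * Y (pe i) (pt i) \<omega>)) 1 =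
        complex_of_real (exp (- (E (\<Sum>i\<in>I. c i *\<^sub>R r i) (\<Sum>i\<in>I. c i *\<^sub>R r i) / \<tau>\<^sup>2) / 2))"
proof -
  obtain lam \<Phi> where wb: "weak_eigenbasis lam \<Phi>" by (rule weak_eigenbasis_exists) (rule that)
  interpret G: gauss_seq gauss_seq_space "\<lambda>k \<omega>. \<omega> k" by (rule gauss_seq_space)
  define b where "b = (\<lambda>e t k. lam k powr (-1/2) * fst (\<Phi> k) e t / \<tau>)"
  \<comment> \<open>\<open>lim\<close> yields a measurable function even on outcomes where the
    series diverges; on the edges it is almost surely the limit.\<close>
  define Y where "Y = (\<lambda>e t \<omega>. lim (\<lambda>n. \<Sum>k<n. lam k powr (-1/2) * \<omega> k * fst (\<Phi> k) e t / \<tau>))"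
  have [measurable]: "(\<lambda>\<omega>. \<omega> k) \<in> borel_measurable gauss_seq_space" for k :: nat
    using G.indep unfolding G.indep_vars_def by blast
  have Y_meas: "Y e t \<in> borel_measurable gauss_seq_space" for e t
    unfolding Y_def by (rule borel_measurable_lim_metric) measurable
  have lim: "AE \<omega> in gauss_seq_space. (\<lambda>n. \<Sum>k<n. lam k powr (-1/2) * \<omega> k * fst (\<Phi> k) e t / \<tau>) \<longlonglongrightarrow> Y e t \<omega>"
    if t: "t \<in> {0..len e}" for e t
  proof -
    obtain r where r: "r \<in> V" "\<And>x. x \<in> V \<Longrightarrow> E r x = fst x e t"
      by (rule representer[OF wb t]) (rule that)
    have "summable (\<lambda>k. (b e t k)\<^sup>2)"
      using sums_summable[OF field_coefficients[OF wb, of "{()}" "\<lambda>_. r" "\<lambda>_. e" "\<lambda>_. t" "\<lambda>_. 1" \<tau>]] r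
      by (simp add: b_def)
    then have "AE \<omega> in gauss_seq_space. convergent (\<lambda>n. \<Sum>k<n. b e t k * \<omega> k)" by (rule G.series_AE_convergent)
    then show ?thesis
    proof eventually_elim
      case (elim \<omega>)
      have "b e t k * \<omega> k = lam k powr (-1/2) * \<omega> k * fst (\<Phi> k) e t / \<tau>" for k by (simp add: b_def)
      with elim have "convergent (\<lambda>n. \<Sum>k<n. lam k powr (-1/2) * \<omega> k * fst (\<Phi> k) e t / \<tau>)" by (simp only:)
      then show ?case unfolding Y_def convergent_LIMSEQ_iff .
    qed
  qed
  have "WM_field src tgt len \<kappa> a 1 \<tau> gauss_seq_space Y"
    unfolding WM_field_def
  proof (rule exI[of _ lam], rule exI[of _ "\<lambda>k. fst (\<Phi> k)"], rule exI[of _ "\<lambda>k \<omega>. \<omega> k"], intro conjI allI ballI)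
    show "eigenbasis src tgt len \<kappa> a lam (\<lambda>k. fst (\<Phi> k))" by (rule eigenbasis_of_weak[OF wb])
    show "G.indep_vars (\<lambda>_. borel) (\<lambda>k \<omega>. \<omega> k) UNIV" by (rule G.indep)
    show "distr gauss_seq_space borel (\<lambda>\<omega>. \<omega> k) = std_normal_distribution" for k by (rule G.std)
  qed (rule lim)
  then show thesis
  proof (rule that[OF _ Y_meas], intro allI impI)
    fix I :: "nat set" and pe pt r c
    assume I: "finite I" and pt: "\<forall>i\<in>I. pt i \<in> {0..len (pe i)}"
      and r: "\<forall>i\<in>I. r i \<in> V \<and> (\<forall>x\<in>V. E (r i) x = fst x (pe i) (pt i))"
    show "char (distr gauss_seq_space borel (\<lambda>\<omega>. \<Sum>i\<in>I. c i * Y (pe i) (pt i) \<omega>)) 1 =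
        complex_of_real (exp (- (E (\<Sum>i\<in>I. c i *\<^sub>R r i) (\<Sum>i\<in>I. c i *\<^sub>R r i) / \<tau>\<^sup>2) / 2))"
      by (rule field_char[OF wb gauss_seq_space I bspec[OF r] Y_meas lim[OF bspec[OF pt]]])
  qed
qed

text \<open>The vectors \<open>\<pi>\<close> behind the values of \<open>u\<close> are representers
  on \<open>V\<close>, so the same vectors compute the law of the field on the graph. Both sides are
  centred Gaussian with variance \<open>E (x c) (x c) / \<tau>\<^sup>2\<close>.\<close>

lemma has_WM_law_of_representation:
  assumes iso: "isonormal M H E L (1 / \<tau>\<^sup>2)" and u: "\<And>e t. u e t \<in> borel_measurable M"
    and rep: "\<And>e t. t \<in> {0..len e} \<Longrightarrow> \<exists>R \<pi>. (R, \<pi>) \<in> L \<and> \<pi> \<in> V \<and>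
      (\<forall>x\<in>V. E \<pi> x = fst x e t) \<and> (AE \<omega> in M. u e t \<omega> = R \<omega>)"
  shows "has_WM_law src tgt len \<kappa> a 1 \<tau> M u"
proof -
  interpret iso: isonormal M H E L "1 / \<tau>\<^sup>2" by (rule iso)
  interpret G: gauss_seq gauss_seq_space "\<lambda>k \<omega>. \<omega> k" by (rule gauss_seq_space)
  obtain Y where Y: "WM_field src tgt len \<kappa> a 1 \<tau> gauss_seq_space Y"
    and Y_meas: "\<And>e t. Y e t \<in> borel_measurable gauss_seq_space"
    and Y_char: "\<forall>(I :: nat set) pe pt r c. finite I \<longrightarrow> (\<forall>i\<in>I. pt i \<in> {0..len (pe i)}) \<longrightarrow>
        (\<forall>i\<in>I. r i \<in> V \<and> (\<forall>x\<in>V. E (r i) x = fst x (pe i) (pt i))) \<longrightarrow>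
      char (distr gauss_seq_space borel (\<lambda>\<omega>. \<Sum>i\<in>I. c i * Y (pe i) (pt i) \<omega>)) 1 =
        complex_of_real (exp (- (E (\<Sum>i\<in>I. c i *\<^sub>R r i) (\<Sum>i\<in>I. c i *\<^sub>R r i) / \<tau>\<^sup>2) / 2))"
    by (rule WM_field_exists[of \<tau>]) (rule that)
  have "same_fdd len M u gauss_seq_space Y"
    unfolding same_fdd_def
  proof (intro allI impI)
    fix ps :: "('e \<times> real) list" assume ps: "\<forall>p\<in>set ps. snd p \<in> {0..len (fst p)}"
    define I where "I = {..<length ps}"
    define pe where "pe = (\<lambda>i. fst (ps ! i))"
    define pt where "pt = (\<lambda>i. snd (ps ! i))"
    have I: "finite I" by (simp add: I_def)
    have pt: "pt i \<in> {0..len (pe i)}" if "i \<in> I" for i using ps that by (simp add: I_def pe_def pt_def)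
    have "\<forall>i\<in>I. \<exists>q. q \<in> L \<and> snd q \<in> V \<and> (\<forall>x\<in>V. E (snd q) x = fst x (pe i) (pt i)) \<and> (AE \<omega> in M. u (pe i) (pt i) \<omega> = fst q \<omega>)"
    proof
      fix i assume "i \<in> I"
      from rep[OF pt[OF this]] obtain R \<pi> where q: "(R, \<pi>) \<in> L" "\<pi> \<in> V" "\<forall>x\<in>V. E \<pi> x = fst x (pe i) (pt i)"
        "AE \<omega> in M. u (pe i) (pt i) \<omega> = R \<omega>" by (elim exE conjE) (rule that)
      show "\<exists>q. q \<in> L \<and> snd q \<in> V \<and> (\<forall>x\<in>V. E (snd q) x = fst x (pe i) (pt i)) \<and> (AE \<omega> in M. u (pe i) (pt i) \<omega> = fst q \<omega>)"
        by (rule exI[of _ "(R, \<pi>)"]) (simp add: q)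
    qed
    from bchoice[OF this] obtain q where q: "\<forall>i\<in>I. q i \<in> L \<and> snd (q i) \<in> V \<and> (\<forall>x\<in>V. E (snd (q i)) x = fst x (pe i) (pt i)) \<and>
      (AE \<omega> in M. u (pe i) (pt i) \<omega> = fst (q i) \<omega>)" ..
    define x where "x = (\<lambda>c. \<Sum>i\<in>I. c i *\<^sub>R snd (q i))"
    have comb: "(\<lambda>\<omega>. \<Sum>i\<in>I. c i * fst (q i) \<omega>, x c) \<in> L" for c
      unfolding x_def using q by (intro iso.L_sum) simp
    have AE_eq: "AE \<omega> in M. (\<Sum>i\<in>I. c i * u (pe i) (pt i) \<omega>) = (\<Sum>i\<in>I. c i * fst (q i) \<omega>)" for c
    proof -
      have "AE \<omega> in M. \<forall>i\<in>I. u (pe i) (pt i) \<omega> = fst (q i) \<omega>" using q by (intro AE_finite_allI I) blast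
      then show ?thesis by eventually_elim (simp cong: sum.cong)
    qed
    note [measurable] = u Y_meas iso.L_meas[OF comb]
    have Y_trig: "(LINT \<omega>|gauss_seq_space. cos (\<Sum>i\<in>I. c i * Y (pe i) (pt i) \<omega>)) = exp (- (E (x c) (x c) / \<tau>\<^sup>2) / 2)"
      "(LINT \<omega>|gauss_seq_space. sin (\<Sum>i\<in>I. c i * Y (pe i) (pt i) \<omega>)) = 0" for c
    proof -
      have "char (distr gauss_seq_space borel (\<lambda>\<omega>. \<Sum>i\<in>I. c i * Y (pe i) (pt i) \<omega>)) 1 = complex_of_real (exp (- (E (x c) (x c) / \<tau>\<^sup>2) / 2))"
        unfolding x_def by (rule Y_char[rule_format, OF I pt]) (use q in blast)+
      from G.trig_of_char[OF _ this]
      show "(LINT \<omega>|gauss_seq_space. cos (\<Sum>i\<in>I. c i * Y (pe i) (pt i) \<omega>)) = exp (- (E (x c) (x c) / \<tau>\<^sup>2) / 2)"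
        "(LINT \<omega>|gauss_seq_space. sin (\<Sum>i\<in>I. c i * Y (pe i) (pt i) \<omega>)) = 0" by simp_all
    qed
    have "distr M (PiM I (\<lambda>_. borel)) (\<lambda>\<omega>. \<lambda>i\<in>I. u (pe i) (pt i) \<omega>) =
      distr gauss_seq_space (PiM I (\<lambda>_. borel)) (\<lambda>\<omega>. \<lambda>i\<in>I. Y (pe i) (pt i) \<omega>)"
    proof (rule law_eqI_trig[OF iso.prob_space_axioms G.prob_space_axioms I u Y_meas])
      fix c
      have "(LINT \<omega>|M. cos (\<Sum>i\<in>I. c i * u (pe i) (pt i) \<omega>)) = (LINT \<omega>|M. cos (\<Sum>i\<in>I. c i * fst (q i) \<omega>))"
      proof (rule integral_cong_AE)
        show "AE \<omega> in M. cos (\<Sum>i\<in>I. c i * u (pe i) (pt i) \<omega>) = cos (\<Sum>i\<in>I. c i * fst (q i) \<omega>)"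
          using AE_eq[of c] by eventually_elim simp
        show "(\<lambda>\<omega>. cos (\<Sum>i\<in>I. c i * u (pe i) (pt i) \<omega>)) \<in> borel_measurable M" by measurable
        show "(\<lambda>\<omega>. cos (\<Sum>i\<in>I. c i * fst (q i) \<omega>)) \<in> borel_measurable M" by measurable
      qed
      also have "\<dots> = exp (- (1 / \<tau>\<^sup>2 * E (x c) (x c)) / 2)" by (rule iso.L_trig(1)[OF comb])
      finally show "(LINT \<omega>|M. cos (\<Sum>i\<in>I. c i * u (pe i) (pt i) \<omega>)) = (LINT \<omega>|gauss_seq_space. cos (\<Sum>i\<in>I. c i * Y (pe i) (pt i) \<omega>))"
        unfolding Y_trig by simp
      have "(LINT \<omega>|M. sin (\<Sum>i\<in>I. c i * u (pe i) (pt i) \<omega>)) = (LINT \<omega>|M. sin (\<Sum>i\<in>I. c i * fst (q i) \<omega>))"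
      proof (rule integral_cong_AE)
        show "AE \<omega> in M. sin (\<Sum>i\<in>I. c i * u (pe i) (pt i) \<omega>) = sin (\<Sum>i\<in>I. c i * fst (q i) \<omega>)"
          using AE_eq[of c] by eventually_elim simp
        show "(\<lambda>\<omega>. sin (\<Sum>i\<in>I. c i * u (pe i) (pt i) \<omega>)) \<in> borel_measurable M" by measurable
        show "(\<lambda>\<omega>. sin (\<Sum>i\<in>I. c i * fst (q i) \<omega>)) \<in> borel_measurable M" by measurable
      qed
      also have "\<dots> = 0" by (rule iso.L_trig(2)[OF comb])
      finally show "(LINT \<omega>|M. sin (\<Sum>i\<in>I. c i * u (pe i) (pt i) \<omega>)) = (LINT \<omega>|gauss_seq_space. sin (\<Sum>i\<in>I. c i * Y (pe i) (pt i) \<omega>))"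
        unfolding Y_trig .
    qed
    then show "distr M (PiM {..<length ps} (\<lambda>_. borel)) (\<lambda>\<omega>. \<lambda>i\<in>{..<length ps}. u (fst (ps ! i)) (snd (ps ! i)) \<omega>) =
      distr gauss_seq_space (PiM {..<length ps} (\<lambda>_. borel)) (\<lambda>\<omega>. \<lambda>i\<in>{..<length ps}. Y (fst (ps ! i)) (snd (ps ! i)) \<omega>)"
      by (simp only: I_def pe_def pt_def)
  qed
  with Y show ?thesis unfolding has_WM_law_def by blast
qed

end

lemma metric_graph_of_A1:
  assumes graph: "connected_metric_graph src tgt len" and A1: "assumption_A1 src tgt len \<kappa> a"
  obtains \<kappa>0 C\<kappa> a0 Ca La where "metric_graph len \<kappa> a \<kappa>0 C\<kappa> a0 Ca La src tgt"
proof -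
  from A1 obtain \<kappa>0 C\<kappa> a0 La where \<kappa>0: "0 < \<kappa>0" and \<kappa>: "\<forall>e. set_borel_measurable lborel {0..len e} (\<kappa> e) \<and>
        (AE t in lborel. t \<in> {0..len e} \<longrightarrow> \<kappa>0 \<le> \<kappa> e t \<and> \<bar>\<kappa> e t\<bar> \<le> C\<kappa>)"
    and a0: "0 < a0" and a: "\<forall>e. La-lipschitz_on {0..len e} (a e) \<and> (\<forall>t\<in>{0..len e}. a0 \<le> a e t)"
    and a_vertex: "\<forall>j j'. endpt src tgt j = endpt src tgt j' \<longrightarrow> at_endpt len a j = at_endpt len a j'"
    unfolding assumption_A1_def by (elim exE conjE) (rule that)
  have len: "0 < len e" for e using graph by (simp add: connected_metric_graph_def)
  have lip: "La-lipschitz_on {0..len e} (a e)" for e using a by blast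
  \<comment> \<open>On each edge the Lipschitz bound gives an upper bound from the value at 0; the
    sum over the edges serves all of them.\<close>
  define Ca where "Ca = (\<Sum>e\<in>UNIV. \<bar>a e 0\<bar> + La * len e)"
  have "a e t \<le> Ca" if t: "t \<in> {0..len e}" for e t
  proof -
    have La: "0 \<le> La" using lipschitz_on_nonneg[OF lip] .
    have "\<bar>a e t - a e 0\<bar> \<le> La * t"
      using lipschitz_onD[OF lip t, of 0] t by (simp add: dist_real_def)
    also have "\<dots> \<le> La * len e" using t La by (intro mult_left_mono) auto
    finally have "a e t \<le> \<bar>a e 0\<bar> + La * len e" by linarith
    also have "\<dots> \<le> Ca" unfolding Ca_def
      by (rule member_le_sum[of e UNIV "\<lambda>e. \<bar>a e 0\<bar> + La * len e"]) (use La less_imp_le[OF len] in auto)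
    finally show ?thesis .
  qed
  moreover have "\<kappa> e \<in> borel_measurable (Ivl (len e))" for e
    using \<kappa> unfolding set_borel_measurable_def by (simp add: borel_measurable_restrict_space_iff)
  moreover have "AE t in Ivl (len e). \<kappa>0 \<le> \<kappa> e t \<and> \<bar>\<kappa> e t\<bar> \<le> C\<kappa>" for e
    using \<kappa> unfolding AE_Ivl by blast
  ultimately have "graph_coeffs len \<kappa> a \<kappa>0 C\<kappa> a0 Ca La"
    using a by (intro graph_coeffs.intro len lip \<kappa>0 a0) auto
  then have "metric_graph len \<kappa> a \<kappa>0 C\<kappa> a0 Ca La src tgt"
    using a_vertex by (intro metric_graph.intro metric_graph_axioms.intro graph_form.intro) blast+
  then show thesis by (rule that)
qed

theorem mainTheorem15:
  fixes src tgt :: "'e::finite \<Rightarrow> 'v"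
    and len :: "'e \<Rightarrow> real"
    and \<kappa> a :: "'e \<Rightarrow> real \<Rightarrow> real"
    and \<tau> :: real
    and M :: "'w measure"
    and ut :: "'e \<Rightarrow> real \<Rightarrow> 'w \<Rightarrow> real"
    and K :: "'r::finite \<Rightarrow> 'e \<times> bool \<Rightarrow> real"
  assumes graph: "connected_metric_graph src tgt len"
    and A1: "assumption_A1 src tgt len \<kappa> a"
    and tau: "0 < \<tau>"
    and prob: "prob_space M"
    and edge_fields: "\<forall>e. edge_WM_field (len e) (\<kappa> e) (a e) 1 \<tau> M (ut e)"
    and meas: "\<forall>e t. ut e t \<in> borel_measurable M"
    and indep: "prob_space.indep_vars M (\<lambda>e. PiM {0..len e} (\<lambda>_. borel))
                  (\<lambda>e \<omega>. restrict (\<lambda>t. ut e t \<omega>) {0..len e}) UNIV"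
    and K: "\<forall>x :: 'e \<times> bool \<Rightarrow> real.
              (\<forall>r. (\<Sum>j\<in>UNIV. K r j * x j) = 0) \<longleftrightarrow>
              (\<forall>j j'. endpt src tgt j = endpt src tgt j' \<longrightarrow> x j = x j')"
  defines "u \<equiv> (\<lambda>e t \<omega>. ut e t \<omega> -
             real_cond_exp M
               (vimage_algebra (space M)
                  (\<lambda>\<omega>. \<lambda>r. \<Sum>j\<in>UNIV. K r j * at_endpt len ut j \<omega>)
                  (PiM UNIV (\<lambda>_::'r. borel)))
               (ut e t) \<omega>)"
  shows "(\<forall>j j'. endpt src tgt j = endpt src tgt j' \<longrightarrow>
            (AE \<omega> in M. at_endpt len u j \<omega> = at_endpt len u j' \<omega>))
         \<and> has_WM_law src tgt len \<kappa> a 1 \<tau> M u"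
proof -
  obtain \<kappa>0 C\<kappa> a0 Ca La where "metric_graph len \<kappa> a \<kappa>0 C\<kappa> a0 Ca La src tgt"
    by (rule metric_graph_of_A1[OF graph A1]) (rule that)
  then interpret metric_graph len \<kappa> a \<kappa>0 C\<kappa> a0 Ca La src tgt .
  obtain \<rho> L where iso: "isonormal M H E L (1 / \<tau>\<^sup>2)" and rep: "\<And>e t. t \<in> {0..len e} \<Longrightarrow> (ut e t, \<rho> e t) \<in> L"
    and eval: "\<And>e t x. t \<in> {0..len e} \<Longrightarrow> x \<in> H \<Longrightarrow> E (\<rho> e t) x = fst x e t"
    by (rule independent_edges[OF prob edge_fields[rule_format] meas[rule_format] indep]) (rule that)
  interpret iso: isonormal M H E L "1 / \<tau>\<^sup>2" by (rule iso)
  note [measurable] = meas[rule_format]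
  have u_rep: "\<exists>R \<pi>. (R, \<pi>) \<in> L \<and> \<pi> \<in> V \<and> (\<forall>x\<in>V. E \<pi> x = fst x e t) \<and> (AE \<omega> in M. u e t \<omega> = R \<omega>)"
    if "t \<in> {0..len e}" for e t
    unfolding u_def by (rule conditioned_representation[OF iso rep eval K[rule_format] that])
  have "AE \<omega> in M. at_endpt len u j \<omega> = at_endpt len u j' \<omega>" if j: "endpt src tgt j = endpt src tgt j'" for j j'
  proof -
    have pos: "endpt_pos len i \<in> {0..len (fst i)}" for i by (simp add: endpt_pos_def)
    obtain R \<pi> where R: "(R, \<pi>) \<in> L" "\<pi> \<in> V" "\<forall>x\<in>V. E \<pi> x = fst x (fst j) (endpt_pos len j)"
      "AE \<omega> in M. u (fst j) (endpt_pos len j) \<omega> = R \<omega>"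
      using u_rep[OF pos[of j]] by (elim exE conjE) (rule that)
    obtain R' \<pi>' where R': "(R', \<pi>') \<in> L" "\<pi>' \<in> V" "\<forall>x\<in>V. E \<pi>' x = fst x (fst j') (endpt_pos len j')"
      "AE \<omega> in M. u (fst j') (endpt_pos len j') \<omega> = R' \<omega>"
      using u_rep[OF pos[of j']] by (elim exE conjE) (rule that)
    have dV: "\<pi> - \<pi>' \<in> V" using H1_graph_subspace R(2) R'(2) by (rule subspace_diff)
    \<comment> \<open>Both vectors represent evaluations on \<open>V\<close>, so pairing their
      difference with itself, an element of \<open>V\<close>, gives the difference of its values at
      the two endpoints. It is 0 at a common vertex, hence \<open>R - R'\<close> has variance
      0.\<close>
    have "E (\<pi> - \<pi>') (\<pi> - \<pi>') = at_endpt len (fst (\<pi> - \<pi>')) j - at_endpt len (fst (\<pi> - \<pi>')) j'"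
      using iso.diff_left[OF V_H[OF R(2)] V_H[OF R'(2)] V_H[OF dV]] bspec[OF R(3) dV] bspec[OF R'(3) dV]
      by (simp only: at_endpt_def)
    also have "\<dots> = 0" using H1_graphD[OF dV j] by simp
    finally have "AE \<omega> in M. R \<omega> - R' \<omega> = 0" by (rule iso.L_null[OF iso.L_diff[OF R(1) R'(1)]])
    then show ?thesis using R(4) R'(4) by eventually_elim (simp add: at_endpt_def)
  qed
  moreover have "has_WM_law src tgt len \<kappa> a 1 \<tau> M u"
  proof (rule has_WM_law_of_representation[OF iso _ u_rep])
    show "u e t \<in> borel_measurable M" for e t
      unfolding u_def by (intro borel_measurable_diff borel_measurable_cond_exp2) measurable
  qed
  ultimately show ?thesis by blast
qed

end
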